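(* Assume $I=J=2$ and that there exists $c\in\mathcal C$ such that $e\cdot m_c<0$. Then there exist nonpreemptive scheduling control policies (N-SCPs) $(\Psi^{0,n},F^n,R^n)$, $n\in\mathbb N$, under which, for every $\varepsilon$ and $T$ satisfying $0<\varepsilon<T<\infty$, $$\lim_{n\to\infty}P\big(Y^n(t)=0\text{ for all }t\in[\varepsilon,T]\big)=1.$$
   Context: Parameters and fluid model. Let $I,J\ge 2$, $\mathcal I=\{1,\dots,I\}$ (customer classes), $\mathcal J=\{I+1,\dots,I+J\}$ (service stations). For each $n\in\mathbb N$ there are arrival rates $\lambda_i^n>0$, service rates $\mu_{ij}^n\ge 0$ and numbers of servers $N_j^n\in\mathbb N$. The set $\mathcal E=\{(i,j):\mu_{ij}^n>0\}$ does not depend on $n$; write $i\sim j$ if $(i,j)\in\mathcal E$. Elements of $\mathcal E$ are called activities, and $\mathcal G$ is the graph with vertex set $\mathcal I\cup\mathcal J$ and edge set $\mathcal E$. There are constants $\lambda_i,\nu_j\in(0,\infty)$, $\mu_{ij}\in(0,\infty)$ for $(i,j)\in\mathcal E$, $\mu_{ij}=0$ for $(i,j)\notin\mathcal E$, and $\hat\lambda_i,\hat\mu_{ij}\in\mathbb R$ such that $n^{-1}\lambda_i^n\to\lambda_i$, $\mu_{ij}^n\to\mu_{ij}$, $n^{-1}N_j^n\to\nu_j$ and $$n^{1/2}(n^{-1}\lambda_i^n-\lambda_i)\to\hat\lambda_i,\quad n^{1/2}(\mu_{ij}^n-\mu_{ij})\to\hat\mu_{ij},\quad n^{1/2}(n^{-1}N_j^n-\nu_j)\to0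 .$$ Let $\bar\mu_{ij}=\nu_j\mu_{ij}$ and consider the linear program: minimize $\rho\in\mathbb R_+$ subject to $\sum_{j}\bar\mu_{ij}\xi_{ij}=\lambda_i$, $\sum_i\xi_{ij}\le\rho$, $\xi_{ij}\ge0$ for all $i\in\mathcal I,j\in\mathcal J$. Standing assumption (heavy traffic): it has a unique optimal solution $(\xi^*,\rho^* )$, and $\sum_i\xi^*_{ij}=1$ for all $j\in\mathcal J$ (so $\rho^*=1$). Put $x_i^*=\sum_j\xi_{ij}^*\nu_j$. An activity is basic if $\xi^*_{ij}>0$; $\mathcal E_b$ is the set of basic activities, other activities are nonbasic. Standing assumption (complete resource pooling): the graph $\mathcal G_b$ with vertex set $\mathcal I\cup\mathcal J$ and edge set $\mathcal E_b$ is a tree. Simple cycles. $\mathcal C$ is the set of cycles that are subgraphs of $\mathcal G$ with exactly one edge being a nonbasic activity. If $c\in\mathcal C$ has nonbasic edge $(i_0,j_0)$, orient $c$ cyclically so that this edge is directed from $i_0$ to $j_0$: $i_0\to j_0\to i_1\to j_1\to\cdots\to i_k\to j_k\to i_0$. For an edge $(i,j)$ of $c$ (written $(i,j)\in c$), $s(c,i,j)=-1$ if in $c$ it is directed from $i$ to $j$, and $s(c,i,j)=1$ if directed from $j$ to $i$. Let $m_{i,c}=\sum_{j:(i,j)\in c}s(c,i,j)\mu_{ij}$, $m_c=(m_{i,c})_{i\in\mathcal I}\in\mathbb R^I$, and $e=(1,\dots,1)'$. Queueing model. On a complete probability space, let $\{\check U_i(k)\}_{k\in\mathbb N}$, $i\in\mathcal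 I$, be independent sequences of strictly positive i.i.d. random variables with mean $1$ and finite variance, and $A_i^n(t)=\sup\{l\ge0:\sum_{k=1}^l\check U_i(k)/\lambda_i^n\le t\}$ (arrivals). Let $S_{ij}^n$ be Poisson processes of rate $\mu_{ij}^n$ (the zero process if the rate is $0$), mutually independent and independent of the arrival processes. $A^n,S^n$ are the primitive processes. Initial data $X^{0,n}\in\mathbb Z_+^I$ are deterministic and satisfy $n^{-1/2}(X_i^{0,n}-nx_i^* )\to x_i$ for some constants $x_i\in\mathbb R$. The processes $X_i^n$ (class-$i$ customers in the system), $Y_i^n$ (class-$i$ customers in queue), $Z_j^n$ (idle servers at station $j$), $\Psi_{ij}^n$ (class-$i$ customers in service at station $j$) have cadlag paths and satisfy, for all $t\ge 0$, $i\in\mathcal I$, $j\in\mathcal J$: (a) $\Psi_{ij}^n(t)=0$ for $i\not\sim j$; (b) $X_i^n(t)=X_i^{0,n}+A_i^n(t)-\sum_{j}S_{ij}^n\big(\int_0^t\Psi_{ij}^n(s)ds\big)$; (c) $Y_i^n(t)+\sum_j\Psi_{ij}^n(t)=X_i^n(t)$; (d) $Z_j^n(t)+\sum_i\Psi_{ij}^n(t)=N_j^n$; (e) $Y_i^n(t)\ge0$, $Z_j^n(t)\ge0$, $\Psi_{ij}^n(t)\ge0$; and, in nonpreemptive scheduling, (f) $\Psi_{ij}^n(t)=\Psi_{ij}^n(0)+B_{ij}^n(t)-S_{ij}^n\big(\int_0^t\Psi_{ij}^n(s)ds\big)$, where $B_{ij}^n$ is a nondecreasing $\mathbb Z_+$-valued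 process that counts the class-$i$ customers routed to station $j$ (and $B_{ij}^n=0$ for $i\not\sim j$). Customers in service at time zero are assumed to begin service at that time. Let $\tau_k^{n,i}$ be the time of the $k$th jump of $A_i^n$ and $\Xi^n(t)=(X^n(t),Y^n(t),Z^n(t),\Psi^n(t))$. N-SCP. A triplet $(\Psi^{0,n},F^n,R^n)$ is a nonpreemptive scheduling control policy (N-SCP), and $X^n$ is the controlled process corresponding to it, to initial data $X^{0,n}$ and to primitive processes $A^n,S^n$, if: (i) $\Psi^{0,n}\in\mathbb Z_+^{IJ}$ and $\Psi^n(0)=\Psi^{0,n}$; in particular $\Psi_{ij}^{0,n}=0$ for $i\not\sim j$, $\sum_j\Psi^{0,n}_{ij}\le X_i^{0,n}$, $\sum_i\Psi_{ij}^{0,n}\le N_j^n$; (ii) $R^n=\{R^{n,i},i\in\mathcal I\}$, where each $R^{n,i}=\{R_k^{n,i}:k\in\mathbb N\}$ is a sequence of real-valued independent random variables, the sequences being mutually independent and independent of the primitive processes; (iii) $F^n=\{F_{ij}^n\}$ is a collection of measurable maps $F_{ij}^n:\mathbb R_+\times\mathbb Z_+^I\times\mathbb Z_+^I\times\mathbb Z_+^J\times\mathbb Z_+^{IJ}\times\mathbb R\to\mathbb Z_+$, and $B_{ij}^n(t)=\sum_{k:\tau_k^{n,i}\le t}F_{ij}^n(\tau_k^{n,i},\Xi^n(\tau_k^{n,i}-),R_k^{n,i})$ for $t\ge0$; (iv) (a)–(f) hold. *)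

theory Defs
  imports "HOL-Probability.Probability"
begin

section \<open>Bipartite graphs, trees and simple cycles\<close>

text \<open>
  Customer classes form the finite type \<open>'i\<close>, service stations the finite type \<open>'j\<close>; the vertices of
  the graphs are the elements of \<open>'i + 'j\<close>. A bipartite graph is given by its edge set
  \<open>E :: ('i \<times> 'j) set\<close>; the relation \<open>links E\<close> is its symmetric adjacency relation.
\<close>

definition links :: "('i \<times> 'j) set \<Rightarrow> ('i + 'j) rel" where
  "links E = (\<Union>(i, j)\<in>E. {(Inl i, Inr j), (Inr j, Inl i)})"

text \<open>The directed edges of a list of vertices that is read cyclically.\<close>

definition arcs_of :: "'v list \<Rightarrow> 'v rel" where
  "arcs_of vs = {(vs ! k, vs ! (Suc k mod length vs)) | k. k < length vs}"

definition is_cycle :: "('i \<times> 'j) set \<Rightarrow> ('i + 'j) list \<Rightarrow> bool" where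
  "is_cycle E vs \<longleftrightarrow> 3 \<le> length vs \<and> distinct vs \<and> arcs_of vs \<subseteq> links E"

definition is_tree :: "('i \<times> 'j) set \<Rightarrow> bool" where
  "is_tree E \<longleftrightarrow> (\<forall>u v. (u, v) \<in> (links E)\<^sup>*) \<and> (\<nexists>vs. is_cycle E vs)"

definition edges_of :: "('i + 'j) list \<Rightarrow> ('i \<times> 'j) set" where
  "edges_of vs = {(i, j). (Inl i, Inr j) \<in> arcs_of vs \<or> (Inr j, Inl i) \<in> arcs_of vs}"

text \<open>
  \<open>E\<close> is the set of activities and \<open>Eb\<close> the set of basic ones. A simple cycle is an (undirected) cycle,
  represented by its edge set, having exactly one nonbasic edge.
\<close>

definition simple_cycles :: "('i \<times> 'j) set \<Rightarrow> ('i \<times> 'j) set \<Rightarrow> ('i \<times> 'j) set set" where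
  "simple_cycles E Eb =
     {c. (\<exists>vs. is_cycle E vs \<and> c = edges_of vs) \<and> (\<exists>!e. e \<in> c \<and> e \<in> E - Eb)}"

text \<open>
  The orientation of a simple cycle: the arcs of the cyclic arrangement of its vertices
  in which the nonbasic edge is directed from its class to its station.
\<close>

definition oriented :: "('i \<times> 'j) set \<Rightarrow> ('i \<times> 'j) set \<Rightarrow> ('i \<times> 'j) set \<Rightarrow> ('i + 'j) rel" where
  "oriented E Eb c = \<Union>{arcs_of vs | vs. is_cycle E vs \<and> c = edges_of vs \<and>
     (\<exists>i0 j0. (i0, j0) \<in> E - Eb \<and> (Inl i0, Inr j0) \<in> arcs_of vs)}"

definition cyc_sign :: "('i \<times> 'j) set \<Rightarrow> ('i \<times> 'j) set \<Rightarrow> ('i \<times> 'j) set \<Rightarrow> 'i \<Rightarrow> 'j \<Rightarrow> real" where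
  "cyc_sign E Eb c i j = (if (Inl i, Inr j) \<in> oriented E Eb c then - 1 else 1)"

definition cyc_vec ::
    "('i \<times> 'j) set \<Rightarrow> ('i \<times> 'j) set \<Rightarrow> ('i \<Rightarrow> 'j \<Rightarrow> real) \<Rightarrow> ('i \<times> 'j) set \<Rightarrow> real ^ 'i::finite" where
  "cyc_vec E Eb \<mu> c = (\<chi> i. \<Sum>j | (i, j) \<in> c. cyc_sign E Eb c i j * \<mu> i j)"

section \<open>Parameters, the static linear program and the fluid model\<close>

definition lp_feasible ::
    "('i::finite \<Rightarrow> real) \<Rightarrow> ('i \<Rightarrow> 'j::finite \<Rightarrow> real) \<Rightarrow> ('j \<Rightarrow> real) \<Rightarrow> ('i \<Rightarrow> 'j \<Rightarrow> real) \<Rightarrow> real \<Rightarrow> bool" where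
  "lp_feasible lam \<mu> \<nu> \<xi> \<rho> \<longleftrightarrow> 0 \<le> \<rho> \<and>
     (\<forall>i. (\<Sum>j\<in>UNIV. (\<nu> j * \<mu> i j) * \<xi> i j) = lam i) \<and>
     (\<forall>j. (\<Sum>i\<in>UNIV. \<xi> i j) \<le> \<rho>) \<and> (\<forall>i j. 0 \<le> \<xi> i j)"

definition lp_optimal ::
    "('i::finite \<Rightarrow> real) \<Rightarrow> ('i \<Rightarrow> 'j::finite \<Rightarrow> real) \<Rightarrow> ('j \<Rightarrow> real) \<Rightarrow> ('i \<Rightarrow> 'j \<Rightarrow> real) \<Rightarrow> real \<Rightarrow> bool" where
  "lp_optimal lam \<mu> \<nu> \<xi> \<rho> \<longleftrightarrow> lp_feasible lam \<mu> \<nu> \<xi> \<rho> \<and>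
     (\<forall>\<xi>' \<rho>'. lp_feasible lam \<mu> \<nu> \<xi>' \<rho>' \<longrightarrow> \<rho> \<le> \<rho>')"

definition basic_activities :: "('i \<times> 'j) set \<Rightarrow> ('i \<Rightarrow> 'j \<Rightarrow> real) \<Rightarrow> ('i \<times> 'j) set" where
  "basic_activities E \<xi> = {(i, j) \<in> E. 0 < \<xi> i j}"

text \<open>
  The \<open>n\<close>th system, \<open>n \<ge> 1\<close>, has arrival rates \<open>lamn n i\<close>, service rates \<open>mun n i j\<close> and \<open>N n j\<close> servers
  at station \<open>j\<close>; \<open>(\<xi>, \<rho>)\<close> is the optimal solution of the linear program.
\<close>

locale fluid_model =
  fixes lamn :: "nat \<Rightarrow> 'i::finite \<Rightarrow> real"
    and mun :: "nat \<Rightarrow> 'i \<Rightarrow> 'j::finite \<Rightarrow> real"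
    and N :: "nat \<Rightarrow> 'j \<Rightarrow> nat"
    and E :: "('i \<times> 'j) set"
    and lam lamhat :: "'i \<Rightarrow> real"
    and \<mu> muhat :: "'i \<Rightarrow> 'j \<Rightarrow> real"
    and \<nu> :: "'j \<Rightarrow> real"
    and \<xi> :: "'i \<Rightarrow> 'j \<Rightarrow> real"
    and \<rho> :: real
  assumes card_classes: "2 \<le> CARD('i)"
    and card_stations: "2 \<le> CARD('j)"
    and lamn_pos: "\<And>n i. 1 \<le> n \<Longrightarrow> 0 < lamn n i"
    and mun_nonneg: "\<And>n i j. 1 \<le> n \<Longrightarrow> 0 \<le> mun n i j"
    and activities: "\<And>n. 1 \<le> n \<Longrightarrow> E = {(i, j). 0 < mun n i j}"
    and lam_pos: "\<And>i. 0 < lam i"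
    and nu_pos: "\<And>j. 0 < \<nu> j"
    and mu_pos: "\<And>i j. (i, j) \<in> E \<Longrightarrow> 0 < \<mu> i j"
    and mu_zero: "\<And>i j. (i, j) \<notin> E \<Longrightarrow> \<mu> i j = 0"
    and lam_lim: "\<And>i. (\<lambda>n. lamn n i / real n) \<longlonglongrightarrow> lam i"
    and mu_lim: "\<And>i j. (\<lambda>n. mun n i j) \<longlonglongrightarrow> \<mu> i j"
    and N_lim: "\<And>j. (\<lambda>n. real (N n j) / real n) \<longlonglongrightarrow> \<nu> j"
    and lamhat_lim: "\<And>i. (\<lambda>n. sqrt (real n) * (lamn n i / real n - lam i)) \<longlonglongrightarrow> lamhat i"
    and muhat_lim: "\<And>i j. (\<lambda>n. sqrt (real n) * (mun n i j - \<mu> i j)) \<longlonglongrightarrow> muhat i j"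
    and N_second_order: "\<And>j. (\<lambda>n. sqrt (real n) * (real (N n j) / real n - \<nu> j)) \<longlonglongrightarrow> 0"
    and optimal: "lp_optimal lam \<mu> \<nu> \<xi> \<rho>"
    and optimal_unique: "\<And>\<xi>' \<rho>'. lp_optimal lam \<mu> \<nu> \<xi>' \<rho>' \<Longrightarrow> \<xi>' = \<xi> \<and> \<rho>' = \<rho>"
    and heavy_traffic: "\<And>j. (\<Sum>i\<in>UNIV. \<xi> i j) = 1"
    and complete_resource_pooling: "is_tree (basic_activities E \<xi>)"

section \<open>Primitive processes\<close>

definition process_sets :: "'w measure \<Rightarrow> 't set \<Rightarrow> 'b measure \<Rightarrow> ('t \<Rightarrow> 'w \<Rightarrow> 'b) \<Rightarrow> 'w set set" where
  "process_sets M T N X =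
     sigma_sets (space M) (\<Union>t\<in>T. {X t -` B \<inter> space M | B. B \<in> sets N})"

text \<open>
  Sequences are indexed by \<open>k \<ge> 1\<close>. The supremum below is over an infinite set only on the null set
  on which \<open>\<Sum>k. u k \<omega>\<close> is finite; its value there is immaterial.
\<close>

definition arrivals :: "real \<Rightarrow> (nat \<Rightarrow> 'w \<Rightarrow> real) \<Rightarrow> real \<Rightarrow> 'w \<Rightarrow> nat" where
  "arrivals l u t \<omega> = Sup {m. (\<Sum>k=1..m. u k \<omega> / l) \<le> t}"

text \<open>The time of the \<open>k\<close>th jump, for a counting process \<open>a\<close> with unit jumps.\<close>

definition jump_time :: "(real \<Rightarrow> 'w \<Rightarrow> nat) \<Rightarrow> nat \<Rightarrow> 'w \<Rightarrow> real" where
  "jump_time a k \<omega> = Inf {t. 0 \<le> t \<and> k \<le> a t \<omega>}"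

definition poisson_process :: "'w measure \<Rightarrow> real \<Rightarrow> (real \<Rightarrow> 'w \<Rightarrow> nat) \<Rightarrow> bool" where
  "poisson_process M r S \<longleftrightarrow>
     (\<forall>t\<ge>0. S t \<in> measurable M (count_space UNIV)) \<and>
     (\<forall>\<omega>\<in>space M. S 0 \<omega> = 0 \<and> mono_on {0..} (\<lambda>t. S t \<omega>) \<and>
        (\<forall>t\<ge>0. continuous (at_right t) (\<lambda>s. S s \<omega>))) \<and>
     (\<forall>s t. 0 \<le> s \<and> s \<le> t \<longrightarrow>
        (\<forall>k. measure M {\<omega>\<in>space M. S t \<omega> - S s \<omega> = k} =
              (r * (t - s)) ^ k / fact k * exp (- (r * (t - s)))) \<and>
        prob_space.indep_set M (process_sets M {0..s} (count_space UNIV) S)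
          (process_sets M {t} (count_space UNIV) (\<lambda>t' \<omega>. S t' \<omega> - S s \<omega>)))"

locale queueing_model =
  fluid_model lamn mun N E lam lamhat \<mu> muhat \<nu> \<xi> \<rho> + prob_space M + complete_measure M
  for lamn :: "nat \<Rightarrow> 'i::finite \<Rightarrow> real"
    and mun :: "nat \<Rightarrow> 'i \<Rightarrow> 'j::finite \<Rightarrow> real"
    and N E lam lamhat \<mu> muhat \<nu> \<xi> \<rho>
    and M :: "'w measure" +
  fixes U :: "'i \<Rightarrow> nat \<Rightarrow> 'w \<Rightarrow> real"
    and S :: "nat \<Rightarrow> 'i \<Rightarrow> 'j \<Rightarrow> real \<Rightarrow> 'w \<Rightarrow> nat"
    and X0 :: "nat \<Rightarrow> 'i \<Rightarrow> nat"
    and x :: "'i \<Rightarrow> real"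
  assumes U_pos: "\<And>i k \<omega>. 1 \<le> k \<Longrightarrow> \<omega> \<in> space M \<Longrightarrow> 0 < U i k \<omega>"
    and U_indep: "indep_vars (\<lambda>_. borel) (\<lambda>(i, k). U i k) (UNIV \<times> {1..})"
    and U_ident: "\<And>i k. 1 \<le> k \<Longrightarrow> distr M borel (U i k) = distr M borel (U i 1)"
    and U_integrable: "\<And>i k. 1 \<le> k \<Longrightarrow> integrable M (U i k)"
    and U_mean: "\<And>i k. 1 \<le> k \<Longrightarrow> expectation (U i k) = 1"
    and U_finite_variance: "\<And>i k. 1 \<le> k \<Longrightarrow> integrable M (\<lambda>\<omega>. (U i k \<omega>)\<^sup>2)"
    and S_poisson: "\<And>n i j. 1 \<le> n \<Longrightarrow> 0 < mun n i j \<Longrightarrow> poisson_process M (mun n i j) (S n i j)"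
    and S_zero: "\<And>n i j t \<omega>. 1 \<le> n \<Longrightarrow> mun n i j = 0 \<Longrightarrow> 0 \<le> t \<Longrightarrow> \<omega> \<in> space M \<Longrightarrow> S n i j t \<omega> = 0"
    and S_indep: "\<And>n. 1 \<le> n \<Longrightarrow> indep_sets
        (\<lambda>v. case v of
            None \<Rightarrow> sigma_sets (space M)
              (\<Union>i. process_sets M {0..} (count_space UNIV) (arrivals (lamn n i) (U i)))
          | Some (i, j) \<Rightarrow> process_sets M {0..} (count_space UNIV) (S n i j)) UNIV"
    and X0_lim: "\<And>i. (\<lambda>n. (real (X0 n i) - real n * (\<Sum>j\<in>UNIV. \<xi> i j * \<nu> j)) / sqrt (real n)) \<longlonglongrightarrow> x i"

section \<open>Nonpreemptive scheduling control policies\<close>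

definition cadlag :: "(real \<Rightarrow> 'b::topological_space) \<Rightarrow> bool" where
  "cadlag f \<longleftrightarrow> (\<forall>t\<ge>0. continuous (at_right t) f) \<and> (\<forall>t>0. \<exists>l. (f \<longlongrightarrow> l) (at_left t))"

definition left_lim :: "(real \<Rightarrow> 'b::t2_space) \<Rightarrow> real \<Rightarrow> 'b" where
  "left_lim f t = Lim (at_left t) f"

type_synonym ('i, 'j) routing_map =
  "real \<Rightarrow> ('i \<Rightarrow> nat) \<Rightarrow> ('i \<Rightarrow> nat) \<Rightarrow> ('j \<Rightarrow> nat) \<Rightarrow> ('i \<Rightarrow> 'j \<Rightarrow> nat) \<Rightarrow> real \<Rightarrow> nat"

text \<open>
  The routing process of an activity, built from the arrival process \<open>a\<close> of the class, the routing map
  \<open>f\<close> and the randomizing sequence \<open>r\<close>. Almost surely the sum is finite.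
\<close>

definition routing ::
    "(real \<Rightarrow> 'w \<Rightarrow> nat) \<Rightarrow> ('i, 'j) routing_map \<Rightarrow> (nat \<Rightarrow> 'w \<Rightarrow> real) \<Rightarrow>
     (real \<Rightarrow> 'w \<Rightarrow> 'i \<Rightarrow> nat) \<Rightarrow> (real \<Rightarrow> 'w \<Rightarrow> 'i \<Rightarrow> nat) \<Rightarrow> (real \<Rightarrow> 'w \<Rightarrow> 'j \<Rightarrow> nat) \<Rightarrow>
     (real \<Rightarrow> 'w \<Rightarrow> 'i \<Rightarrow> 'j \<Rightarrow> nat) \<Rightarrow> real \<Rightarrow> 'w \<Rightarrow> nat" where
  "routing a f r X Y Z \<Psi> t \<omega> =
     (\<Sum>k | 1 \<le> k \<and> jump_time a k \<omega> \<le> t.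
        let \<tau> = jump_time a k \<omega> in
        f \<tau> (\<lambda>i. left_lim (\<lambda>s. X s \<omega> i) \<tau>) (\<lambda>i. left_lim (\<lambda>s. Y s \<omega> i) \<tau>)
          (\<lambda>j. left_lim (\<lambda>s. Z s \<omega> j) \<tau>) (\<lambda>i j. left_lim (\<lambda>s. \<Psi> s \<omega> i j) \<tau>) (r k \<omega>))"

text \<open>
  \<open>N_SCP\<close> says that \<open>(\<Psi>0, F, R)\<close> is an N-SCP in a system with activities \<open>E\<close> and \<open>N j\<close> servers at
  station \<open>j\<close>, and that \<open>X\<close> (with \<open>Y\<close>, \<open>Z\<close>, \<open>\<Psi>\<close>) is the controlled process corresponding to it, to
  the initial data \<open>X0\<close> and to the primitive processes \<open>A\<close>, \<open>S\<close>. All counts are natural numbers, so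
  the nonnegativity constraints are part of the types; the balance equations are written without
  subtraction, because subtraction of natural numbers truncates. The pathwise conditions are required
  almost surely, since renewal paths may explode and independent Poisson processes may have
  simultaneous or multiple jumps on a null set.
\<close>

definition N_SCP ::
    "'w measure \<Rightarrow> ('i \<times> 'j) set \<Rightarrow> ('j \<Rightarrow> nat) \<Rightarrow> ('i \<Rightarrow> nat) \<Rightarrow>
     ('i \<Rightarrow> real \<Rightarrow> 'w \<Rightarrow> nat) \<Rightarrow> ('i \<Rightarrow> 'j \<Rightarrow> real \<Rightarrow> 'w \<Rightarrow> nat) \<Rightarrow>
     ('i \<Rightarrow> 'j \<Rightarrow> nat) \<Rightarrow> ('i \<Rightarrow> 'j \<Rightarrow> ('i, 'j) routing_map) \<Rightarrow> ('i \<Rightarrow> nat \<Rightarrow> 'w \<Rightarrow> real) \<Rightarrow>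
     (real \<Rightarrow> 'w \<Rightarrow> 'i::finite \<Rightarrow> nat) \<Rightarrow> (real \<Rightarrow> 'w \<Rightarrow> 'i \<Rightarrow> nat) \<Rightarrow>
     (real \<Rightarrow> 'w \<Rightarrow> 'j::finite \<Rightarrow> nat) \<Rightarrow> (real \<Rightarrow> 'w \<Rightarrow> 'i \<Rightarrow> 'j \<Rightarrow> nat) \<Rightarrow> bool" where
  "N_SCP M E N X0 A S \<Psi>0 F R X Y Z \<Psi> \<longleftrightarrow>
     (\<forall>i j. (i, j) \<notin> E \<longrightarrow> \<Psi>0 i j = 0) \<and>
     (\<forall>i. (\<Sum>j\<in>UNIV. \<Psi>0 i j) \<le> X0 i) \<and>
     (\<forall>j. (\<Sum>i\<in>UNIV. \<Psi>0 i j) \<le> N j) \<and>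
     (\<forall>i. prob_space.indep_vars M (\<lambda>_. borel) (R i) {1..}) \<and>
     prob_space.indep_sets M
       (\<lambda>v. case v of
           None \<Rightarrow> sigma_sets (space M)
             ((\<Union>i. process_sets M {0..} (count_space UNIV) (A i)) \<union>
              (\<Union>i j. process_sets M {0..} (count_space UNIV) (S i j)))
         | Some i \<Rightarrow> process_sets M {1..} borel (R i)) UNIV \<and>
     (\<forall>i j. (\<lambda>(t, x, y, z, p, r). F i j t x y z p r) \<in> measurable
        (restrict_space borel {0..} \<Otimes>\<^sub>M count_space UNIV \<Otimes>\<^sub>M count_space UNIV \<Otimes>\<^sub>M
         count_space UNIV \<Otimes>\<^sub>M count_space UNIV \<Otimes>\<^sub>M borel) (count_space UNIV)) \<and>
     (\<forall>t\<ge>0. (\<forall>i. (\<lambda>\<omega>. X t \<omega> i) \<in> measurable M (count_space UNIV)) \<and>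
            (\<forall>i. (\<lambda>\<omega>. Y t \<omega> i) \<in> measurable M (count_space UNIV)) \<and>
            (\<forall>j. (\<lambda>\<omega>. Z t \<omega> j) \<in> measurable M (count_space UNIV)) \<and>
            (\<forall>i j. (\<lambda>\<omega>. \<Psi> t \<omega> i j) \<in> measurable M (count_space UNIV))) \<and>
     (AE \<omega> in M.
        (\<forall>i. cadlag (\<lambda>t. X t \<omega> i)) \<and> (\<forall>i. cadlag (\<lambda>t. Y t \<omega> i)) \<and>
        (\<forall>j. cadlag (\<lambda>t. Z t \<omega> j)) \<and> (\<forall>i j. cadlag (\<lambda>t. \<Psi> t \<omega> i j)) \<and>
        (\<forall>i j. \<Psi> 0 \<omega> i j = \<Psi>0 i j) \<and>
        (\<forall>t\<ge>0. \<forall>i j.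
           ((i, j) \<notin> E \<longrightarrow> \<Psi> t \<omega> i j = 0) \<and>
           X t \<omega> i + (\<Sum>j'\<in>UNIV. S i j' (integral {0..t} (\<lambda>s. real (\<Psi> s \<omega> i j'))) \<omega>)
             = X0 i + A i t \<omega> \<and>
           Y t \<omega> i + (\<Sum>j'\<in>UNIV. \<Psi> t \<omega> i j') = X t \<omega> i \<and>
           Z t \<omega> j + (\<Sum>i'\<in>UNIV. \<Psi> t \<omega> i' j) = N j \<and>
           \<Psi> t \<omega> i j + S i j (integral {0..t} (\<lambda>s. real (\<Psi> s \<omega> i j))) \<omega>
             = \<Psi> 0 \<omega> i j + routing (A i) (F i j) (R i) X Y Z \<Psi> t \<omega> \<and>
           ((i, j) \<notin> E \<longrightarrow> routing (A i) (F i j) (R i) X Y Z \<Psi> t \<omega> = 0)))"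

end

theory Submission
  imports Defs "HOL-Real_Asymp.Real_Asymp"
begin

text \<open>
  In a system with two classes and two stations, the hypothesis says that all four activities are
  available, that exactly one of them, \<open>(i0, j0)\<close>, is nonbasic, and that
  \<open>\<kappa> = \<mu> i0 j0 + \<mu> i1 j1 - \<mu> i0 j1 - \<mu> i1 j0\<close> is positive (\<open>simple_cycle_2x2\<close>). Moving a mass \<open>d\<close> of
  customers in service around the cycle, so that \<open>(i0, j0)\<close> and \<open>(i1, j1)\<close> gain \<open>d\<close> and the other two
  activities lose \<open>d\<close>, changes neither the class totals nor the station totals, but it raises the total
  service rate by \<open>\<kappa> d\<close>. A critically loaded system can thus serve faster than customers arrive and
  create idle servers. A constant shift does so only for a while, since its later effects on the
  class totals may be harmful; but if the shift grows like \<open>exp (growth * t)\<close> with a large rate, then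
  the immediate gain always dominates the delayed losses. With four explicit solutions of the linear
  fluid equations, \<open>station_gain\<close> shows that both stations then have idle capacity proportional to
  \<open>t\<close>. On a bounded time interval such a shift stays negligible if its amplitude tends to zero, so the
  nonnegativity constraints of the fluid model are no obstacle. The amplitude used in the \<open>n\<close>th system
  is \<open>n powr (- 1 / 16)\<close> on the fluid scale, and the idle capacity is of order \<open>n powr (15 / 16) * t\<close>.

  No feedback is needed to follow these targets. The randomizing sequences are deterministic and tell,
  for the \<open>k\<close>th arrival of a class, to which station it goes; they are chosen such that the number of
  the first \<open>k\<close> arrivals sent to \<open>j0\<close> is the integer part of a prescribed curve. Every activity is
  then an infinite server system with an input that is known up to the fluctuations of the renewal
  process, and \<open>activity_tracking\<close>, a stability estimate for a Volterra equation, bounds the distance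
  from the target by a multiple of the fluctuations. By Chebyshev's inequality on a grid and
  monotonicity (\<open>grid_uniform\<close>), the fluctuations are of order at most \<open>n powr (3 / 4)\<close>. Initially every
  activity is kept \<open>n powr (13 / 16)\<close> customers below the shifted equilibrium. This is a cushion for small times,
  when the idle capacity is not yet larger than the fluctuations, and it leaves about
  \<open>2 * n powr (13 / 16)\<close> customers of every class in queue. After time \<open>n powr (- 1 / 16)\<close> the number of
  idle servers is at least of order \<open>n powr (14 / 16)\<close>, and the next arrival of a class takes the whole queue of its class
  into service.

  To be feasible under all circumstances, the policy routes an arrival only if both stations have
  enough idle servers. If some arrival were not admitted, then the first such arrival would find a
  state to which the estimates still apply, and would be admitted (\<open>all_admitted\<close>). Therefore the
  queues stay empty once they have been emptied (\<open>queue_empties\<close>).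

  That the policies are N-SCPs includes the existence of a controlled process. The construction from
  event to event in \<open>event_system\<close> provides it for every policy that respects the numbers of waiting
  customers and idle servers (\<open>controlled_process_exists\<close>); it uses that almost surely the service
  processes have unit jumps and are unbounded, and that the interarrival times have infinite sum.
\<close>

section \<open>The two-by-two cycle\<close>

lemma links_simps:
  "(Inl i, Inr j) \<in> links E \<longleftrightarrow> (i, j) \<in> E"
  "(Inr j, Inl i) \<in> links E \<longleftrightarrow> (i, j) \<in> E"
  "(Inl i, Inl i') \<notin> links E"
  "(Inr j, Inr j') \<notin> links E"
  by (auto simp: links_def)

lemma arcs_of_4: "arcs_of [a, b, c, d] = {(a, b), (b, c), (c, d), (d, a)}"
proof -
  have "arcs_of [a, b, c, d] = (\<lambda>k. ([a, b, c, d] ! k, [a, b, c, d] ! (Suc k mod 4))) ` {..<4}"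
    by (auto simp: arcs_of_def)
  also have "{..<4::nat} = {0, 1, 2, 3}" by auto
  finally show ?thesis by simp
qed

lemma arcs_of_3: "arcs_of [a, b, c] = {(a, b), (b, c), (c, a)}"
proof -
  have "arcs_of [a, b, c] = (\<lambda>k. ([a, b, c] ! k, [a, b, c] ! (Suc k mod 3))) ` {..<3}"
    by (auto simp: arcs_of_def)
  also have "{..<3::nat} = {0, 1, 2}" by auto
  finally show ?thesis by simp
qed

text \<open>Classes and stations alternate along a cycle, so in a graph with two vertices of either kind its length
  is four and it passes through every edge. The two lists are the possible types of the first vertex.\<close>

lemma is_cycle_2x2:
  fixes E :: "('i::finite \<times> 'j::finite) set"
  assumes "CARD('i) = 2" "CARD('j) = 2" "is_cycle E vs"
  obtains a b a' b' where "a \<noteq> a'" "b \<noteq> b'" "E = UNIV"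
    "vs = [Inl a, Inr b, Inl a', Inr b'] \<or> vs = [Inr b, Inl a', Inr b', Inl a]"
proof -
  have d: "distinct vs" and l3: "3 \<le> length vs" and arcs: "arcs_of vs \<subseteq> links E"
    using assms(3) by (auto simp: is_cycle_def)
  have "length vs = card (set vs)" using d by (simp add: distinct_card)
  also have "\<dots> \<le> card (UNIV :: ('i + 'j) set)" by (rule card_mono) auto
  also have "\<dots> = 4" using assms(1,2) by (simp add: card_UNIV_sum)
  finally have "length vs = 3 \<or> length vs = 4" using l3 by auto
  then show thesis
  proof
    assume "length vs = 3"
    then obtain u v w where vs: "vs = [u, v, w]"
      by (auto simp: length_Suc_conv eval_nat_numeral)
    show thesis
      using arcs unfolding vs arcs_of_3
      by (cases u; cases v; cases w) (simp_all add: links_simps)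
  next
    assume "length vs = 4"
    then obtain u v w z where vs: "vs = [u, v, w, z]"
      by (auto simp: length_Suc_conv eval_nat_numeral)
    have all: "E = UNIV" if "a \<noteq> a'" "b \<noteq> b'" "{(a,b),(a',b),(a',b'),(a,b')} \<subseteq> E" for a a' b b'
    proof -
      have U: "UNIV = {a, a'}" "UNIV = {b, b'}"
        using that assms(1,2) by (intro card_subset_eq[symmetric]; simp)+
      then       have "(i, j) \<in> E" for i j
      proof -
        have "i = a \<or> i = a'" "j = b \<or> j = b'" using U by auto
        then show ?thesis using that(3) by auto
      qed
      then show ?thesis by auto
    qed
    show thesis
    proof (cases u)
      case (Inl a)
      then obtain b where b: "v = Inr b" using arcs by (cases v) (auto simp: vs arcs_of_4 links_simps)
      then obtain a' where a': "w = Inl a'" using arcs by (cases w) (auto simp: vs arcs_of_4 links_simps)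
      then obtain b' where b': "z = Inr b'" using arcs by (cases z) (auto simp: vs arcs_of_4 links_simps)
      have "a \<noteq> a'" "b \<noteq> b'" using d Inl b a' b' by (auto simp: vs)
      moreover have "{(a,b),(a',b),(a',b'),(a,b')} \<subseteq> E"
        using arcs by (auto simp: vs arcs_of_4 links_simps Inl b a' b')
      ultimately show thesis using that[of a a' b b'] all[of a a' b b'] Inl b a' b' vs by simp
    next
      case (Inr b)
      then obtain a' where a': "v = Inl a'" using arcs by (cases v) (auto simp: vs arcs_of_4 links_simps)
      then obtain b' where b': "w = Inr b'" using arcs by (cases w) (auto simp: vs arcs_of_4 links_simps)
      then obtain a where a: "z = Inl a" using arcs by (cases z) (auto simp: vs arcs_of_4 links_simps)
      have "a \<noteq> a'" "b \<noteq> b'" using d Inr a b' a' by (auto simp: vs)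
      moreover have "{(a,b),(a',b),(a',b'),(a,b')} \<subseteq> E"
        using arcs by (auto simp: vs arcs_of_4 links_simps Inr a b' a')
      ultimately show thesis using that[of a a' b b'] all[of a a' b b'] Inr a b' a' vs by simp
    qed
  qed
qed

text \<open>The orientation of the cycle is forced by its nonbasic edge, hence \<open>oriented\<close>, which collects the arcs
  of all admissible arrangements, consists of the arcs of a single one.\<close>

lemma simple_cycle_2x2:
  fixes E :: "('i::finite \<times> 'j::finite) set"
  assumes card: "CARD('i) = 2" "CARD('j) = 2" and c: "c \<in> simple_cycles E Eb"
  obtains i0 i1 j0 j1 where "i0 \<noteq> i1" "j0 \<noteq> j1" "UNIV = {i0, i1}" "UNIV = {j0, j1}" "E = UNIV"
    "(i0, j0) \<notin> Eb" "(i0, j1) \<in> Eb" "(i1, j0) \<in> Eb" "(i1, j1) \<in> Eb"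
    "(\<chi> i. 1) \<bullet> cyc_vec E Eb \<mu> c = \<mu> i0 j1 + \<mu> i1 j0 - \<mu> i0 j0 - \<mu> i1 j1"
proof -
  from c obtain vs where vs: "is_cycle E vs" "c = edges_of vs" and ex1: "\<exists>!e. e \<in> c \<and> e \<in> E - Eb"
    by (auto simp: simple_cycles_def)
  have U2: "UNIV = {a, a'}" if "CARD('a) = 2" "a \<noteq> a'" for a a' :: "'a::finite"
    using that by (intro card_subset_eq[symmetric]; simp)
  obtain a b a' b' where ab: "a \<noteq> a'" "b \<noteq> b'" and E: "E = UNIV" and
    vs': "vs = [Inl a, Inr b, Inl a', Inr b'] \<or> vs = [Inr b, Inl a', Inr b', Inl a]"
    using is_cycle_2x2[OF card vs(1)] by metis
  have Uab: "UNIV = {a, a'}" "UNIV = {b, b'}" using U2 card ab by blast+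
  have cU: "c = UNIV"
  proof -
    have "(i, j) \<in> c" for i j
    proof -
      have "i = a \<or> i = a'" "j = b \<or> j = b'" using Uab by auto
      then show ?thesis using vs' unfolding vs(2) edges_of_def by (elim disjE) (auto simp: arcs_of_4)
    qed
    then show ?thesis by auto
  qed
  obtain i0 j0 where nb: "(i0, j0) \<notin> Eb" and uniq: "\<And>i j. (i, j) \<notin> Eb \<Longrightarrow> i = i0 \<and> j = j0"
    using ex1 unfolding cU E by (auto simp: Ex1_def)
  obtain i1 where i1: "i0 \<noteq> i1" using Uab(1) ab by (metis (full_types))
  obtain j1 where j1: "j0 \<noteq> j1" using Uab(2) ab by (metis (full_types))
  have U: "UNIV = {i0, i1}" "UNIV = {j0, j1}" using U2 card i1 j1 by blast+
  let ?o = "[Inl i0, Inr j0, Inl i1, Inr j1]"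
  have cyc: "is_cycle E ?o"
    using i1 j1 by (auto simp: is_cycle_def arcs_of_4 links_simps E)
  have edg: "c = edges_of ?o"
  proof -
    have "(i, j) \<in> edges_of ?o" for i j
    proof -
      have "i = i0 \<or> i = i1" "j = j0 \<or> j = j1" using U by auto
      then show ?thesis unfolding edges_of_def by (elim disjE) (auto simp: arcs_of_4)
    qed
    then show ?thesis using cU by auto
  qed
  have sub: "arcs_of ws = arcs_of ?o"
    if ws: "is_cycle E ws" and i: "(k0, l0) \<in> E - Eb" "(Inl k0, Inr l0) \<in> arcs_of ws" for ws k0 l0
  proof -
    have k: "k0 = i0" "l0 = j0" using uniq i by auto
    obtain p q p' q' where pq: "p \<noteq> p'" "q \<noteq> q'" and
      ws': "ws = [Inl p, Inr q, Inl p', Inr q'] \<or> ws = [Inr q, Inl p', Inr q', Inl p]"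
      using is_cycle_2x2[OF card ws] by metis
    have "(p = i0 \<and> p' = i1 \<or> p = i1 \<and> p' = i0)" "(q = j0 \<and> q' = j1 \<or> q = j1 \<and> q' = j0)"
      using pq UNIV_I[of p, unfolded U(1)] UNIV_I[of p', unfolded U(1)]
        UNIV_I[of q, unfolded U(2)] UNIV_I[of q', unfolded U(2)] by auto
    then show ?thesis using ws' i(2) i1 j1 unfolding k
      by (elim disjE conjE) (auto simp: arcs_of_4)
  qed
  have orient: "oriented E Eb c = arcs_of ?o"
  proof
    show "oriented E Eb c \<subseteq> arcs_of ?o"
      unfolding oriented_def using sub by fast
    have "(i0, j0) \<in> E - Eb" "(Inl i0, Inr j0) \<in> arcs_of ?o"
      using nb by (auto simp: E arcs_of_4)
    then show "arcs_of ?o \<subseteq> oriented E Eb c"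
      unfolding oriented_def using cyc edg by blast
  qed
  have sg: "cyc_sign E Eb c i0 j0 = - 1" "cyc_sign E Eb c i1 j1 = - 1"
    "cyc_sign E Eb c i0 j1 = 1" "cyc_sign E Eb c i1 j0 = 1"
    using i1 j1 by (auto simp: cyc_sign_def orient arcs_of_4)
  have sumI: "(\<Sum>i\<in>UNIV. f i) = f i0 + f i1" for f :: "'i \<Rightarrow> real"
    using i1 by (simp add: U(1))
  have sumJ: "(\<Sum>j\<in>UNIV. f j) = f j0 + f j1" for f :: "'j \<Rightarrow> real"
    using j1 by (simp add: U(2))
  have "(\<chi> i. 1) \<bullet> cyc_vec E Eb \<mu> c = \<mu> i0 j1 + \<mu> i1 j0 - \<mu> i0 j0 - \<mu> i1 j1"
    unfolding inner_vec_def cyc_vec_def cU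
    by (simp add: sumI sumJ sg[unfolded cU])
  moreover have "(i0, j1) \<in> Eb" "(i1, j0) \<in> Eb" "(i1, j1) \<in> Eb" using uniq i1 j1 by metis+
  ultimately show thesis using that i1 j1 U E nb by blast
qed

section \<open>Shifting work around the cycle\<close>

text \<open>The solution of \<open>y' = exp (b * t) - m * y\<close> with \<open>y 0 = 0\<close>.\<close>

definition exp_lag :: "real \<Rightarrow> real \<Rightarrow> real \<Rightarrow> real" where
  "exp_lag b m t = (exp (b * t) - exp (- (m * t))) / (b + m)"

text \<open>For large \<open>b\<close> the exponential lag depends on the service rate \<open>m\<close> only to the order \<open>1 / b\<close>. This is
  what makes the immediate effect of a growing shift dominate.\<close>

lemma exp_lag_bounds:
  assumes "0 < b" "0 < m" "0 \<le> t"
  shows "exp_lag b m t \<le> (exp (b * t) - 1) / b"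
    and "(exp (b * t) - 1) / (b + m) \<le> exp_lag b m t"
proof -
  have 1: "1 - m * t \<le> exp (- (m * t))" using exp_ge_add_one_self[of "- (m * t)"] by simp
  have 2: "b * t \<le> exp (b * t) - 1" using exp_ge_add_one_self[of "b * t"] by linarith
  have "b * (1 - exp (- (m * t))) \<le> b * (m * t)" using 1 assms by (intro mult_left_mono) auto
  also have "\<dots> = m * (b * t)" by simp
  also have "\<dots> \<le> m * (exp (b * t) - 1)" using assms by (intro mult_left_mono 2) auto
  finally have "(exp (b * t) - exp (- (m * t))) * b \<le> (exp (b * t) - 1) * (b + m)"
    by (simp add: algebra_simps)
  then show "exp_lag b m t \<le> (exp (b * t) - 1) / b"
    using assms unfolding exp_lag_def by (simp add: frac_le_eq divide_simps)
  show "(exp (b * t) - 1) / (b + m) \<le> exp_lag b m t"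
    using assms unfolding exp_lag_def by (intro divide_right_mono) auto
qed

text \<open>The mass in an activity with service rate \<open>m\<close> that starts with mass \<open>1\<close> and has the input rate
  \<open>(b + \<eta>) * exp (b * t)\<close>; see \<open>shift_profile_deriv\<close>.\<close>

definition shift_profile :: "real \<Rightarrow> real \<Rightarrow> real \<Rightarrow> real \<Rightarrow> real" where
  "shift_profile b \<eta> m t = exp (b * t) + (\<eta> - m) * exp_lag b m t"

lemma shift_profile_0 [simp]: "shift_profile b \<eta> m 0 = 1"
  by (simp add: shift_profile_def exp_lag_def)

lemma shift_profile_deriv:
  assumes "0 < b" "0 < m"
  shows "(shift_profile b \<eta> m has_real_derivative (b + \<eta>) * exp (b * t) - m * shift_profile b \<eta> m t) (at t)"
proof -
  have bm: "b + m \<noteq> 0" using assms by simp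
  have "(shift_profile b \<eta> m has_real_derivative
      b * exp (b * t) + (\<eta> - m) * ((b * exp (b * t) + m * exp (- (m * t))) / (b + m))) (at t)"
    unfolding shift_profile_def[abs_def] exp_lag_def
    by (rule derivative_eq_intros refl | simp add: bm)+
  also have "b * exp (b * t) + (\<eta> - m) * ((b * exp (b * t) + m * exp (- (m * t))) / (b + m))
     = (b + \<eta>) * exp (b * t) - m * shift_profile b \<eta> m t"
    using bm by (simp add: shift_profile_def exp_lag_def field_simps)
  finally show ?thesis .
qed

text \<open>The activities gain or lose mass with signs that alternate around the cycle. With the same input rate
  \<open>b * exp (b * t)\<close> for both classes the total mass would decrease by nearly \<open>\<kappa>\<close> times the lag, but possibly
  in one of the stations only. The surplus \<open>\<eta>\<close> in the rerouting of the second class divides the gain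
  equally between the two stations: each obtains \<open>\<kappa> / 2\<close> up to errors of relative order \<open>1 / b\<close>.\<close>

lemma station_gain:
  fixes m00 m01 m10 m11 b :: real
  defines "\<kappa> \<equiv> m00 + m11 - m01 - m10"
  defines "\<eta> \<equiv> (m10 - m00 + m11 - m01) / 2"
  assumes pos: "0 < m00" "0 < m01" "0 < m10" "0 < m11" and \<kappa>: "0 < \<kappa>" and t: "0 \<le> t"
    and b: "0 < b" "m00 \<le> b" "m01 \<le> b" "m10 \<le> b" "m11 \<le> b"
      "8 * m00\<^sup>2 \<le> \<kappa> * b" "8 * m01 * m11 \<le> \<kappa> * b"
  shows "shift_profile b 0 m00 t - shift_profile b \<eta> m10 t \<le> - (\<kappa> / 8) * t"
    and "shift_profile b \<eta> m11 t - shift_profile b 0 m01 t \<le> - (\<kappa> / 8) * t"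
proof -
  define D where "D = (exp (b * t) - 1) / b"
  have "b * t \<le> exp (b * t) - 1" using exp_ge_add_one_self[of "b * t"] by linarith
  then have D: "t \<le> D" unfolding D_def using b by (subst pos_le_divide_eq) (simp_all only: mult.commute[of t b])
  have D0: "0 \<le> D" using D t by simp
  have bm: "b / (b + m) * D \<le> exp_lag b m t" "exp_lag b m t \<le> D" if "0 < m" for m
    using exp_lag_bounds[of b m t] that b t by (auto simp: D_def)
  have half: "D / 2 \<le> exp_lag b m t" if "0 < m" "m \<le> b" for m
  proof -
    have "1 / 2 \<le> b / (b + m)" using that b by (simp add: field_simps)
    then have "1 / 2 * D \<le> b / (b + m) * D" using D0 by (intro mult_right_mono) auto
    then show ?thesis using bm(1)[OF that(1)] by linarith
  qed
  have diff: "exp_lag b m t - exp_lag b m' t \<le> m' / b * D" if "0 < m" "0 < m'" for m m'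
  proof -
    have "exp_lag b m t - exp_lag b m' t \<le> D - b / (b + m') * D" using bm that by (smt (verit))
    also have "\<dots> = m' / (b + m') * D" using b that by (simp add: field_simps)
    also have "\<dots> \<le> m' / b * D" using b that D0 by (intro mult_right_mono frac_le) auto
    finally show ?thesis .
  qed
  have "shift_profile b 0 m00 t - shift_profile b \<eta> m10 t = m00 * (exp_lag b m10 t - exp_lag b m00 t) - \<kappa> / 2 * exp_lag b m10 t"
    by (simp add: shift_profile_def \<kappa>_def \<eta>_def field_simps)
  also have "\<dots> \<le> m00 * (m00 / b * D) - \<kappa> / 2 * (D / 2)"
    using pos \<kappa> b by (intro diff_mono mult_left_mono diff half) auto
  also have "\<dots> = (m00\<^sup>2 / b - \<kappa> / 4) * D" by (simp add: power2_eq_square field_simps)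
  also have "\<dots> \<le> (- (\<kappa> / 8)) * D"
    using b D0 by (intro mult_right_mono) (auto simp: field_simps)
  also have "\<dots> \<le> - (\<kappa> / 8) * t" using D \<kappa> by simp
  finally show "shift_profile b 0 m00 t - shift_profile b \<eta> m10 t \<le> - (\<kappa> / 8) * t" .
  have "shift_profile b \<eta> m11 t - shift_profile b 0 m01 t = m01 * (exp_lag b m01 t - exp_lag b m11 t) - \<kappa> / 2 * exp_lag b m11 t"
    by (simp add: shift_profile_def \<kappa>_def \<eta>_def field_simps)
  also have "\<dots> \<le> m01 * (m11 / b * D) - \<kappa> / 2 * (D / 2)"
    using pos \<kappa> b by (intro diff_mono mult_left_mono diff half) auto
  also have "\<dots> = (m01 * m11 / b - \<kappa> / 4) * D" by (simp add: power2_eq_square field_simps)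
  also have "\<dots> \<le> (- (\<kappa> / 8)) * D"
    using b D0 by (intro mult_right_mono) (auto simp: field_simps)
  also have "\<dots> \<le> - (\<kappa> / 8) * t" using D \<kappa> by simp
  finally show "shift_profile b \<eta> m11 t - shift_profile b 0 m01 t \<le> - (\<kappa> / 8) * t" .
qed

section \<open>A Volterra estimate\<close>

text \<open>A right continuous function is the limit of the step functions that evaluate it at the next point
  of a grid strictly to the right.\<close>

lemma right_continuous_measurable:
  fixes f :: "real \<Rightarrow> real"
  assumes "\<And>t. 0 \<le> t \<Longrightarrow> continuous (at_right t) f"
  shows "(\<lambda>t. if 0 \<le> t then f t else 0) \<in> borel_measurable borel"
proof (rule borel_measurable_LIMSEQ_real)
  let ?g = "\<lambda>n t. if 0 \<le> t then f ((of_int \<lfloor>real (Suc n) * t\<rfloor> + 1) / real (Suc n)) else 0"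
  show "?g n \<in> borel_measurable borel" for n
  proof (rule measurable_If)
    have "(\<lambda>t. \<lfloor>real (Suc n) * t\<rfloor>) \<in> borel \<rightarrow>\<^sub>M count_space UNIV" by measurable
    then show "(\<lambda>t. f ((of_int \<lfloor>real (Suc n) * t\<rfloor> + 1) / real (Suc n))) \<in> borel_measurable borel"
      by (rule measurable_compose[where g="\<lambda>k::int. f ((of_int k + 1) / real (Suc n))"]) simp
  qed auto
  fix t :: real
  show "(\<lambda>n. ?g n t) \<longlonglongrightarrow> (if 0 \<le> t then f t else 0)"
  proof (cases "0 \<le> t")
    case True
    have lim: "(f \<longlongrightarrow> f t) (at_right t)" using assms[OF True] by (simp add: continuous_within)
    have fl: "filterlim (\<lambda>n. (of_int \<lfloor>real (Suc n) * t\<rfloor> + 1) / real (Suc n)) (at_right t) sequentially"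
    proof (rule tendsto_imp_filterlim_at_right)
      have *: "t < (of_int \<lfloor>real (Suc n) * t\<rfloor> + 1) / real (Suc n)" for n
        using floor_correct[of "real (Suc n) * t"] by (simp add: field_simps del: of_nat_Suc)
      have **: "(of_int \<lfloor>real (Suc n) * t\<rfloor> + 1) / real (Suc n) \<le> t + 1 / real (Suc n)" for n
        using floor_correct[of "real (Suc n) * t"] by (simp add: field_simps del: of_nat_Suc)
      show "(\<lambda>n. (of_int \<lfloor>real (Suc n) * t\<rfloor> + 1) / real (Suc n)) \<longlonglongrightarrow> t"
      proof (rule tendsto_sandwich[where f="\<lambda>_. t" and h="\<lambda>n. t + 1 / real (Suc n)"])
        show "(\<lambda>n. t + 1 / real (Suc n)) \<longlonglongrightarrow> t" by real_asymp
      qed (simp_all only: * ** less_imp_le eventually_True tendsto_const)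
      show "\<forall>\<^sub>F n in sequentially. t < (of_int \<lfloor>real (Suc n) * t\<rfloor> + 1) / real (Suc n)"
        using * by simp
    qed
    show ?thesis using True filterlim_compose[OF lim fl] by simp
  qed simp
qed

lemma bounded_right_continuous_integrable:
  fixes f :: "real \<Rightarrow> real"
  assumes rc: "\<And>t. 0 \<le> t \<Longrightarrow> continuous (at_right t) f"
    and bd: "\<And>t. 0 \<le> t \<Longrightarrow> t \<le> T \<Longrightarrow> \<bar>f t\<bar> \<le> B"
  shows "f integrable_on {0..T}"
proof (rule measurable_bounded_by_integrable_imp_integrable)
  have "(\<lambda>t. if 0 \<le> t then f t else 0) \<in> borel_measurable lebesgue"
    using right_continuous_measurable[OF rc] by (simp add: borel_measurable_if_I measurable_completion)
  then have "(\<lambda>t. if 0 \<le> t then f t else 0) \<in> borel_measurable (lebesgue_on {0..T})"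
    by (rule measurable_restrict_space1)
  then show "f \<in> borel_measurable (lebesgue_on {0..T})"
    by (rule measurable_cong[THEN iffD1, rotated]) auto
  show "(\<lambda>_. B) integrable_on {0..T}" by auto
qed (use bd in auto)

text \<open>The supremum \<open>L\<close> of \<open>exp (- (2 * m * t)) * \<bar>\<Delta> t\<bar>\<close> is finite, and inserting it in the equation gives
  \<open>L \<le> C + L / 2\<close>. The error \<open>e\<close> has jumps in the application, so the equation is not differentiated.\<close>

lemma volterra_bound:
  fixes \<Delta> e :: "real \<Rightarrow> real"
  assumes m: "0 < m" and int: "\<Delta> integrable_on {0..T}"
    and bd: "\<And>t. 0 \<le> t \<Longrightarrow> t \<le> T \<Longrightarrow> \<bar>\<Delta> t\<bar> \<le> B"
    and eq: "\<And>t. 0 \<le> t \<Longrightarrow> t \<le> T \<Longrightarrow> \<Delta> t = e t - m * integral {0..t} \<Delta>"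
    and err: "\<And>t. 0 \<le> t \<Longrightarrow> t \<le> T \<Longrightarrow> \<bar>e t\<bar> \<le> C"
    and t: "0 \<le> t" "t \<le> T"
  shows "\<bar>\<Delta> t\<bar> \<le> 2 * C * exp (2 * m * t)"
proof -
  define g where "g s = exp (- (2 * m * s)) * \<bar>\<Delta> s\<bar>" for s
  define L where "L = Sup (g ` {0..T})"
  have bdd: "bdd_above (g ` {0..T})"
  proof (rule bdd_aboveI2)
    fix s assume s: "s \<in> {0..T}"
    have "g s \<le> 1 * \<bar>\<Delta> s\<bar>" unfolding g_def using s m by (intro mult_right_mono) auto
    then show "g s \<le> B" using bd[of s] s by simp
  qed
  have gL: "g s \<le> L" if "0 \<le> s" "s \<le> T" for s
    unfolding L_def using that bdd by (intro cSUP_upper) auto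
  have le: "\<bar>\<Delta> s\<bar> \<le> L * exp (2 * m * s)" if "0 \<le> s" "s \<le> T" for s
  proof -
    have "\<bar>\<Delta> s\<bar> = g s * exp (2 * m * s)" by (simp add: g_def exp_minus field_simps)
    also have "\<dots> \<le> L * exp (2 * m * s)" using gL[OF that] by (intro mult_right_mono) auto
    finally show ?thesis .
  qed
  have "0 \<le> g 0" by (simp add: g_def)
  then have L0: "0 \<le> L" using gL[of 0] t by linarith
  have step: "g s \<le> C + L / 2" if s: "0 \<le> s" "s \<le> T" for s
  proof -
    have hi: "((\<lambda>u. L * exp (2 * m * u)) has_integral L * exp (2 * m * s) / (2 * m) - L * exp (2 * m * 0) / (2 * m)) {0..s}"
      using s m by (intro fundamental_theorem_of_calculus)
        (auto intro!: derivative_eq_intros simp: has_real_derivative_iff_has_vector_derivative[symmetric])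
    have "norm (integral {0..s} \<Delta>) \<le> integral {0..s} (\<lambda>u. L * exp (2 * m * u))"
      using s by (intro integral_norm_bound_integral has_integral_integrable[OF hi]
          integrable_subinterval_real[OF int]) (auto intro!: le)
    also have "\<dots> = L * (exp (2 * m * s) - 1) / (2 * m)"
      unfolding integral_unique[OF hi] by (simp add: diff_divide_distrib right_diff_distrib)
    finally have "m * \<bar>integral {0..s} \<Delta>\<bar> \<le> L * (exp (2 * m * s) - 1) / 2"
      using m by (simp add: field_simps)
    then have "\<bar>\<Delta> s\<bar> \<le> C + L * (exp (2 * m * s) - 1) / 2"
      using eq[OF s] err[OF s] m abs_mult[of m "integral {0..s} \<Delta>"] by (simp add: abs_le_iff) linarith
    also have "\<dots> \<le> (C + L / 2) * exp (2 * m * s)"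
    proof -
      have "0 \<le> C" using err[OF s] by linarith
      then have "C * 1 \<le> C * exp (2 * m * s)" using s m by (intro mult_left_mono) auto
      then show ?thesis using L0 by (simp add: field_simps)
    qed
    finally show ?thesis unfolding g_def by (simp add: exp_minus field_simps)
  qed
  have "L \<le> C + L / 2"
    by (subst L_def, rule cSUP_least) (use step t in auto)
  then have "L \<le> 2 * C" by simp
  then have "L * exp (2 * m * t) \<le> 2 * C * exp (2 * m * t)" by (rule mult_right_mono) simp
  with le[OF t] show ?thesis by (rule order.trans)
qed

section \<open>Tail estimates and typical paths of the primitive processes\<close>

lemma poisson_second_moment_sums:
  fixes a :: real
  shows "(\<lambda>k. (real k - a)\<^sup>2 * (a ^ k / fact k * exp (- a))) sums a"
proof -
  let ?f = "\<lambda>k. a ^ k / fact k :: real"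
  have 0: "?f sums exp a" using exp_converges[of a] by (simp add: divide_inverse mult.commute)
  have shift: "real (Suc k) * ?f (Suc k) = a * ?f k" for k
    by (simp add: fact_Suc del: of_nat_Suc)
  have 1: "(\<lambda>k. real k * ?f k) sums (a * exp a)"
  proof -
    have "(\<lambda>k. real (Suc k) * ?f (Suc k)) = (\<lambda>k. a * ?f k)" using shift by blast
    then have "(\<lambda>k. real (Suc k) * ?f (Suc k)) sums (a * exp a)" using sums_mult[OF 0, of a] by metis
    then show ?thesis by (subst (asm) sums_Suc_iff) simp
  qed
  have 2: "(\<lambda>k. real k * (real k - 1) * ?f k) sums (a * (a * exp a))"
  proof -
    have "(\<lambda>k. real (Suc k) * (real (Suc k) - 1) * ?f (Suc k)) = (\<lambda>k. a * (real k * ?f k))"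
    proof
      fix k
      have "real (Suc k) * (real (Suc k) - 1) * ?f (Suc k) = real k * (real (Suc k) * ?f (Suc k))" by simp
      then show "real (Suc k) * (real (Suc k) - 1) * ?f (Suc k) = a * (real k * ?f k)"
        unfolding shift by (simp add: ac_simps)
    qed
    then have "(\<lambda>k. real (Suc k) * (real (Suc k) - 1) * ?f (Suc k)) sums (a * (a * exp a))"
      using sums_mult[OF 1, of a] by metis
    then show ?thesis by (subst (asm) sums_Suc_iff) simp
  qed
  have "(\<lambda>k. (real k * (real k - 1) * ?f k + (1 - 2 * a) * (real k * ?f k) + a\<^sup>2 * ?f k) * exp (- a))
      sums ((a * (a * exp a) + (1 - 2 * a) * (a * exp a) + a\<^sup>2 * exp a) * exp (- a))"
    by (intro sums_mult2 sums_add sums_mult 0 1 2)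
  also have "(a * (a * exp a) + (1 - 2 * a) * (a * exp a) + a\<^sup>2 * exp a) * exp (- a) = a * (exp a * exp (- a))"
    by (simp add: algebra_simps power2_eq_square)
  also have "\<dots> = a" by (simp add: exp_minus)
  also have "(\<lambda>k. (real k * (real k - 1) * ?f k + (1 - 2 * a) * (real k * ?f k) + a\<^sup>2 * ?f k) * exp (- a))
    = (\<lambda>k. (real k - a)\<^sup>2 * (a ^ k / fact k * exp (- a)))"
    by (rule ext) (simp add: algebra_simps power2_eq_square add_divide_distrib diff_divide_distrib)
  finally show ?thesis .
qed

context prob_space
begin

lemma poisson_tail:
  fixes S :: "'a \<Rightarrow> nat"
  assumes [measurable]: "S \<in> M \<rightarrow>\<^sub>M count_space UNIV"
    and p: "\<And>k. prob {\<omega>\<in>space M. S \<omega> = k} = a ^ k / fact k * exp (- a)"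
    and y: "0 < y"
  shows "prob {\<omega>\<in>space M. y \<le> \<bar>real (S \<omega>) - a\<bar>} \<le> a / y\<^sup>2"
proof -
  let ?B = "\<lambda>k. {\<omega>\<in>space M. S \<omega> = k \<and> y \<le> \<bar>real k - a\<bar>}"
  have s1: "(\<lambda>k. prob (?B k)) sums prob (\<Union>k. ?B k)"
    by (intro finite_measure_UNION) (auto simp: disjoint_family_on_def)
  have s2: "prob (?B k) \<le> (real k - a)\<^sup>2 * (a ^ k / fact k * exp (- a)) * (1 / y\<^sup>2)" for k
  proof (cases "y \<le> \<bar>real k - a\<bar>")
    case True
    then have "y\<^sup>2 \<le> (real k - a)\<^sup>2" using y by (simp add: abs_le_square_iff[symmetric])
    then have "1 \<le> (real k - a)\<^sup>2 * (1 / y\<^sup>2)" using y by (simp add: field_simps)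
    moreover have "0 \<le> a ^ k / fact k * exp (- a)" using p[of k] by (metis measure_nonneg)
    ultimately have "1 * (a ^ k / fact k * exp (- a)) \<le> ((real k - a)\<^sup>2 * (1 / y\<^sup>2)) * (a ^ k / fact k * exp (- a))"
      by (rule mult_right_mono)
    moreover have "?B k = {\<omega>\<in>space M. S \<omega> = k}" using True by auto
    ultimately show ?thesis using p[of k] by (simp add: ac_simps)
  next
    case False
    have "0 \<le> a ^ k / fact k * exp (- a)" using p[of k] by (metis measure_nonneg)
    then have "0 \<le> (real k - a)\<^sup>2 * (a ^ k / fact k * exp (- a)) * (1 / y\<^sup>2)"
      by (rule mult_nonneg_nonneg[OF mult_nonneg_nonneg[OF zero_le_power2]]) simp
    then show ?thesis using False by simp
  qed
  have "prob (\<Union>k. ?B k) \<le> a * (1 / y\<^sup>2)"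
    by (rule sums_le[OF s2 s1 sums_mult2[OF poisson_second_moment_sums]])
  moreover have "(\<Union>k. ?B k) = {\<omega>\<in>space M. y \<le> \<bar>real (S \<omega>) - a\<bar>}" by auto
  ultimately show ?thesis by simp
qed

text \<open>Deterministic randomizing sequences generate the trivial \<open>\<sigma>\<close>-algebra, which is independent of
  every other one.\<close>

lemma indep_sets_trivial:
  assumes ev: "F i0 \<subseteq> events" and triv: "\<And>i. i \<in> I \<Longrightarrow> i \<noteq> i0 \<Longrightarrow> F i \<subseteq> {{}, space M}"
  shows "indep_sets F I"
proof (rule indep_setsI)
  fix i assume "i \<in> I" then show "F i \<subseteq> events" using ev triv[of i] by (cases "i = i0") auto
next
  fix A J assume J: "J \<noteq> {}" "J \<subseteq> I" "finite J" and A: "\<forall>j\<in>J. A j \<in> F j"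
  show "prob (\<Inter>j\<in>J. A j) = (\<Prod>j\<in>J. prob (A j))"
  proof (cases "\<exists>j\<in>J. A j = {}")
    case True
    then obtain j where j: "j \<in> J" "A j = {}" by blast
    then have "(\<Inter>j\<in>J. A j) = {}" "(\<Prod>j\<in>J. prob (A j)) = 0"
      using J by (auto intro!: prod_zero bexI[of _ j])
    then show ?thesis by simp
  next
    case False
    have sp: "A j = space M" if "j \<in> J" "j \<noteq> i0" for j
    proof -
      have "A j \<in> F j" "j \<in> I" using A J(2) that(1) by auto
      then have "A j \<in> {{}, space M}" using triv[of j] that(2) by blast
      then show ?thesis using False that(1) by auto
    qed
    show ?thesis
    proof (cases "i0 \<in> J")
      case True
      have "A i0 \<subseteq> space M" using True A ev sets.sets_into_space by blast
      then have "(\<Inter>j\<in>J. A j) = A i0" 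
      proof (intro equalityI INT_greatest)
        fix j assume "j \<in> J"
        then show "A i0 \<subseteq> A j" using \<open>A i0 \<subseteq> space M\<close> sp[of j] by (cases "j = i0") auto
      qed (rule INT_lower[OF True])
      moreover have "(\<Prod>j\<in>J. prob (A j)) = (\<Prod>j\<in>J. if j = i0 then prob (A i0) else 1)"
        using sp by (intro prod.cong) (auto simp: prob_space)
      ultimately show ?thesis using True J by (simp add: prod.delta)
    next
      case False
      then have all: "A j = space M" if "j \<in> J" for j using sp[OF that] that by metis
      then have "(\<Inter>j\<in>J. A j) = space M" using J by auto
      moreover have "(\<Prod>j\<in>J. prob (A j)) = 1" by (intro prod.neutral) (simp add: all prob_space)
      ultimately show ?thesis by (simp add: prob_space)
    qed
  qed
qed

lemma sigma_sets_trivial: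
  assumes "A \<subseteq> {{}, space M}"
  shows "sigma_sets (space M) A \<subseteq> {{}, space M}"
proof
  fix B assume "B \<in> sigma_sets (space M) A"
  then show "B \<in> {{}, space M}"
  proof induction
    case (Union a)
    then have "a i = {} \<or> a i = space M" for i by auto
    then show ?case by (cases "\<exists>i. a i = space M") (auto; blast)+
  qed (use assms in auto)
qed

lemma process_sets_const: "process_sets M T N (\<lambda>k \<omega>. c k) \<subseteq> {{}, space M}"
  unfolding process_sets_def by (rule sigma_sets_trivial) auto

lemma indep_vars_const:
  assumes "\<And>i. i \<in> I \<Longrightarrow> c i \<in> space (N i)"
  shows "indep_vars N (\<lambda>i \<omega>. c i) I"
  unfolding indep_vars_def
proof (intro conjI ballI indep_sets_trivial)
  let ?F = "\<lambda>i. sigma_sets (space M) {(\<lambda>\<omega>. c i) -` A \<inter> space M |A. A \<in> sets (N i)}"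
  show t: "?F i \<subseteq> {{}, space M}" for i by (rule sigma_sets_trivial) auto
  show "?F undefined \<subseteq> events" by (rule order.trans[OF t]) auto
qed (use assms in auto)


lemma indep_sum_second_moment:
  fixes V :: "'k \<Rightarrow> 'a \<Rightarrow> real"
  assumes "finite K" "indep_vars (\<lambda>_. borel) V K"
    "\<And>k. k \<in> K \<Longrightarrow> integrable M (V k)" "\<And>k. k \<in> K \<Longrightarrow> integrable M (\<lambda>\<omega>. (V k \<omega>)\<^sup>2)"
    "\<And>k. k \<in> K \<Longrightarrow> expectation (V k) = 0" "\<And>k. k \<in> K \<Longrightarrow> expectation (\<lambda>\<omega>. (V k \<omega>)\<^sup>2) \<le> v"
  shows "integrable M (\<lambda>\<omega>. \<Sum>k\<in>K. V k \<omega>) \<and> expectation (\<lambda>\<omega>. \<Sum>k\<in>K. V k \<omega>) = 0 \<and>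
    integrable M (\<lambda>\<omega>. (\<Sum>k\<in>K. V k \<omega>)\<^sup>2) \<and>
    expectation (\<lambda>\<omega>. (\<Sum>k\<in>K. V k \<omega>)\<^sup>2) \<le> real (card K) * v"
  using assms
proof (induction K rule: finite_induct)
  case (insert k K)
  let ?W = "\<lambda>\<omega>. \<Sum>k\<in>K. V k \<omega>"
  have IH: "integrable M ?W" "expectation ?W = 0" "integrable M (\<lambda>\<omega>. (?W \<omega>)\<^sup>2)"
    "expectation (\<lambda>\<omega>. (?W \<omega>)\<^sup>2) \<le> real (card K) * v"
    using insert.IH indep_vars_subset[OF insert.prems(1), of K] insert.prems by auto
  have Vk: "integrable M (V k)" "expectation (V k) = 0" "integrable M (\<lambda>\<omega>. (V k \<omega>)\<^sup>2)"
    "expectation (\<lambda>\<omega>. (V k \<omega>)\<^sup>2) \<le> v" using insert.prems by auto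
  have ind: "indep_var borel (V k) borel ?W"
    using insert.hyps insert.prems(1) by (rule indep_vars_sum)
  have i: "integrable M (\<lambda>\<omega>. V k \<omega> * ?W \<omega>)" using ind Vk(1) IH(1) by (rule indep_var_integrable)
  have e: "expectation (\<lambda>\<omega>. V k \<omega> * ?W \<omega>) = 0"
    using indep_var_lebesgue_integral[OF ind Vk(1) IH(1)] Vk(2) by simp
  have sq: "(\<Sum>k\<in>insert k K. V k \<omega>)\<^sup>2 = (V k \<omega>)\<^sup>2 + 2 * (V k \<omega> * ?W \<omega>) + (?W \<omega>)\<^sup>2" for \<omega>
    using insert.hyps by (simp add: power2_sum)
  show ?case
    unfolding sq using insert.hyps IH Vk i e by (simp add: algebra_simps)
qed simp

lemma indep_sum_tail:
  fixes V :: "'k \<Rightarrow> 'a \<Rightarrow> real"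
  assumes "finite K" "indep_vars (\<lambda>_. borel) V K"
    "\<And>k. k \<in> K \<Longrightarrow> integrable M (V k)" "\<And>k. k \<in> K \<Longrightarrow> integrable M (\<lambda>\<omega>. (V k \<omega>)\<^sup>2)"
    "\<And>k. k \<in> K \<Longrightarrow> expectation (V k) = 1" "\<And>k. k \<in> K \<Longrightarrow> expectation (\<lambda>\<omega>. (V k \<omega>)\<^sup>2) \<le> v"
    and y: "0 < y"
  shows "prob {\<omega>\<in>space M. y \<le> \<bar>(\<Sum>k\<in>K. V k \<omega>) - real (card K)\<bar>} \<le> real (card K) * v / y\<^sup>2"
proof -
  let ?V = "\<lambda>k \<omega>. V k \<omega> - 1"
  have i: "indep_vars (\<lambda>_. borel) ?V K"
    using indep_vars_compose2[OF assms(2), of "\<lambda>_ z. z - 1" "\<lambda>_. borel"] by simp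
  have sq: "(V k \<omega> - 1)\<^sup>2 = (V k \<omega>)\<^sup>2 - 2 * V k \<omega> + 1" for k \<omega>
    by (simp add: power2_eq_square algebra_simps)
  have "integrable M (\<lambda>\<omega>. \<Sum>k\<in>K. ?V k \<omega>) \<and> expectation (\<lambda>\<omega>. \<Sum>k\<in>K. ?V k \<omega>) = 0 \<and>
    integrable M (\<lambda>\<omega>. (\<Sum>k\<in>K. ?V k \<omega>)\<^sup>2) \<and>
    expectation (\<lambda>\<omega>. (\<Sum>k\<in>K. ?V k \<omega>)\<^sup>2) \<le> real (card K) * v"
    using assms by (intro indep_sum_second_moment i)
      (simp_all add: sq prob_space, smt (verit, ccfv_threshold))
  then have W: "integrable M (\<lambda>\<omega>. \<Sum>k\<in>K. ?V k \<omega>)" "expectation (\<lambda>\<omega>. \<Sum>k\<in>K. ?V k \<omega>) = 0"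
    "integrable M (\<lambda>\<omega>. (\<Sum>k\<in>K. ?V k \<omega>)\<^sup>2)"
    "expectation (\<lambda>\<omega>. (\<Sum>k\<in>K. ?V k \<omega>)\<^sup>2) \<le> real (card K) * v" by blast+
  have "prob {\<omega>\<in>space M. y \<le> \<bar>(\<Sum>k\<in>K. ?V k \<omega>) - 0\<bar>} \<le> expectation (\<lambda>\<omega>. (\<Sum>k\<in>K. ?V k \<omega>)\<^sup>2) / y\<^sup>2"
    using Chebyshev_inequality[of "\<lambda>\<omega>. \<Sum>k\<in>K. ?V k \<omega>" y] W y
    by (simp add: borel_measurable_integrable)
  also have "\<dots> \<le> real (card K) * v / y\<^sup>2" using W(4) by (intro divide_right_mono) auto
  finally show ?thesis by (simp add: sum_subtractf)
qed


text \<open>A bound at the points of a grid extends to all times, because between two neighbouring grid points a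
  nondecreasing process and its linear centering deviate by at most \<open>r * h\<close> more.\<close>

lemma grid_uniform:
  fixes g :: "real \<Rightarrow> 'a \<Rightarrow> real"
  assumes [measurable]: "\<And>l. g (real l * h) \<in> borel_measurable M"
    and mono: "\<And>\<omega> s t. \<omega> \<in> space M \<Longrightarrow> 0 \<le> s \<Longrightarrow> s \<le> t \<Longrightarrow> g s \<omega> \<le> g t \<omega>"
    and tail: "\<And>l. l \<le> L \<Longrightarrow> prob {\<omega>\<in>space M. y \<le> \<bar>g (real l * h) \<omega> - r * (real l * h)\<bar>} \<le> b"
    and h: "0 < h" and r: "0 \<le> r"
  obtains G where "G \<in> events" "1 - (real L + 1) * b \<le> prob G"
    "\<And>\<omega> s. \<omega> \<in> G \<Longrightarrow> 0 \<le> s \<Longrightarrow> s \<le> real L * h \<Longrightarrow> \<bar>g s \<omega> - r * s\<bar> \<le> y + r * h"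
proof -
  let ?B = "\<lambda>l. {\<omega>\<in>space M. y \<le> \<bar>g (real l * h) \<omega> - r * (real l * h)\<bar>}"
  let ?U = "\<Union>l\<in>{..L}. ?B l"
  have U: "?U \<in> events" by measurable
  have "prob ?U \<le> (\<Sum>l\<in>{..L}. prob (?B l))" by (rule finite_measure_subadditive_finite) auto
  also have "\<dots> \<le> (\<Sum>l\<in>{..L}. b)" using tail by (intro sum_mono) auto
  finally have "1 - (real L + 1) * b \<le> prob (space M - ?U)" using prob_compl[OF U] by (simp add: algebra_simps)
  moreover have "\<bar>g s \<omega> - r * s\<bar> \<le> y + r * h"
    if w: "\<omega> \<in> space M - ?U" and s: "0 \<le> s" "s \<le> real L * h" for s \<omega>
  proof -
    define l where "l = nat \<lfloor>s / h\<rfloor>"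
    have fl: "real l \<le> s / h" "s / h < real l + 1" using s h by (auto simp: l_def of_nat_nat)
    then have l: "real l * h \<le> s" "s < (real l + 1) * h"
      using h by (simp_all add: pos_le_divide_eq pos_divide_less_eq)
    have "real l \<le> s / h" by (rule fl)
    also have "\<dots> \<le> real L" using s h by (simp add: pos_divide_le_eq)
    finally have lL: "l \<le> L" by simp
    define u where "u = min (Suc l) L"
    have "real u \<le> real l + 1" by (simp add: u_def)
    then have "real u * h \<le> (real l + 1) * h" using h by (intro mult_right_mono) auto
    then have u: "u \<le> L" "s \<le> real u * h" "real u * h \<le> real l * h + h"
      using l s h by (auto simp: u_def min_def algebra_simps)
    have gl: "\<bar>g (real l * h) \<omega> - r * (real l * h)\<bar> < y" and gu: "\<bar>g (real u * h) \<omega> - r * (real u * h)\<bar> < y"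
      using w lL u(1) by (auto simp: not_le)
    have "g (real l * h) \<omega> \<le> g s \<omega>" "g s \<omega> \<le> g (real u * h) \<omega>"
      using w mono[of \<omega>] l(1) u(2) s h by auto
    moreover have "r * (real u * h) \<le> r * (real l * h + h)" "r * s \<le> r * (real l * h + h)"
      "r * (real l * h) \<le> r * s" "r * s \<le> r * (real u * h)"
      using u l by (auto intro!: mult_left_mono[OF _ r] simp: distrib_right)
    moreover have "r * (real l * h + h) = r * (real l * h) + r * h" by (simp add: algebra_simps)
    ultimately show ?thesis using gl gu by linarith
  qed
  ultimately show thesis using that U by blast
qed

lemma poisson_marginal:
  assumes "poisson_process M r S" "0 \<le> s" "s \<le> t"
  shows "prob {\<omega>\<in>space M. S t \<omega> - S s \<omega> = k} = (r * (t - s)) ^ k / fact k * exp (- (r * (t - s)))"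
proof -
  have "\<forall>s t. 0 \<le> s \<and> s \<le> t \<longrightarrow> (\<forall>k. prob {\<omega>\<in>space M. S t \<omega> - S s \<omega> = k} =
      (r * (t - s)) ^ k / fact k * exp (- (r * (t - s))))"
    using assms(1) by (simp add: poisson_process_def)
  then show ?thesis using assms(2,3) by simp
qed

lemma poisson_marginal_0:
  assumes S: "poisson_process M r S" and t: "0 \<le> t"
  shows "prob {\<omega>\<in>space M. S t \<omega> = k} = (r * t) ^ k / fact k * exp (- (r * t))"
proof -
  have *: "{\<omega>\<in>space M. S t \<omega> = k} = {\<omega>\<in>space M. S t \<omega> - S 0 \<omega> = k}"
    using S by (auto simp: poisson_process_def)
  show ?thesis unfolding * using poisson_marginal[OF S order.refl t, of k] by simp
qed

lemma poisson_uniform: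
  assumes S: "poisson_process M r S" and r: "0 \<le> r" and h: "0 < h" and y: "0 < y"
  obtains G where "G \<in> events" "1 - (real L + 1) * (r * (real L * h) / y\<^sup>2) \<le> prob G"
    "\<And>\<omega> s. \<omega> \<in> G \<Longrightarrow> 0 \<le> s \<Longrightarrow> s \<le> real L * h \<Longrightarrow> \<bar>real (S s \<omega>) - r * s\<bar> \<le> y + r * h"
proof -
  have meas: "S t \<in> M \<rightarrow>\<^sub>M count_space UNIV" if "0 \<le> t" for t
    using S that by (simp add: poisson_process_def)
  have S0: "S 0 \<omega> = 0" and mono: "mono_on {0..} (\<lambda>t. S t \<omega>)" if "\<omega> \<in> space M" for \<omega>
    using S that by (auto simp: poisson_process_def)
  have tail: "prob {\<omega>\<in>space M. y \<le> \<bar>real (S (real l * h) \<omega>) - r * (real l * h)\<bar>} \<le> r * (real L * h) / y\<^sup>2"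
    if "l \<le> L" for l
  proof -
    have "prob {\<omega>\<in>space M. S (real l * h) \<omega> = k} = (r * (real l * h)) ^ k / fact k * exp (- (r * (real l * h)))" for k
      using poisson_marginal_0[OF S, of "real l * h" k] h by simp
    then have "prob {\<omega>\<in>space M. y \<le> \<bar>real (S (real l * h) \<omega>) - r * (real l * h)\<bar>} \<le> r * (real l * h) / y\<^sup>2"
      using h y by (intro poisson_tail meas) auto
    also have "\<dots> \<le> r * (real L * h) / y\<^sup>2"
      using that r h by (intro divide_right_mono mult_left_mono mult_right_mono) auto
    finally show ?thesis .
  qed
  show thesis
  proof (rule grid_uniform[of "\<lambda>t \<omega>. real (S t \<omega>)" h L y r "r * (real L * h) / y\<^sup>2"])
    show "(\<lambda>\<omega>. real (S (real l * h) \<omega>)) \<in> borel_measurable M" for l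
      by (rule measurable_compose[OF meas]) (use h in auto)
    show "real (S s \<omega>) \<le> real (S t \<omega>)" if "\<omega> \<in> space M" "0 \<le> s" "s \<le> t" for \<omega> s t
      using mono_onD[OF mono[OF that(1)], of s t] that by simp
  qed (use that tail h r in auto)
qed

text \<open>The tool for almost sure statements: an event contained in infinitely many events whose probabilities
  tend to zero along the sequence is null.\<close>

lemma AE_not_all:
  fixes P :: "nat \<Rightarrow> 'a \<Rightarrow> bool"
  assumes [measurable]: "\<And>n. Measurable.pred M (P n)"
    and le: "\<forall>\<^sub>F n in sequentially. prob {\<omega>\<in>space M. P n \<omega>} \<le> b n" and b: "b \<longlonglongrightarrow> 0"
  shows "AE \<omega> in M. \<exists>n\<ge>m. \<not> P n \<omega>"
proof -
  let ?B = "{\<omega>\<in>space M. \<forall>n\<ge>m. P n \<omega>}"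
  have "\<forall>\<^sub>F n in sequentially. prob ?B \<le> b n"
    using le eventually_ge_at_top[of m]
  proof eventually_elim
    case (elim n)
    have "prob ?B \<le> prob {\<omega>\<in>space M. P n \<omega>}" using elim by (intro finite_measure_mono) auto
    then show ?case using elim by simp
  qed
  then have "prob ?B \<le> 0" using b by (intro tendsto_lowerbound) auto
  then have "prob ?B = 0" by (simp add: measure_le_0_iff)
  then have "AE \<omega> in M. \<not> (\<forall>n\<ge>m. P n \<omega>)"
    by (subst AE_iff_measurable[OF _ refl]) (auto simp: emeasure_eq_measure)
  then show ?thesis by simp
qed

lemma poisson_unbounded:
  assumes S: "poisson_process M r S" and r: "0 < r"
  shows "AE \<omega> in M. \<forall>k. \<exists>s\<ge>0. k \<le> S s \<omega>"
proof (subst AE_all_countable, rule)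
  fix k
  have meas[measurable]: "S (real n) \<in> M \<rightarrow>\<^sub>M count_space UNIV" for n
    using S by (simp add: poisson_process_def)
  have p: "prob {\<omega>\<in>space M. S (real n) \<omega> = k} = (r * real n) ^ k / fact k * exp (- (r * real n))" for n k
    using poisson_marginal_0[OF S] by simp
  have "AE \<omega> in M. \<exists>n\<ge>0. \<not> S (real n) \<omega> < k"
  proof (rule AE_not_all)
    have "\<forall>\<^sub>F n in sequentially. real k < r * real n" using r by real_asymp
    then show "\<forall>\<^sub>F n in sequentially. prob {\<omega>\<in>space M. S (real n) \<omega> < k} \<le> r * real n / (r * real n - real k)\<^sup>2"
    proof eventually_elim
      case (elim n)
      have "prob {\<omega>\<in>space M. S (real n) \<omega> < k} \<le>
          prob {\<omega>\<in>space M. r * real n - real k \<le> \<bar>real (S (real n) \<omega>) - r * real n\<bar>}"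
        by (intro finite_measure_mono) auto
      also have "\<dots> \<le> r * real n / (r * real n - real k)\<^sup>2"
        using elim by (intro poisson_tail meas p) auto
      finally show ?case .
    qed
    show "(\<lambda>n. r * real n / (r * real n - real k)\<^sup>2) \<longlonglongrightarrow> 0" using r by real_asymp
  qed measurable
  then show "AE \<omega> in M. \<exists>s\<ge>0. k \<le> S s \<omega>"
    by (rule AE_mp) (auto intro!: AE_I2 simp: not_less intro: exI[of _ "real _"])
qed

text \<open>An increment over an interval of length \<open>1 / p\<close> exceeds one with probability \<open>O(1 / p\<^sup>2)\<close>, and there
  are \<open>O(p)\<close> such intervals. The statement is about one grid for every horizon because this suffices to
  exclude jumps of size two.\<close>

lemma poisson_increments:
  assumes S: "poisson_process M r S" and r: "0 < r"
  shows "AE \<omega> in M. \<forall>L. \<exists>p\<ge>1. \<forall>i<L * p. S (real (Suc i) / real p) \<omega> - S (real i / real p) \<omega> \<le> 1"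
proof (subst AE_all_countable, rule)
  fix L :: nat
  have meas[measurable]: "S (real i / real p) \<in> M \<rightarrow>\<^sub>M count_space UNIV" for i p
    using S by (simp add: poisson_process_def)
  let ?D = "\<lambda>i p \<omega>. S (real (Suc i) / real p) \<omega> - S (real i / real p) \<omega>"
  have D: "prob {\<omega>\<in>space M. 1 < ?D i p \<omega>} \<le> (r / real p)\<^sup>2" if p: "1 \<le> p" for i p
  proof -
    define a where "a = r / real p"
    have a: "0 < a" using r p by (simp add: a_def)
    have pk: "prob {\<omega>\<in>space M. ?D i p \<omega> = k} = a ^ k / fact k * exp (- a)" for k
    proof -
      have "0 \<le> real i / real p" "real i / real p \<le> real (Suc i) / real p" by (auto intro: divide_right_mono)
      then have "prob {\<omega>\<in>space M. ?D i p \<omega> = k} =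
        (r * (real (Suc i) / real p - real i / real p)) ^ k / fact k * exp (- (r * (real (Suc i) / real p - real i / real p)))"
        by (rule poisson_marginal[OF S])
      also have "r * (real (Suc i) / real p - real i / real p) = a"
        by (simp add: a_def diff_divide_distrib[symmetric])
      finally show ?thesis .
    qed
    have ev: "{\<omega>\<in>space M. ?D i p \<omega> = k} \<in> events" for k by measurable
    have ev2: "{\<omega>\<in>space M. ?D i p \<omega> = 0 \<or> ?D i p \<omega> = 1} \<in> events"
      using sets.Un[OF ev[of 0] ev[of 1]] by (simp add: Collect_disj_eq[symmetric] Un_def conj_disj_distribL)
    have "prob {\<omega>\<in>space M. ?D i p \<omega> = 0 \<or> ?D i p \<omega> = 1} =
        prob ({\<omega>\<in>space M. ?D i p \<omega> = 0} \<union> {\<omega>\<in>space M. ?D i p \<omega> = 1})"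
      by (intro arg_cong[where f=prob]) auto
    also have "\<dots> = prob {\<omega>\<in>space M. ?D i p \<omega> = 0} + prob {\<omega>\<in>space M. ?D i p \<omega> = 1}"
      by (rule finite_measure_Union[OF ev ev]) auto
    also have "\<dots> = exp (- a) + a * exp (- a)" unfolding pk by simp
    finally have e: "prob {\<omega>\<in>space M. ?D i p \<omega> = 0 \<or> ?D i p \<omega> = 1} = (1 + a) * exp (- a)" by (simp add: algebra_simps)
    have "prob {\<omega>\<in>space M. 1 < ?D i p \<omega>} = prob (space M - {\<omega>\<in>space M. ?D i p \<omega> = 0 \<or> ?D i p \<omega> = 1})"
      by (intro arg_cong[where f=prob]) auto
    also have "\<dots> = 1 - (1 + a) * exp (- a)" by (simp only: prob_compl[OF ev2] e)
    also have "\<dots> \<le> 1 - (1 + a) * (1 - a)"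
      using exp_ge_add_one_self[of "- a"] a by (intro diff_left_mono mult_left_mono) auto
    also have "\<dots> = a\<^sup>2" by (simp add: power2_eq_square algebra_simps)
    finally show ?thesis by (simp add: a_def)
  qed
  have "AE \<omega> in M. \<exists>p\<ge>1. \<not> (\<exists>i<L * p. 1 < ?D i p \<omega>)"
  proof (rule AE_not_all)
    show "\<forall>\<^sub>F p in sequentially. prob {\<omega>\<in>space M. \<exists>i<L * p. 1 < ?D i p \<omega>} \<le> real L * r\<^sup>2 / real p"
      using eventually_ge_at_top[of 1]
    proof eventually_elim
      case (elim p)
      have "{\<omega>\<in>space M. \<exists>i<L * p. 1 < ?D i p \<omega>} = (\<Union>i\<in>{..<L * p}. {\<omega>\<in>space M. 1 < ?D i p \<omega>})" by auto
      then have "prob {\<omega>\<in>space M. \<exists>i<L * p. 1 < ?D i p \<omega>} \<le> (\<Sum>i\<in>{..<L * p}. prob {\<omega>\<in>space M. 1 < ?D i p \<omega>})"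
        by (simp only:) (intro finite_measure_subadditive_finite image_subsetI finite_lessThan; measurable)
      also have "\<dots> \<le> (\<Sum>i\<in>{..<L * p}. (r / real p)\<^sup>2)" using D elim by (intro sum_mono) auto
      also have "\<dots> = real L * r\<^sup>2 / real p" using elim by (simp add: field_simps power2_eq_square)
      finally show ?case .
    qed
    show "(\<lambda>p. real L * r\<^sup>2 / real p) \<longlonglongrightarrow> 0" by real_asymp
  qed measurable
  then show "AE \<omega> in M. \<exists>p\<ge>1. \<forall>i<L * p. ?D i p \<omega> \<le> 1"
    by (simp only: not_ex imp_conv_disj de_Morgan_conj not_less)
qed

end

text \<open>If \<open>J k = J (Suc k)\<close> then the path jumps by at least two at this time, and so does its increment over
  the cell that contains it in every grid.\<close>

lemma counting_path_jump_times:
  fixes s :: "real \<Rightarrow> nat"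
  assumes s0: "s 0 = 0" and mono: "mono_on {0..} s"
    and rc: "\<And>t. 0 \<le> t \<Longrightarrow> continuous (at_right t) s"
    and unb: "\<And>k. \<exists>t\<ge>0. k \<le> s t"
    and inc: "\<And>L. \<exists>p\<ge>1. \<forall>i<L * p. s (real (Suc i) / real p) - s (real i / real p) \<le> 1"
  defines "J \<equiv> \<lambda>k. Inf {t. 0 \<le> t \<and> k \<le> s t}"
  shows "J 0 = 0" and "strict_mono J" and "\<And>t k. 0 \<le> t \<Longrightarrow> k \<le> s t \<longleftrightarrow> J k \<le> t"
proof -
  let ?A = "\<lambda>k. {t. 0 \<le> t \<and> k \<le> s t}"
  have ne: "?A k \<noteq> {}" for k using unb[of k] by blast
  have bdd: "bdd_below (?A k)" for k by (rule bdd_belowI[of _ 0]) auto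
  have J0: "0 \<le> J k" for k unfolding J_def by (rule cInf_greatest[OF ne]) auto
  have JA: "k \<le> s (J k)" for k
  proof -
    have "(s \<longlongrightarrow> s (J k)) (at_right (J k))"
      using rc[OF J0] by (simp add: continuous_within)
    then have "\<forall>\<^sub>F u in at_right (J k). s u = s (J k)" by (simp add: tendsto_discrete)
    then obtain b where b: "J k < b" "\<And>u. J k < u \<Longrightarrow> u < b \<Longrightarrow> s u = s (J k)"
      unfolding eventually_at_right_field by blast
    obtain u where u: "u \<in> ?A k" "u < b"
      using cInf_lessD[OF ne, of k b] b(1) unfolding J_def by blast
    have "J k \<le> u" unfolding J_def using u(1) bdd by (rule cInf_lower)
    then show ?thesis using u b(2)[of u] by (cases "u = J k") auto
  qed
  show iff: "k \<le> s t \<longleftrightarrow> J k \<le> t" if t: "0 \<le> t" for t k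
  proof
    assume "k \<le> s t"
    then show "J k \<le> t" unfolding J_def using t bdd by (intro cInf_lower) auto
  next
    assume "J k \<le> t"
    then have "s (J k) \<le> s t" using mono_onD[OF mono] J0 t by simp
    then show "k \<le> s t" using JA[of k] by simp
  qed
  show J00: "J 0 = 0" using iff[of 0 0] J0[of 0] by simp
  have "J k < J (Suc k)" for k
  proof (rule ccontr)
    assume "\<not> J k < J (Suc k)"
    then have eq: "J (Suc k) \<le> J k" by simp
    have sk: "Suc k \<le> s (J k)" using iff[OF J0[of k], of "Suc k"] eq by simp
    have pos: "0 < J k" using sk s0 J0[of k] by (cases "J k = 0") auto
    obtain L :: nat where L: "J k < real L" using reals_Archimedean2 by blast
    obtain p where p: "1 \<le> p" and step: "\<And>i. i < L * p \<Longrightarrow> s (real (Suc i) / real p) - s (real i / real p) \<le> 1"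
      using inc[of L] by blast
    \<comment> \<open>the cell \<open>(i / p, (i + 1) / p]\<close> contains \<open>J k\<close>\<close>
    define i where "i = nat (\<lceil>J k * real p\<rceil> - 1)"
    have c: "1 \<le> \<lceil>J k * real p\<rceil>" using pos p by (simp add: one_le_ceiling)
    then have ri: "real i = of_int \<lceil>J k * real p\<rceil> - 1" by (simp add: i_def)
    have i: "real i < J k * real p" "J k * real p \<le> real (Suc i)"
      using ceiling_correct[of "J k * real p"] ri by auto
    then have i': "real i / real p < J k" "J k \<le> real (Suc i) / real p"
      using p by (simp_all add: pos_divide_less_eq pos_le_divide_eq)
    have "real i < real L * real p" using i(1) L p by (smt (verit) mult_right_mono of_nat_0_le_iff)
    then have "i < L * p" by (metis of_nat_less_iff of_nat_mult)
    note st = step[OF this]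
    have "s (J k) \<le> s (real (Suc i) / real p)"
      using mono_onD[OF mono, of "J k" "real (Suc i) / real p"] i'(2) J0[of k] by simp
    moreover have "s (real i / real p) < k"
      using iff[of "real i / real p" k] i'(1) by auto
    ultimately show False using st sk by linarith
  qed
  then show "strict_mono J" by (simp add: strict_mono_Suc_iff)
qed

lemma strict_mono_partial_sums:
  fixes u :: "nat \<Rightarrow> real"
  assumes "\<And>k. 1 \<le> k \<Longrightarrow> 0 < u k"
  shows "strict_mono (\<lambda>m. \<Sum>k=1..m. u k)"
  using assms by (simp add: strict_mono_Suc_iff)

lemma arrivals_iff:
  fixes u :: "nat \<Rightarrow> 'w \<Rightarrow> real"
  assumes u: "\<And>k. 1 \<le> k \<Longrightarrow> 0 < u k \<omega>" and l: "0 < l" and t: "0 \<le> t"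
    and unb: "t < (\<Sum>k=1..K. u k \<omega> / l)"
  shows "k \<le> arrivals l u t \<omega> \<longleftrightarrow> (\<Sum>k=1..k. u k \<omega> / l) \<le> t"
proof -
  let ?W = "\<lambda>m. \<Sum>k=1..m. u k \<omega> / l"
  have sm: "strict_mono ?W" using u l by (intro strict_mono_partial_sums) auto
  let ?S = "{m. ?W m \<le> t}"
  have "m < K" if "m \<in> ?S" for m
  proof -
    have "?W m < ?W K" using that unb by simp
    then show ?thesis using strict_mono_less[OF sm] by blast
  qed
  then have fin: "finite ?S" by (meson finite_lessThan finite_subset lessThan_iff subsetI)
  have ne: "0 \<in> ?S" using t by simp
  have S: "arrivals l u t \<omega> = Max ?S"
    unfolding arrivals_def using ne by (intro cSup_eq_Max fin) blast
  have M: "Max ?S \<in> ?S" using ne by (intro Max_in fin) blast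
  show ?thesis
  proof
    assume "k \<le> arrivals l u t \<omega>"
    then have "?W k \<le> ?W (Max ?S)" using S strict_mono_less_eq[OF sm] by metis
    then show "?W k \<le> t" using M by simp
  next
    assume "?W k \<le> t"
    then show "k \<le> arrivals l u t \<omega>" unfolding S using fin by (intro Max_ge) auto
  qed
qed

lemma jump_time_arrivals:
  fixes u :: "nat \<Rightarrow> 'w \<Rightarrow> real"
  assumes u: "\<And>k. 1 \<le> k \<Longrightarrow> 0 < u k \<omega>" and l: "0 < l"
    and unb: "\<And>t. \<exists>K. t < (\<Sum>k=1..K. u k \<omega> / l)"
  shows "jump_time (arrivals l u) k \<omega> = (\<Sum>k=1..k. u k \<omega> / l)"
proof -
  let ?W = "\<lambda>m. \<Sum>k=1..m. u k \<omega> / l"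
  have "0 \<le> ?W k" using u l by (intro sum_nonneg divide_nonneg_nonneg less_imp_le) auto
  moreover have "k \<le> arrivals l u t \<omega> \<longleftrightarrow> ?W k \<le> t" if "0 \<le> t" for t
  proof -
    obtain K where "t < ?W K" using unb by blast
    then show ?thesis by (intro arrivals_iff[where u=u and \<omega>=\<omega>] u l that)
  qed
  ultimately have "{t. 0 \<le> t \<and> k \<le> arrivals l u t \<omega>} = {?W k..}" by auto
  then show ?thesis by (simp add: jump_time_def)
qed

lemma poisson_paths:
  assumes "poisson_process M r S" "\<omega> \<in> space M"
  shows "S 0 \<omega> = 0" and "0 \<le> s \<Longrightarrow> s \<le> t \<Longrightarrow> S s \<omega> \<le> S t \<omega>"
    and "0 \<le> t \<Longrightarrow> continuous (at_right t) (\<lambda>s. S s \<omega>)"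
proof -
  have *: "\<forall>\<omega>\<in>space M. S 0 \<omega> = 0 \<and> mono_on {0..} (\<lambda>t. S t \<omega>) \<and>
      (\<forall>t\<ge>0. continuous (at_right t) (\<lambda>s. S s \<omega>))"
    using assms(1) by (simp add: poisson_process_def)
  show "S 0 \<omega> = 0" "0 \<le> t \<Longrightarrow> continuous (at_right t) (\<lambda>s. S s \<omega>)"
    using * assms(2) by auto
  show "S s \<omega> \<le> S t \<omega>" if "0 \<le> s" "s \<le> t"
    using * assms(2) that mono_onD[of "{0..}" "\<lambda>t. S t \<omega>" s t] by simp
qed

lemma (in prob_space) poisson_good_paths:
  assumes S: "poisson_process M r S" and r: "0 < r"
  shows "AE \<omega> in M. jump_time S 0 \<omega> = 0 \<and> strict_mono (\<lambda>k. jump_time S k \<omega>) \<and>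
    (\<forall>t\<ge>0. \<forall>k. k \<le> S t \<omega> \<longleftrightarrow> jump_time S k \<omega> \<le> t)"
  using poisson_unbounded[OF S r] poisson_increments[OF S r] AE_space
proof eventually_elim
  case (elim \<omega>)
  have J: "jump_time S k \<omega> = Inf {t. 0 \<le> t \<and> k \<le> S t \<omega>}" for k
    by (simp add: jump_time_def)
  have mono: "mono_on {0..} (\<lambda>t. S t \<omega>)"
    using poisson_paths(2)[OF S elim(3)] by (intro mono_onI) auto
  have unb: "\<exists>t\<ge>0. k \<le> S t \<omega>" for k using elim(1) by blast
  have inc: "\<exists>p\<ge>1. \<forall>i<L * p. S (real (Suc i) / real p) \<omega> - S (real i / real p) \<omega> \<le> 1" for L
    using elim(2) by blast
  note * = counting_path_jump_times[of "\<lambda>t. S t \<omega>", OF poisson_paths(1)[OF S elim(3)] mono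
      poisson_paths(3)[OF S elim(3)] unb inc]
  show ?case unfolding J using * by simp
qed

text \<open>Where the process never reaches \<open>k\<close> the jump time is the unspecified constant \<open>Inf {}\<close>. Elsewhere, by
  monotonicity, it is less than \<open>a\<close> iff level \<open>k\<close> is reached at some rational time before \<open>a\<close>.\<close>

lemma (in prob_space) jump_time_measurable:
  assumes S: "poisson_process M r S"
  shows "(\<lambda>\<omega>. jump_time S k \<omega>) \<in> borel_measurable M"
proof -
  have meas[measurable]: "S t \<in> M \<rightarrow>\<^sub>M count_space UNIV" if "0 \<le> t" for t
    using S that by (simp add: poisson_process_def)
  note mono = poisson_paths(2)[OF S]
  show ?thesis
  proof (rule borel_measurable_iff_less[THEN iffD2], rule)
    fix a :: real
    let ?N = "{\<omega>\<in>space M. \<exists>n. k \<le> S (real n) \<omega>}"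
    have N[measurable]: "?N \<in> events" by measurable
    have eq: "jump_time S k \<omega> < a \<longleftrightarrow> (\<exists>q\<in>\<rat>. 0 \<le> q \<and> q < a \<and> k \<le> S q \<omega>)" if w: "\<omega> \<in> ?N" for \<omega>
    proof
      obtain n where "k \<le> S (real n) \<omega>" using w by blast
      then have "real n \<in> {t. 0 \<le> t \<and> k \<le> S t \<omega>}" by simp
      then have ne: "{t. 0 \<le> t \<and> k \<le> S t \<omega>} \<noteq> {}" by blast
      have bdd: "bdd_below {t. 0 \<le> t \<and> k \<le> S t \<omega>}" by (rule bdd_belowI[of _ 0]) auto
      assume "jump_time S k \<omega> < a"
      then obtain t where t: "0 \<le> t" "k \<le> S t \<omega>" "t < a"
        using cInf_lessD[OF ne] unfolding jump_time_def by blast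
      obtain q where q: "q \<in> \<rat>" "t < q" "q < a" using Rats_dense_in_real[OF t(3)] by blast
      then show "\<exists>q\<in>\<rat>. 0 \<le> q \<and> q < a \<and> k \<le> S q \<omega>"
        using t mono[of \<omega> t q] w by (intro bexI[of _ q]) auto
    next
      assume "\<exists>q\<in>\<rat>. 0 \<le> q \<and> q < a \<and> k \<le> S q \<omega>"
      then obtain q where q: "0 \<le> q" "q < a" "k \<le> S q \<omega>" by blast
      then have "jump_time S k \<omega> \<le> q"
        unfolding jump_time_def by (intro cInf_lower) (auto intro!: bdd_belowI[of _ 0])
      then show "jump_time S k \<omega> < a" using q by simp
    qed
    have no: "jump_time S k \<omega> = Inf {}" if w: "\<omega> \<in> space M - ?N" for \<omega>
    proof -
      have "{t. 0 \<le> t \<and> k \<le> S t \<omega>} = {}"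
      proof safe
        fix t :: real assume t: "0 \<le> t" "k \<le> S t \<omega>"
        obtain n :: nat where "t < real n" using reals_Archimedean2 by blast
        then have "k \<le> S (real n) \<omega>" using order.trans[OF t(2) mono[of \<omega> t "real n"]] t(1) w by simp
        then show "t \<in> {}" using w by auto
      qed
      then show ?thesis by (simp only: jump_time_def)
    qed
    have Q: "{\<omega>\<in>space M. \<exists>q\<in>\<rat>. 0 \<le> q \<and> q < a \<and> k \<le> S q \<omega>} \<in> events"
    proof -
      have "{\<omega>\<in>space M. \<exists>q\<in>\<rat>. 0 \<le> q \<and> q < a \<and> k \<le> S q \<omega>} =
        (\<Union>q\<in>{q\<in>\<rat>. 0 \<le> q \<and> q < a}. {\<omega>\<in>space M. k \<le> S q \<omega>})" by auto
      also have "\<dots> \<in> events"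
        by (rule sets.countable_UN') (auto intro: countable_subset[OF _ countable_rat])
      finally show ?thesis .
    qed
    have "{\<omega>\<in>space M. jump_time S k \<omega> < a} =
      (?N \<inter> {\<omega>\<in>space M. \<exists>q\<in>\<rat>. 0 \<le> q \<and> q < a \<and> k \<le> S q \<omega>}) \<union>
      (if Inf {} < a then space M - ?N else {})"
    proof (rule set_eqI)
      fix \<omega>
      show "\<omega> \<in> {\<omega>\<in>space M. jump_time S k \<omega> < a} \<longleftrightarrow> \<omega> \<in>
        (?N \<inter> {\<omega>\<in>space M. \<exists>q\<in>\<rat>. 0 \<le> q \<and> q < a \<and> k \<le> S q \<omega>}) \<union>
        (if Inf {} < a then space M - ?N else {})"
      proof (cases "\<omega> \<in> ?N")
        case True
        then show ?thesis using eq[OF True] by simp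
      next
        case False
        then show ?thesis using no[of \<omega>] by (cases "\<omega> \<in> space M") simp_all
      qed
    qed
    also have "\<dots> \<in> events" using N Q by auto
    finally show "{\<omega>\<in>space M. jump_time S k \<omega> < a} \<in> events" .
  qed
qed

section \<open>Discrete event systems\<close>

lemma measurable_fun_finite:
  fixes f :: "'w \<Rightarrow> 'x::finite \<Rightarrow> 'y::countable"
  assumes "\<And>a. (\<lambda>\<omega>. f \<omega> a) \<in> M \<rightarrow>\<^sub>M count_space UNIV"
  shows "f \<in> M \<rightarrow>\<^sub>M count_space UNIV"
proof (subst measurable_count_space_eq2_countable, safe)
  fix g :: "'x \<Rightarrow> 'y"
  have "f -` {g} \<inter> space M = (\<Inter>a\<in>UNIV. (\<lambda>\<omega>. f \<omega> a) -` {g a} \<inter> space M)" by auto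
  also have "\<dots> \<in> sets M" using assms by (intro sets.finite_INT measurable_sets) auto
  finally show "f -` {g} \<inter> space M \<in> sets M" .
qed auto

lemma measurable_Pair_count_space:
  fixes f :: "'w \<Rightarrow> 'x::countable"
  assumes f: "f \<in> M \<rightarrow>\<^sub>M count_space UNIV" and g: "g \<in> M \<rightarrow>\<^sub>M count_space UNIV"
  shows "(\<lambda>w. (f w, g w)) \<in> M \<rightarrow>\<^sub>M count_space UNIV"
proof (rule measurable_compose_countable[OF _ f, where f="\<lambda>a w. (a, g w)"])
  show "(\<lambda>w. (a, g w)) \<in> M \<rightarrow>\<^sub>M count_space UNIV" for a
    by (rule measurable_compose[OF g]) simp
qed

lemma measurable_collect_finite:
  assumes "\<And>c::'x::finite. Measurable.pred M (P c)"
  shows "(\<lambda>\<omega>. {c. P c \<omega>}) \<in> M \<rightarrow>\<^sub>M count_space UNIV"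
proof (subst measurable_count_space_eq2_countable, safe)
  fix A :: "'x set"
  have "{\<omega>\<in>space M. \<forall>c\<in>UNIV. P c \<omega> = (c \<in> A)} \<in> sets M"
    using assms by measurable
  also have "{\<omega>\<in>space M. \<forall>c\<in>UNIV. P c \<omega> = (c \<in> A)} = (\<lambda>\<omega>. {c. P c \<omega>}) -` {A} \<inter> space M" by auto
  finally show "(\<lambda>\<omega>. {c. P c \<omega>}) -` {A} \<inter> space M \<in> sets M" .
qed auto

text \<open>A discrete state drives finitely many clocks: in state \<open>d\<close> the clock of channel \<open>c\<close> runs at speed
  \<open>rate d c\<close>, and the channel fires for the \<open>k\<close>th time when its clock reaches the level \<open>H c k\<close>. All
  channels that fire at the same time are handed to the update together, since arrivals of different
  classes may coincide with positive probability. In the application, arrival clocks run at speed one, and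
  the clock of an activity runs at the speed of the number of customers in service, so that it shows the
  argument of the Poisson process of the activity.\<close>

locale event_system =
  fixes rate :: "'d::countable \<Rightarrow> 'c::finite \<Rightarrow> nat"
    and cnt :: "'d \<Rightarrow> 'c \<Rightarrow> nat"
    and upd :: "real \<Rightarrow> 'c set \<Rightarrow> 'd \<Rightarrow> 'd"
    and d0 :: 'd
  assumes cnt_upd: "cnt (upd t F d) c = cnt d c + of_bool (c \<in> F)"
    and cnt_d0: "cnt d0 c = 0"
    and active: "\<exists>c. 0 < rate d c"
    and upd_measurable: "(\<lambda>t. upd t F d) \<in> borel \<rightarrow>\<^sub>M count_space UNIV"
begin

definition waiting :: "('c \<Rightarrow> nat \<Rightarrow> real) \<Rightarrow> 'd \<Rightarrow> ('c \<Rightarrow> real) \<Rightarrow> real" where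
  "waiting H d T = Min ((\<lambda>c. (H c (Suc (cnt d c)) - T c) / real (rate d c)) ` {c. 0 < rate d c})"

definition firing :: "('c \<Rightarrow> nat \<Rightarrow> real) \<Rightarrow> 'd \<Rightarrow> ('c \<Rightarrow> real) \<Rightarrow> 'c set" where
  "firing H d T = {c. 0 < rate d c \<and> H c (Suc (cnt d c)) \<le> T c + real (rate d c) * waiting H d T}"

text \<open>The discrete state, the time and the clocks immediately after the \<open>m\<close>th event time.\<close>

primrec ev :: "('c \<Rightarrow> nat \<Rightarrow> real) \<Rightarrow> nat \<Rightarrow> 'd \<times> real \<times> ('c \<Rightarrow> real)" where
  "ev H 0 = (d0, 0, \<lambda>c. 0)"
| "ev H (Suc m) = (case ev H m of (d, t, T) \<Rightarrow>
     (upd (t + waiting H d T) (firing H d T) d, t + waiting H d T,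
      \<lambda>c. T c + real (rate d c) * waiting H d T))"

definition evd where "evd H m = fst (ev H m)"
definition evt where "evt H m = fst (snd (ev H m))"
definition evT where "evT H m = snd (snd (ev H m))"
definition holding where "holding H m = waiting H (evd H m) (evT H m)"
definition fired where "fired H m = firing H (evd H m) (evT H m)"

lemma ev_0 [simp]: "evd H 0 = d0" "evt H 0 = 0" "evT H 0 c = 0"
  by (simp_all add: evd_def evt_def evT_def)

lemma ev_Suc:
  "evt H (Suc m) = evt H m + holding H m"
  "evd H (Suc m) = upd (evt H (Suc m)) (fired H m) (evd H m)"
  "evT H (Suc m) c = evT H m c + real (rate (evd H m) c) * holding H m"
  by (simp_all add: evd_def evt_def evT_def holding_def fired_def split: prod.split)

definition event_index :: "('c \<Rightarrow> nat \<Rightarrow> real) \<Rightarrow> real \<Rightarrow> nat" where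
  "event_index H t = (LEAST m. t < evt H (Suc m))"

definition state_at :: "('c \<Rightarrow> nat \<Rightarrow> real) \<Rightarrow> real \<Rightarrow> 'd" where
  "state_at H t = evd H (event_index H t)"

definition clock :: "('c \<Rightarrow> nat \<Rightarrow> real) \<Rightarrow> real \<Rightarrow> 'c \<Rightarrow> real" where
  "clock H t c = evT H (event_index H t) c + real (rate (state_at H t) c) * (t - evt H (event_index H t))"

context
  fixes H :: "'c \<Rightarrow> nat \<Rightarrow> real"
  assumes H0: "\<And>c. H c 0 = 0" and Hmono: "\<And>c. strict_mono (H c)"
begin

lemma waiting_le:
  assumes "0 < rate (evd H m) c"
  shows "evT H m c + real (rate (evd H m) c) * holding H m \<le> H c (Suc (cnt (evd H m) c))"
proof -
  have "holding H m \<le> (H c (Suc (cnt (evd H m) c)) - evT H m c) / real (rate (evd H m) c)"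
    unfolding holding_def waiting_def using assms by (intro Min_le) auto
  then show ?thesis using assms by (simp add: field_simps)
qed

text \<open>The invariant that makes the construction consistent: every clock lies between the levels of the
  last and the next firing of its channel.\<close>

lemma clock_between:
  "H c (cnt (evd H m) c) \<le> evT H m c \<and> evT H m c < H c (Suc (cnt (evd H m) c))"
proof (induction m arbitrary: c)
  case 0
  show ?case using strict_monoD[OF Hmono, of 0 "Suc 0" c] by (simp add: cnt_d0 H0)
next
  case (Suc m)
  let ?d = "evd H m"
  have "0 \<le> holding H m"
    unfolding holding_def waiting_def using active[of ?d] Suc.IH
    by (subst Min_ge_iff) (auto intro!: divide_nonneg_nonneg less_imp_le simp: algebra_simps)
  then have ge: "evT H m c \<le> evT H (Suc m) c" by (simp add: ev_Suc)
  show ?case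
  proof (cases "c \<in> fired H m")
    case True
    then have r: "0 < rate ?d c" and "H c (Suc (cnt ?d c)) \<le> evT H m c + real (rate ?d c) * holding H m"
      by (auto simp: fired_def firing_def holding_def)
    with waiting_le[OF r] have "evT H (Suc m) c = H c (Suc (cnt ?d c))" by (simp add: ev_Suc)
    moreover have "H c (Suc (cnt ?d c)) < H c (Suc (Suc (cnt ?d c)))"
      using Hmono[of c] by (simp add: strict_mono_Suc_iff)
    ultimately show ?thesis using True by (simp add: ev_Suc(2) cnt_upd)
  next
    case False
    have "evT H (Suc m) c < H c (Suc (cnt ?d c))"
    proof (cases "0 < rate ?d c")
      case True
      then show ?thesis using False by (auto simp: fired_def firing_def holding_def ev_Suc)
    next
      case False
      then show ?thesis using Suc.IH[of c] by (simp add: ev_Suc)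
    qed
    then show ?thesis using False ge Suc.IH[of c] by (auto simp: ev_Suc(2) cnt_upd)
  qed
qed

lemma fired_clock: "c \<in> fired H m \<Longrightarrow> evT H (Suc m) c = H c (Suc (cnt (evd H m) c))"
  using waiting_le[of m c] by (auto simp: fired_def firing_def holding_def ev_Suc)

lemma fired_rate: "c \<in> fired H m \<Longrightarrow> 0 < rate (evd H m) c"
  by (simp add: fired_def firing_def)

lemma holding_pos: "0 < holding H m"
  unfolding holding_def waiting_def using active[of "evd H m"] clock_between[of _ m]
  by (subst Min_gr_iff) auto

lemma fired_nonempty: "fired H m \<noteq> {}"
proof -
  let ?A = "(\<lambda>c. (H c (Suc (cnt (evd H m) c)) - evT H m c) / real (rate (evd H m) c)) ` {c. 0 < rate (evd H m) c}"
  have "Min ?A \<in> ?A" using active[of "evd H m"] by (intro Min_in) auto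
  then obtain c where c: "0 < rate (evd H m) c"
    "holding H m = (H c (Suc (cnt (evd H m) c)) - evT H m c) / real (rate (evd H m) c)"
    unfolding holding_def waiting_def by blast
  then have "c \<in> fired H m" by (auto simp: fired_def firing_def holding_def[symmetric])
  then show ?thesis by blast
qed

lemma evt_less: "evt H m < evt H (Suc m)"
  using holding_pos[of m] by (simp add: ev_Suc)

lemma evt_strict_mono: "strict_mono (evt H)"
  using evt_less by (simp add: strict_mono_Suc_iff)

lemma evt_nonneg: "0 \<le> evt H m"
  using strict_mono_less_eq[OF evt_strict_mono, of 0 m] by simp

text \<open>Every event increments a counter, so events can accumulate only if some counter does not stay bounded.\<close>

lemma count_ge: "m \<le> (\<Sum>c\<in>UNIV. cnt (evd H m) c)"
proof (induction m)
  case (Suc m)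
  obtain c where c: "c \<in> fired H m" using fired_nonempty by blast
  have "(\<Sum>c\<in>UNIV. cnt (evd H m) c) < (\<Sum>c\<in>UNIV. cnt (evd H (Suc m)) c)"
    using c by (intro sum_strict_mono_ex1) (auto simp: ev_Suc(2) cnt_upd intro!: bexI[of _ c])
  then show ?case using Suc by simp
qed simp

context
  assumes unbounded: "\<And>L. \<exists>m. L < evt H m"
begin

lemma event_index_between:
  assumes "0 \<le> t"
  shows "evt H (event_index H t) \<le> t" "t < evt H (Suc (event_index H t))"
proof -
  obtain m where "t < evt H m" using unbounded by blast
  then have "t < evt H (Suc m)" using evt_less[of m] by simp
  then show "t < evt H (Suc (event_index H t))" unfolding event_index_def by (rule LeastI)
  show "evt H (event_index H t) \<le> t"
  proof (cases "event_index H t")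
    case (Suc k)
    then have "\<not> t < evt H (Suc k)" unfolding event_index_def using not_less_Least[of k "\<lambda>m. t < evt H (Suc m)"] by simp
    then show ?thesis using Suc by simp
  qed (use assms in simp)
qed

lemma event_index_eqI:
  assumes "evt H m \<le> t" "t < evt H (Suc m)"
  shows "event_index H t = m"
proof -
  have t: "0 \<le> t" using assms(1) evt_nonneg[of m] by simp
  have "m < Suc (event_index H t)" "event_index H t < Suc m"
    using event_index_between[OF t] assms by (auto intro: strict_mono_less[OF evt_strict_mono, THEN iffD1])
  then show ?thesis by simp
qed

lemma state_at_eqI: "evt H m \<le> t \<Longrightarrow> t < evt H (Suc m) \<Longrightarrow> state_at H t = evd H m"
  by (simp add: state_at_def event_index_eqI)

lemma state_at_0: "state_at H 0 = d0"
  using state_at_eqI[of 0 0] evt_less[of 0] by simp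

lemma rate_integral_aux:
  assumes "evt H m \<le> t" "t \<le> evt H (Suc m)"
  shows "((\<lambda>s. real (rate (state_at H s) c)) has_integral
    evT H m c + real (rate (evd H m) c) * (t - evt H m)) {0..t}"
  using assms
proof (induction m arbitrary: t)
  case 0
  have "((\<lambda>s. real (rate d0 c)) has_integral real (rate d0 c) * t) {0..t}"
    using has_integral_const_real[of "real (rate d0 c)" 0 t] 0 by (simp add: mult.commute)
  then have "((\<lambda>s. real (rate (state_at H s) c)) has_integral real (rate d0 c) * t) {0..t}"
    by (rule has_integral_spike_finite[of "{t}", rotated 2])
       (use 0 state_at_eqI[of 0] in auto)
  then show ?case by simp
next
  case (Suc m)
  let ?s = "evt H (Suc m)"
  have 1: "((\<lambda>s. real (rate (state_at H s) c)) has_integral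
    evT H m c + real (rate (evd H m) c) * (?s - evt H m)) {0..?s}"
    using Suc.IH evt_less[of m] by simp
  have "((\<lambda>s. real (rate (evd H (Suc m)) c)) has_integral real (rate (evd H (Suc m)) c) * (t - ?s)) {?s..t}"
    using has_integral_const_real[of "real (rate (evd H (Suc m)) c)" ?s t] Suc.prems by (simp add: mult.commute)
  then have 2: "((\<lambda>s. real (rate (state_at H s) c)) has_integral real (rate (evd H (Suc m)) c) * (t - ?s)) {?s..t}"
    by (rule has_integral_spike_finite[of "{t}", rotated 2])
       (use Suc.prems state_at_eqI[of "Suc m"] in auto)
  have "evT H m c + real (rate (evd H m) c) * (?s - evt H m) = evT H (Suc m) c"
    by (simp add: ev_Suc)
  then show ?case
    using has_integral_combine[OF evt_nonneg Suc.prems(1) 1 2] by simp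
qed

text \<open>The clock of a channel is the integral of its speed; for an activity this is the time change in the
  balance equations.\<close>

lemma rate_integral:
  assumes "0 \<le> t"
  shows "((\<lambda>s. real (rate (state_at H s) c)) has_integral clock H t c) {0..t}"
  using rate_integral_aux[of "event_index H t" t c] event_index_between[OF assms] by (simp add: clock_def state_at_def)

lemma clock_bounds:
  assumes "0 \<le> t"
  shows "H c (cnt (state_at H t) c) \<le> clock H t c" "clock H t c < H c (Suc (cnt (state_at H t) c))"
proof -
  let ?m = "event_index H t"
  let ?r = "real (rate (evd H ?m) c)"
  note b = event_index_between[OF assms]
  have "0 \<le> ?r * (t - evt H ?m)" using b by simp
  then show "H c (cnt (state_at H t) c) \<le> clock H t c"
    using clock_between[of c ?m] by (simp add: clock_def state_at_def)
  show "clock H t c < H c (Suc (cnt (state_at H t) c))"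
  proof (cases "0 < rate (evd H ?m) c")
    case True
    have "?r * (t - evt H ?m) < ?r * holding H ?m"
      using True b by (intro mult_strict_left_mono) (auto simp: ev_Suc)
    then show ?thesis using waiting_le[OF True] by (simp add: clock_def state_at_def)
  next
    case False
    then show ?thesis using clock_between[of c ?m] by (simp add: clock_def state_at_def)
  qed
qed

lemma state_at_left:
  assumes "0 < t"
  obtains m where "evt H m < t" "t \<le> evt H (Suc m)" "\<forall>\<^sub>F s in at_left t. state_at H s = evd H m"
proof -
  define m where "m = (LEAST m. t \<le> evt H (Suc m))"
  obtain k where k: "t < evt H k" using unbounded by blast
  then have "t \<le> evt H (Suc k)" using evt_less[of k] by simp
  then have 1: "t \<le> evt H (Suc m)" unfolding m_def by (rule LeastI)
  have 2: "evt H m < t"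
  proof (cases m)
    case (Suc l)
    then have "\<not> t \<le> evt H (Suc l)" unfolding m_def using not_less_Least[of l "\<lambda>m. t \<le> evt H (Suc m)"] by simp
    then show ?thesis using Suc by simp
  qed (use assms in simp)
  have "\<forall>\<^sub>F s in at_left t. state_at H s = evd H m"
    using eventually_at_left_real[OF 2] by eventually_elim (use 1 in \<open>auto intro!: state_at_eqI\<close>)
  then show thesis using that 1 2 by blast
qed

lemma state_at_right:
  assumes "0 \<le> t"
  shows "\<forall>\<^sub>F s in at_right t. state_at H s = state_at H t"
proof -
  have "\<forall>\<^sub>F s in at_right t. s \<in> {t<..<evt H (Suc (event_index H t))}"
    by (rule eventually_at_right_real) (rule event_index_between[OF assms])
  then show ?thesis
    by eventually_elim (use event_index_between[OF assms] in \<open>auto intro!: state_at_eqI simp: state_at_def[of _ t]\<close>)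
qed

lemma cadlag_state_at: "cadlag (\<lambda>t. f (state_at H t))"
  unfolding cadlag_def
proof safe
  fix t :: real assume "0 \<le> t"
  from state_at_right[OF this] show "continuous (at_right t) (\<lambda>t. f (state_at H t))"
    unfolding continuous_within by (intro tendsto_eventually) (auto elim: eventually_mono)
next
  fix t :: real assume "0 < t"
  then obtain m where "\<forall>\<^sub>F s in at_left t. state_at H s = evd H m" by (rule state_at_left)
  then have "((\<lambda>s. f (state_at H s)) \<longlongrightarrow> f (evd H m)) (at_left t)"
    by (intro tendsto_eventually) (auto elim: eventually_mono)
  then show "\<exists>l. ((\<lambda>s. f (state_at H s)) \<longlongrightarrow> l) (at_left t)" by blast
qed

lemma left_lim_state_at: "left_lim (\<lambda>s. f (state_at H s)) (evt H (Suc m)) = (f (evd H m) :: 'x :: t2_space)"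
proof -
  have "\<forall>\<^sub>F s in at_left (evt H (Suc m)). state_at H s = evd H m"
    using eventually_at_left_real[OF evt_less[of m]] by eventually_elim (auto intro!: state_at_eqI)
  then have "((\<lambda>s. f (state_at H s)) \<longlongrightarrow> f (evd H m)) (at_left (evt H (Suc m)))"
    by (intro tendsto_eventually) (auto elim: eventually_mono)
  then show ?thesis unfolding left_lim_def by (rule tendsto_Lim[rotated]) simp
qed

end
end

context
  fixes M :: "'w measure" and H :: "'w \<Rightarrow> 'c \<Rightarrow> nat \<Rightarrow> real"
  assumes H_meas: "\<And>c k. (\<lambda>\<omega>. H \<omega> c k) \<in> borel_measurable M"
begin

lemma ev_measurable:
  "(\<lambda>\<omega>. evd (H \<omega>) m) \<in> M \<rightarrow>\<^sub>M count_space UNIV \<and> (\<lambda>\<omega>. evt (H \<omega>) m) \<in> borel_measurable M \<and>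
   (\<forall>c. (\<lambda>\<omega>. evT (H \<omega>) m c) \<in> borel_measurable M)"
proof (induction m)
  case (Suc m)
  then have d[measurable]: "(\<lambda>\<omega>. evd (H \<omega>) m) \<in> M \<rightarrow>\<^sub>M count_space UNIV"
    and t[measurable]: "(\<lambda>\<omega>. evt (H \<omega>) m) \<in> borel_measurable M"
    and T[measurable]: "\<And>c. (\<lambda>\<omega>. evT (H \<omega>) m c) \<in> borel_measurable M" by auto
  have w: "(\<lambda>\<omega>. waiting (H \<omega>) d (evT (H \<omega>) m)) \<in> borel_measurable M" for d
    unfolding waiting_def using active[of d]
    by (intro borel_measurable_Min borel_measurable_divide borel_measurable_diff H_meas T) auto
  have holding[measurable]: "(\<lambda>\<omega>. holding (H \<omega>) m) \<in> borel_measurable M"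
    unfolding holding_def
    by (rule measurable_compose_countable[OF _ d, where f="\<lambda>d \<omega>. waiting (H \<omega>) d (evT (H \<omega>) m)"]) (rule w)
  have r[measurable]: "(\<lambda>\<omega>. real (rate (evd (H \<omega>) m) c)) \<in> borel_measurable M" for c
    by (rule measurable_compose[OF d]) simp
  have h[measurable]: "(\<lambda>\<omega>. H \<omega> c (Suc (cnt (evd (H \<omega>) m) c))) \<in> borel_measurable M" for c
    by (rule measurable_compose_countable[OF _ d, where f="\<lambda>d \<omega>. H \<omega> c (Suc (cnt d c))"]) (rule H_meas)
  have p[measurable]: "Measurable.pred M (\<lambda>\<omega>. 0 < rate (evd (H \<omega>) m) c)" for c
    by (rule measurable_compose[OF d]) simp
  have f[measurable]: "(\<lambda>\<omega>. fired (H \<omega>) m) \<in> M \<rightarrow>\<^sub>M count_space UNIV"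
    unfolding fired_def firing_def holding_def[symmetric]
    by (rule measurable_collect_finite) measurable
  have t'[measurable]: "(\<lambda>\<omega>. evt (H \<omega>) (Suc m)) \<in> borel_measurable M"
    unfolding ev_Suc by measurable
  have "(\<lambda>\<omega>. upd (evt (H \<omega>) (Suc m)) F d) \<in> M \<rightarrow>\<^sub>M count_space UNIV" for F d
    by (rule measurable_compose[OF t' upd_measurable])
  then have "(\<lambda>\<omega>. upd (evt (H \<omega>) (Suc m)) (fired (H \<omega>) m) d) \<in> M \<rightarrow>\<^sub>M count_space UNIV" for d
    by (intro measurable_compose_countable'[where I=UNIV and f="\<lambda>F \<omega>. upd (evt (H \<omega>) (Suc m)) F d", OF _ f])
      (auto intro: countable_finite)
  then have "(\<lambda>\<omega>. upd (evt (H \<omega>) (Suc m)) (fired (H \<omega>) m) (evd (H \<omega>) m)) \<in> M \<rightarrow>\<^sub>M count_space UNIV"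
    by (rule measurable_compose_countable[OF _ d,
          where f="\<lambda>d \<omega>. upd (evt (H \<omega>) (Suc m)) (fired (H \<omega>) m) d"])
  then show ?case using t' by (simp add: ev_Suc(2,3))
qed simp

lemma state_at_measurable: "(\<lambda>\<omega>. state_at (H \<omega>) t) \<in> M \<rightarrow>\<^sub>M count_space UNIV"
proof -
  have [measurable]: "(\<lambda>\<omega>. evt (H \<omega>) m) \<in> borel_measurable M" for m
    using ev_measurable[of m] by simp
  have "(\<lambda>\<omega>. event_index (H \<omega>) t) \<in> M \<rightarrow>\<^sub>M count_space UNIV"
    unfolding event_index_def by (rule measurable_Least) measurable
  then show ?thesis unfolding state_at_def
    by (rule measurable_compose_countable[rotated, where f="\<lambda>m \<omega>. evd (H \<omega>) m"])
      (simp add: ev_measurable)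
qed

end
end

section \<open>Controlled processes of capacity respecting policies\<close>

text \<open>The randomizing variable may differ from class to class in \<open>station_capacity\<close>. Summing over all
  classes there guards against simultaneous arrivals: all of them see the same left limits, and may still
  be routed together.\<close>

locale capacity_policy =
  fixes N :: "'j::finite \<Rightarrow> nat" and X0 :: "'i::finite \<Rightarrow> nat" and \<Psi>0 :: "'i \<Rightarrow> 'j \<Rightarrow> nat"
    and F :: "'i \<Rightarrow> 'j \<Rightarrow> ('i, 'j) routing_map" and c :: "'i \<Rightarrow> nat \<Rightarrow> real"
  assumes class_capacity: "\<And>i t x y z p r. (\<Sum>j\<in>UNIV. F i j t x y z p r) \<le> Suc (y i)"
    and station_capacity: "\<And>j t x y z p r. (\<Sum>i\<in>UNIV. F i j t x y z p (r i)) \<le> z j"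
    and initial_class: "\<And>i. (\<Sum>j\<in>UNIV. \<Psi>0 i j) \<le> X0 i"
    and initial_station: "\<And>j. (\<Sum>i\<in>UNIV. \<Psi>0 i j) \<le> N j"
    and F_measurable: "\<And>i j. (\<lambda>(t, x, y, z, p, r). F i j t x y z p r) \<in> measurable
        (restrict_space borel {0..} \<Otimes>\<^sub>M count_space UNIV \<Otimes>\<^sub>M count_space UNIV \<Otimes>\<^sub>M
         count_space UNIV \<Otimes>\<^sub>M count_space UNIV \<Otimes>\<^sub>M borel) (count_space UNIV)"
begin

type_synonym ('a, 'b) dstate = "('a \<Rightarrow> 'b \<Rightarrow> nat) \<times> ('a \<Rightarrow> nat) \<times> ('a + 'a \<times> 'b \<Rightarrow> nat)"

definition busy :: "('i, 'j) dstate \<Rightarrow> 'i \<Rightarrow> 'j \<Rightarrow> nat" where "busy d = fst d"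
definition queue :: "('i, 'j) dstate \<Rightarrow> 'i \<Rightarrow> nat" where "queue d = fst (snd d)"
definition count :: "('i, 'j) dstate \<Rightarrow> 'i + 'i \<times> 'j \<Rightarrow> nat" where "count d = snd (snd d)"
definition present :: "('i, 'j) dstate \<Rightarrow> 'i \<Rightarrow> nat" where
  "present d i = queue d i + (\<Sum>j\<in>UNIV. busy d i j)"
definition idle :: "('i, 'j) dstate \<Rightarrow> 'j \<Rightarrow> nat" where
  "idle d j = N j - (\<Sum>i\<in>UNIV. busy d i j)"

definition rate :: "('i, 'j) dstate \<Rightarrow> 'i + 'i \<times> 'j \<Rightarrow> nat" where
  "rate d v = (case v of Inl i \<Rightarrow> 1 | Inr (i, j) \<Rightarrow> busy d i j)"

lemma rate_simps: "rate d (Inl i) = 1" "rate d (Inr (i, j)) = busy d i j"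
  by (simp_all add: rate_def)

text \<open>The routing maps are only assumed to be measurable for nonnegative times, hence \<open>max 0 t\<close>.\<close>

definition routed :: "real \<Rightarrow> ('i + 'i \<times> 'j) set \<Rightarrow> ('i, 'j) dstate \<Rightarrow> 'i \<Rightarrow> 'j \<Rightarrow> nat" where
  "routed t V d i j = (if Inl i \<in> V
     then F i j (max 0 t) (present d) (queue d) (idle d) (busy d) (c i (Suc (count d (Inl i)))) else 0)"

text \<open>In the states that occur the differences do not truncate: a service completes only where a customer is in service, and
  the customers routed are at most the queue plus the arriving customer.\<close>

definition step :: "real \<Rightarrow> ('i + 'i \<times> 'j) set \<Rightarrow> ('i, 'j) dstate \<Rightarrow> ('i, 'j) dstate" where
  "step t V d =
     (\<lambda>i j. busy d i j + routed t V d i j - of_bool (Inr (i, j) \<in> V),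
      \<lambda>i. queue d i + of_bool (Inl i \<in> V) - (\<Sum>j\<in>UNIV. routed t V d i j),
      \<lambda>v. count d v + of_bool (v \<in> V))"

definition start :: "('i, 'j) dstate" where
  "start = (\<Psi>0, \<lambda>i. X0 i - (\<Sum>j\<in>UNIV. \<Psi>0 i j), \<lambda>_. 0)"

lemma step_simps:
  "busy (step t V d) i j = busy d i j + routed t V d i j - of_bool (Inr (i, j) \<in> V)"
  "queue (step t V d) i = queue d i + of_bool (Inl i \<in> V) - (\<Sum>j\<in>UNIV. routed t V d i j)"
  "count (step t V d) v = count d v + of_bool (v \<in> V)"
  by (simp_all add: busy_def queue_def count_def step_def)

lemma start_simps:
  "busy start = \<Psi>0" "queue start i = X0 i - (\<Sum>j\<in>UNIV. \<Psi>0 i j)" "count start v = 0"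
  by (simp_all add: busy_def queue_def count_def start_def)

lemma F_section_measurable: "(\<lambda>t. F i j (max 0 t) x y z p r) \<in> borel \<rightarrow>\<^sub>M count_space UNIV"
proof -
  have m: "(\<lambda>t::real. max 0 t) \<in> borel \<rightarrow>\<^sub>M restrict_space borel {0..}"
    by (rule measurable_restrict_space2) auto
  have "(\<lambda>t::real. (max 0 t, x, y, z, p, r)) \<in> borel \<rightarrow>\<^sub>M
      (restrict_space borel {0..} \<Otimes>\<^sub>M count_space UNIV \<Otimes>\<^sub>M count_space UNIV \<Otimes>\<^sub>M
         count_space UNIV \<Otimes>\<^sub>M count_space UNIV \<Otimes>\<^sub>M borel)"
    by (intro measurable_Pair m) auto
  from measurable_compose[OF this F_measurable[of i j]] show ?thesis by simp
qed

sublocale event_system rate count step start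
proof
  show "count (step t V d) v = count d v + of_bool (v \<in> V)" for t V d v by (rule step_simps)
  show "count start v = 0" for v by (rule start_simps)
  show "\<exists>v. 0 < rate d v" for d by (rule exI[of _ "Inl undefined"]) (simp add: rate_def)
  show "(\<lambda>t. step t V d) \<in> borel \<rightarrow>\<^sub>M count_space UNIV" for V d
  proof -
    have "(\<lambda>t. routed t V d i j) \<in> borel \<rightarrow>\<^sub>M count_space UNIV" for i j
      unfolding routed_def using F_section_measurable by (cases "Inl i \<in> V") simp_all
    then have "(\<lambda>t. routed t V d) \<in> borel \<rightarrow>\<^sub>M count_space UNIV"
      by (intro measurable_fun_finite)
    then have "(\<lambda>t. (\<lambda>r. (\<lambda>i j. busy d i j + r i j - of_bool (Inr (i, j) \<in> V),
      \<lambda>i. queue d i + of_bool (Inl i \<in> V) - (\<Sum>j\<in>UNIV. r i j),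
      \<lambda>v. count d v + of_bool (v \<in> V))) (routed t V d)) \<in> borel \<rightarrow>\<^sub>M count_space UNIV"
      by (rule measurable_compose) simp
    then show ?thesis by (simp add: step_def)
  qed
qed

context
  fixes H :: "'i + 'i \<times> 'j \<Rightarrow> nat \<Rightarrow> real"
  assumes H0: "\<And>v. H v 0 = 0" and Hmono: "\<And>v. strict_mono (H v)"
    and H_unb: "\<And>i L. \<exists>k. L < H (Inl i) k"
begin

lemma routed_class:
  "(\<Sum>j\<in>UNIV. routed t V d i j) \<le> queue d i + of_bool (Inl i \<in> V)"
  using class_capacity by (auto simp: routed_def)

lemma routed_station:
  "(\<Sum>i\<in>UNIV. routed t V d i j) \<le> idle d j"
proof -
  have "(\<Sum>i\<in>UNIV. routed t V d i j) \<le>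
      (\<Sum>i\<in>UNIV. F i j (max 0 t) (present d) (queue d) (idle d) (busy d) (c i (Suc (count d (Inl i)))))"
    by (intro sum_mono) (simp add: routed_def)
  also have "\<dots> \<le> idle d j" by (rule station_capacity)
  finally show ?thesis .
qed

lemma fired_busy: "of_bool (Inr (i, j) \<in> fired H m) \<le> busy (evd H m) i j"
  using fired_rate[of H "Inr (i, j)" m, OF H0 Hmono] by (auto simp: rate_simps Suc_le_eq)

lemma busy_step:
  "busy (evd H (Suc m)) i j + of_bool (Inr (i, j) \<in> fired H m) =
   busy (evd H m) i j + routed (evt H (Suc m)) (fired H m) (evd H m) i j"
  using fired_busy[of i j m] unfolding ev_Suc(2) step_simps by simp

lemma station_inv: "(\<Sum>i\<in>UNIV. busy (evd H m) i j) \<le> N j"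
proof (induction m)
  case 0
  show ?case using initial_station by (simp add: start_simps)
next
  case (Suc m)
  let ?V = "fired H m" and ?d = "evd H m" and ?t = "evt H (Suc m)"
  have "(\<Sum>i\<in>UNIV. busy (evd H (Suc m)) i j) \<le> (\<Sum>i\<in>UNIV. busy ?d i j + routed ?t ?V ?d i j)"
    by (intro sum_mono) (metis busy_step le_add1)
  also have "\<dots> \<le> (\<Sum>i\<in>UNIV. busy ?d i j) + idle ?d j"
    using routed_station by (simp add: sum.distrib)
  also have "\<dots> = N j" using Suc by (simp add: idle_def)
  finally show ?case .
qed

lemma class_inv:
  "present (evd H m) i + (\<Sum>j\<in>UNIV. count (evd H m) (Inr (i, j))) = X0 i + count (evd H m) (Inl i)"
proof (induction m)
  case 0
  show ?case using initial_class[of i] by (simp add: start_simps present_def)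
next
  case (Suc m)
  let ?V = "fired H m" and ?d = "evd H m" and ?t = "evt H (Suc m)" and ?d' = "evd H (Suc m)"
  have q: "queue ?d' i + (\<Sum>j\<in>UNIV. routed ?t ?V ?d i j) = queue ?d i + of_bool (Inl i \<in> ?V)"
    using routed_class[of ?t ?V ?d i] unfolding ev_Suc(2) step_simps by simp
  have b: "(\<Sum>j\<in>UNIV. busy ?d' i j) + (\<Sum>j\<in>UNIV. of_bool (Inr (i, j) \<in> ?V)) =
      (\<Sum>j\<in>UNIV. busy ?d i j) + (\<Sum>j\<in>UNIV. routed ?t ?V ?d i j)"
    unfolding sum.distrib[symmetric] by (simp only: busy_step)
  have k: "(\<Sum>j\<in>UNIV. count ?d' (Inr (i, j))) =
      (\<Sum>j\<in>UNIV. count ?d (Inr (i, j))) + (\<Sum>j\<in>UNIV. of_bool (Inr (i, j) \<in> ?V))"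
    unfolding ev_Suc(2) step_simps by (simp only: sum.distrib)
  have l: "count ?d' (Inl i) = count ?d (Inl i) + of_bool (Inl i \<in> ?V)"
    unfolding ev_Suc(2) step_simps ..
  show ?case using Suc q b k l unfolding present_def by linarith
qed

lemma evT_arrival: "evT H m (Inl i) = evt H m"
  by (induction m) (simp_all add: ev_Suc rate_simps)

text \<open>Services can only complete for customers that were present initially or have arrived, so
  infinitely many events need infinitely many arrivals.\<close>

lemma unbounded_events: "\<exists>m. L < evt H m"
proof (rule ccontr)
  assume "\<not> (\<exists>m. L < evt H m)"
  then have le: "evt H m \<le> L" for m by (simp add: not_less)
  obtain k where k: "\<And>i. L < H (Inl i) (k i)" using H_unb by metis
  have ca: "count (evd H m) (Inl i) \<le> k i" for m i
  proof -
    have "H (Inl i) (count (evd H m) (Inl i)) \<le> evT H m (Inl i)"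
      using clock_between[of H "Inl i" m, OF H0 Hmono] by blast
    also have "\<dots> < H (Inl i) (k i)" using le[of m] k[of i] by (simp add: evT_arrival)
    finally show ?thesis using strict_mono_less[OF Hmono] by (metis less_imp_le)
  qed
  have cs: "count (evd H m) (Inr (i, j)) \<le> X0 i + k i" for m i j
  proof -
    have "count (evd H m) (Inr (i, j)) \<le> (\<Sum>j\<in>UNIV. count (evd H m) (Inr (i, j)))"
      by (intro member_le_sum) auto
    then show ?thesis using class_inv[of m i] ca[of m i] by linarith
  qed
  define B where "B = (\<Sum>v\<in>(UNIV :: ('i + 'i \<times> 'j) set). case v of Inl i \<Rightarrow> k i | Inr (i, j) \<Rightarrow> X0 i + k i)"
  have "m \<le> B" for m
  proof -
    have "m \<le> (\<Sum>v\<in>UNIV. count (evd H m) v)" by (rule count_ge[OF H0 Hmono])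
    also have "\<dots> \<le> B" unfolding B_def by (intro sum_mono) (auto simp: ca cs split: sum.split)
    finally show ?thesis .
  qed
  from this[of "Suc B"] show False by simp
qed

text \<open>Telescoping the routing over the events. The summands \<open>f k\<close> are indexed by the arrival number, as in
  the routing process, and not by the event number.\<close>

lemma busy_routing:
  assumes f: "\<And>m. Inl i \<in> fired H m \<Longrightarrow>
    f (Suc (count (evd H m) (Inl i))) = routed (evt H (Suc m)) (fired H m) (evd H m) i j"
  shows "busy (evd H m) i j + count (evd H m) (Inr (i, j)) =
    \<Psi>0 i j + (\<Sum>k=1..count (evd H m) (Inl i). f k)"
proof (induction m)
  case 0
  show ?case by (simp add: start_simps)
next
  case (Suc m)
  have l: "count (evd H (Suc m)) v = count (evd H m) v + of_bool (v \<in> fired H m)" for v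
    unfolding ev_Suc(2) step_simps ..
  have r: "routed (evt H (Suc m)) (fired H m) (evd H m) i j = 0" if "Inl i \<notin> fired H m"
    using that by (simp add: routed_def)
  have "(\<Sum>k=1..count (evd H (Suc m)) (Inl i). f k) =
      (\<Sum>k=1..count (evd H m) (Inl i). f k) + routed (evt H (Suc m)) (fired H m) (evd H m) i j"
    using f[of m] r by (cases "Inl i \<in> fired H m") (simp_all add: l)
  then show ?case using Suc busy_step[of m i j] l[of "Inr (i, j)"] by linarith
qed

lemma state_at_inv:
  shows "(\<Sum>i\<in>UNIV. busy (state_at H t) i j) \<le> N j"
    and "present (state_at H t) i + (\<Sum>j\<in>UNIV. count (state_at H t) (Inr (i, j))) = X0 i + count (state_at H t) (Inl i)"
  unfolding state_at_def by (rule station_inv class_inv)+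

lemma clock_arrival: "0 \<le> t \<Longrightarrow> clock H t (Inl i) = t"
  by (simp add: clock_def evT_arrival rate_simps)

lemma arrival_count:
  assumes "0 \<le> t"
  shows "H (Inl i) (count (state_at H t) (Inl i)) \<le> t" "t < H (Inl i) (Suc (count (state_at H t) (Inl i)))"
  using clock_bounds[OF H0 Hmono unbounded_events assms, where c="Inl i"] clock_arrival[OF assms] by auto

lemma state_at_routing:
  assumes t: "0 \<le> t"
  shows "busy (state_at H t) i j + count (state_at H t) (Inr (i, j)) =
    \<Psi>0 i j + (\<Sum>k | 1 \<le> k \<and> H (Inl i) k \<le> t.
      F i j (H (Inl i) k) (\<lambda>a. left_lim (\<lambda>s. present (state_at H s) a) (H (Inl i) k))
        (\<lambda>a. left_lim (\<lambda>s. queue (state_at H s) a) (H (Inl i) k))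
        (\<lambda>b. left_lim (\<lambda>s. idle (state_at H s) b) (H (Inl i) k))
        (\<lambda>a b. left_lim (\<lambda>s. busy (state_at H s) a b) (H (Inl i) k)) (c i k))" (is "_ = _ + (\<Sum>k | _. ?f k)")
proof -
  have ff: "?f (Suc (count (evd H m) (Inl i))) = routed (evt H (Suc m)) (fired H m) (evd H m) i j"
    if "Inl i \<in> fired H m" for m
  proof -
    have h: "H (Inl i) (Suc (count (evd H m) (Inl i))) = evt H (Suc m)"
      using fired_clock[OF H0 Hmono that] by (simp add: evT_arrival)
    have ll: "left_lim (\<lambda>s. g (state_at H s)) (evt H (Suc m)) = g (evd H m)" for g :: "_ \<Rightarrow> nat"
      by (rule left_lim_state_at[OF H0 Hmono unbounded_events])
    have "0 \<le> evt H (Suc m)" by (rule evt_nonneg[OF H0 Hmono])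
    then show ?thesis unfolding h using that
      by (simp add: ll[of "\<lambda>d. present d _"] ll[of "\<lambda>d. queue d _"] ll[of "\<lambda>d. idle d _"]
          ll[of "\<lambda>d. busy d _ _"] routed_def)
  qed
  have set: "{k. 1 \<le> k \<and> H (Inl i) k \<le> t} = {1..count (state_at H t) (Inl i)}"
  proof -
    have iff: "H (Inl i) k \<le> t \<longleftrightarrow> k \<le> count (state_at H t) (Inl i)" for k
    proof
      assume "H (Inl i) k \<le> t"
      then have "H (Inl i) k < H (Inl i) (Suc (count (state_at H t) (Inl i)))"
        using arrival_count(2)[OF t, of i] by simp
      then show "k \<le> count (state_at H t) (Inl i)" using strict_mono_less[OF Hmono] by (simp add: less_Suc_eq_le)
    next
      assume "k \<le> count (state_at H t) (Inl i)"
      then have "H (Inl i) k \<le> H (Inl i) (count (state_at H t) (Inl i))" using strict_mono_less_eq[OF Hmono] by simp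
      then show "H (Inl i) k \<le> t" using arrival_count(1)[OF t, of i] by simp
    qed
    show ?thesis unfolding iff by (rule set_eqI) simp
  qed
  show ?thesis unfolding set unfolding state_at_def[of H t]
    by (rule busy_routing) (use ff in blast)
qed

end
end

text \<open>The pathwise part of \<open>N_SCP\<close>.\<close>

definition controlled_path ::
    "('i \<times> 'j) set \<Rightarrow> ('j \<Rightarrow> nat) \<Rightarrow> ('i \<Rightarrow> nat) \<Rightarrow>
     ('i \<Rightarrow> real \<Rightarrow> 'w \<Rightarrow> nat) \<Rightarrow> ('i \<Rightarrow> 'j \<Rightarrow> real \<Rightarrow> 'w \<Rightarrow> nat) \<Rightarrow>
     ('i \<Rightarrow> 'j \<Rightarrow> nat) \<Rightarrow> ('i \<Rightarrow> 'j \<Rightarrow> ('i, 'j) routing_map) \<Rightarrow> ('i \<Rightarrow> nat \<Rightarrow> 'w \<Rightarrow> real) \<Rightarrow>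
     (real \<Rightarrow> 'w \<Rightarrow> 'i::finite \<Rightarrow> nat) \<Rightarrow> (real \<Rightarrow> 'w \<Rightarrow> 'i \<Rightarrow> nat) \<Rightarrow>
     (real \<Rightarrow> 'w \<Rightarrow> 'j::finite \<Rightarrow> nat) \<Rightarrow> (real \<Rightarrow> 'w \<Rightarrow> 'i \<Rightarrow> 'j \<Rightarrow> nat) \<Rightarrow> 'w \<Rightarrow> bool" where
  "controlled_path E N X0 A S \<Psi>0 F R X Y Z \<Psi> \<omega> \<longleftrightarrow>
        (\<forall>i. cadlag (\<lambda>t. X t \<omega> i)) \<and> (\<forall>i. cadlag (\<lambda>t. Y t \<omega> i)) \<and>
        (\<forall>j. cadlag (\<lambda>t. Z t \<omega> j)) \<and> (\<forall>i j. cadlag (\<lambda>t. \<Psi> t \<omega> i j)) \<and>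
        (\<forall>i j. \<Psi> 0 \<omega> i j = \<Psi>0 i j) \<and>
        (\<forall>t\<ge>0. \<forall>i j.
           ((i, j) \<notin> E \<longrightarrow> \<Psi> t \<omega> i j = 0) \<and>
           X t \<omega> i + (\<Sum>j'\<in>UNIV. S i j' (integral {0..t} (\<lambda>s. real (\<Psi> s \<omega> i j'))) \<omega>)
             = X0 i + A i t \<omega> \<and>
           Y t \<omega> i + (\<Sum>j'\<in>UNIV. \<Psi> t \<omega> i j') = X t \<omega> i \<and>
           Z t \<omega> j + (\<Sum>i'\<in>UNIV. \<Psi> t \<omega> i' j) = N j \<and>
           \<Psi> t \<omega> i j + S i j (integral {0..t} (\<lambda>s. real (\<Psi> s \<omega> i j))) \<omega>
             = \<Psi> 0 \<omega> i j + routing (A i) (F i j) (R i) X Y Z \<Psi> t \<omega> \<and>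
           ((i, j) \<notin> E \<longrightarrow> routing (A i) (F i j) (R i) X Y Z \<Psi> t \<omega> = 0))"

text \<open>The event system is fed with the partial sums of the interarrival times and with the jump times
  of the Poisson processes. Almost surely both are strictly increasing sequences that start at zero.\<close>

theorem (in prob_space) controlled_process_exists:
  fixes U :: "'i::finite \<Rightarrow> nat \<Rightarrow> 'a \<Rightarrow> real" and S :: "'i \<Rightarrow> 'j::finite \<Rightarrow> real \<Rightarrow> 'a \<Rightarrow> nat" and c :: "'i \<Rightarrow> nat \<Rightarrow> real"
  assumes pol: "capacity_policy N X0 \<Psi>0 F"
    and U_meas: "\<And>i k. 1 \<le> k \<Longrightarrow> U i k \<in> borel_measurable M"
    and U_pos: "\<And>i k \<omega>. 1 \<le> k \<Longrightarrow> \<omega> \<in> space M \<Longrightarrow> 0 < U i k \<omega>"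
    and U_unb: "\<And>i. AE \<omega> in M. \<forall>L. \<exists>m. L < (\<Sum>k=1..m. U i k \<omega>)"
    and l: "\<And>i. 0 < l i"
    and S: "\<And>i j. poisson_process M (r i j) (S i j)" and r: "\<And>i j. 0 < r i j"
    and A_meas: "\<And>i t. 0 \<le> t \<Longrightarrow> arrivals (l i) (U i) t \<in> M \<rightarrow>\<^sub>M count_space UNIV"
  shows "\<exists>X Y Z \<Psi>. N_SCP M UNIV N X0 (\<lambda>i. arrivals (l i) (U i)) S \<Psi>0 F (\<lambda>i k \<omega>. c i k) X Y Z \<Psi>"
proof -
  interpret capacity_policy N X0 \<Psi>0 F c by (rule pol)
  define H :: "'a \<Rightarrow> 'i + 'i \<times> 'j \<Rightarrow> nat \<Rightarrow> real" where
    "H \<omega> v k = (case v of Inl i \<Rightarrow> (\<Sum>m=1..k. U i m \<omega> / l i) | Inr (i, j) \<Rightarrow> jump_time (S i j) k \<omega>)" for \<omega> v k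
  have H_simps: "H \<omega> (Inl i) k = (\<Sum>m=1..k. U i m \<omega> / l i)" "H \<omega> (Inr (i, j)) k = jump_time (S i j) k \<omega>" for \<omega> i j k
    by (simp_all add: H_def)
  have H_meas: "(\<lambda>\<omega>. H \<omega> v k) \<in> borel_measurable M" for v k
  proof (cases v)
    case (Inl i)
    then show ?thesis unfolding Inl H_simps
      by (intro borel_measurable_sum borel_measurable_divide U_meas) auto
  next
    case (Inr ij)
    then show ?thesis using jump_time_measurable[OF S] by (cases ij) (simp add: H_simps)
  qed
  let ?X = "\<lambda>t \<omega>. present (state_at (H \<omega>) t)" and ?Y = "\<lambda>t \<omega>. queue (state_at (H \<omega>) t)"
  let ?Z = "\<lambda>t \<omega>. idle (state_at (H \<omega>) t)" and ?P = "\<lambda>t \<omega>. busy (state_at (H \<omega>) t)"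
  let ?A = "\<lambda>i. arrivals (l i) (U i)" and ?R = "\<lambda>i k \<omega>. c i k"
  have dmeas: "(\<lambda>\<omega>. g (state_at (H \<omega>) t)) \<in> M \<rightarrow>\<^sub>M count_space UNIV" for g :: "('i, 'j) dstate \<Rightarrow> nat" and t
    by (rule measurable_compose[OF state_at_measurable[of H M t, OF H_meas]]) simp
  have psets: "process_sets M {0..} (count_space UNIV) V \<subseteq> events"
    if "\<And>t. 0 \<le> t \<Longrightarrow> V t \<in> M \<rightarrow>\<^sub>M count_space UNIV" for V :: "real \<Rightarrow> 'a \<Rightarrow> nat"
    unfolding process_sets_def using that
    by (intro sets.sigma_sets_subset) (auto intro: measurable_sets)
  have indep: "indep_sets (\<lambda>v. case v of
           None \<Rightarrow> sigma_sets (space M)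
             ((\<Union>i. process_sets M {0..} (count_space UNIV) (?A i)) \<union>
              (\<Union>i j. process_sets M {0..} (count_space UNIV) (S i j)))
         | Some i \<Rightarrow> process_sets M {1..} borel (?R i)) UNIV"
  proof (rule indep_sets_trivial[where ?i0.0 = None])
    have "S i j t \<in> M \<rightarrow>\<^sub>M count_space UNIV" if "0 \<le> t" for i j t
      using S[of i j] that by (simp add: poisson_process_def)
    then have "(\<Union>i. process_sets M {0..} (count_space UNIV) (?A i)) \<union>
              (\<Union>i j. process_sets M {0..} (count_space UNIV) (S i j)) \<subseteq> events"
      using psets A_meas by (intro Un_least UN_least) blast+
    then show "(case None of
           None \<Rightarrow> sigma_sets (space M)
             ((\<Union>i. process_sets M {0..} (count_space UNIV) (?A i)) \<union>
              (\<Union>i j. process_sets M {0..} (count_space UNIV) (S i j)))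
         | Some i \<Rightarrow> process_sets M {1..} borel (?R i)) \<subseteq> events"
      by (simp add: sets.sigma_sets_subset)
  next
    fix v :: "'i option" assume "v \<noteq> None"
    then show "(case v of
           None \<Rightarrow> sigma_sets (space M)
             ((\<Union>i. process_sets M {0..} (count_space UNIV) (?A i)) \<union>
              (\<Union>i j. process_sets M {0..} (count_space UNIV) (S i j)))
         | Some i \<Rightarrow> process_sets M {1..} borel (?R i)) \<subseteq> {{}, space M}"
      using process_sets_const by (cases v) auto
  qed
  have g1: "AE \<omega> in M. \<forall>i L. \<exists>m. L < (\<Sum>k=1..m. U i k \<omega>)"
    by (rule AE_all_countable[THEN iffD2]) (use U_unb in blast)
  have g2: "AE \<omega> in M. \<forall>i j. jump_time (S i j) 0 \<omega> = 0 \<and> strict_mono (\<lambda>k. jump_time (S i j) k \<omega>) \<and>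
      (\<forall>t\<ge>0. \<forall>k. k \<le> S i j t \<omega> \<longleftrightarrow> jump_time (S i j) k \<omega> \<le> t)"
    by (intro AE_all_countable[THEN iffD2] allI poisson_good_paths[OF S r])
  have good: "AE \<omega> in M. (\<forall>i L. \<exists>m. L < (\<Sum>k=1..m. U i k \<omega>)) \<and>
    (\<forall>i j. jump_time (S i j) 0 \<omega> = 0 \<and> strict_mono (\<lambda>k. jump_time (S i j) k \<omega>) \<and>
      (\<forall>t\<ge>0. \<forall>k. k \<le> S i j t \<omega> \<longleftrightarrow> jump_time (S i j) k \<omega> \<le> t)) \<and> \<omega> \<in> space M"
    by (rule AE_conjI[OF g1 AE_conjI[OF g2 AE_space]])
  have path: "controlled_path UNIV N X0 ?A S \<Psi>0 F ?R ?X ?Y ?Z ?P \<omega>"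
    if w: "\<omega> \<in> space M" and unbU: "\<And>i L. \<exists>m. L < (\<Sum>k=1..m. U i k \<omega>)"
      and J: "\<And>i j. jump_time (S i j) 0 \<omega> = 0" "\<And>i j. strict_mono (\<lambda>k. jump_time (S i j) k \<omega>)"
        "\<And>i j t k. 0 \<le> t \<Longrightarrow> k \<le> S i j t \<omega> \<longleftrightarrow> jump_time (S i j) k \<omega> \<le> t" for \<omega>
  proof -
    have unbUl: "\<exists>m. L < (\<Sum>k=1..m. U i k \<omega> / l i)" for i L
      using unbU[of "L * l i" i] l[of i] by (auto simp: sum_divide_distrib[symmetric] pos_less_divide_eq)
    have H0: "H \<omega> v 0 = 0" for v using J(1) by (auto simp: H_def split: sum.split)
    have Hm: "strict_mono (H \<omega> v)" for v
    proof (cases v)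
      case (Inl i)
      have "strict_mono (\<lambda>k. \<Sum>m=1..k. U i m \<omega> / l i)"
        using U_pos w l by (intro strict_mono_partial_sums) auto
      then show ?thesis unfolding Inl H_def by simp
    next
      case (Inr ij)
      then obtain a b where "v = Inr (a, b)" by (cases ij) auto
      then have "H \<omega> v = (\<lambda>k. jump_time (S a b) k \<omega>)" by (intro ext) (simp add: H_simps)
      then show ?thesis using J(2) by simp
    qed
    have Hu: "\<exists>k. L < H \<omega> (Inl i) k" for i L using unbUl by (simp add: H_simps)
    note unb = unbounded_events[of "H \<omega>", OF H0 Hm Hu]
    note cad = cadlag_state_at[of "H \<omega>", OF H0 Hm unb]
    have A: "?A i t \<omega> = count (state_at (H \<omega>) t) (Inl i)" if t: "0 \<le> t" for i t
    proof -
      obtain K where K: "t < (\<Sum>k=1..K. U i k \<omega> / l i)" using unbUl by blast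
      have "k \<le> ?A i t \<omega> \<longleftrightarrow> H \<omega> (Inl i) k \<le> t" for k
        unfolding H_simps by (rule arrivals_iff[where u="U i" and \<omega>=\<omega>, OF U_pos[OF _ w] l t K])
      then show ?thesis using arrival_count[of "H \<omega>", OF H0 Hm Hu t, of i]
        by (metis not_le not_less_eq_eq order_antisym)
    qed
    have jt: "jump_time (?A i) k \<omega> = H \<omega> (Inl i) k" for i k
      unfolding H_simps by (intro jump_time_arrivals[where u="U i" and \<omega>=\<omega>] U_pos w l unbUl)
    have SI: "S i j (integral {0..t} (\<lambda>s. real (?P s \<omega> i j))) \<omega> = count (state_at (H \<omega>) t) (Inr (i, j))"
      if t: "0 \<le> t" for i j t
    proof -
      let ?v = "Inr (i, j) :: 'i + 'i \<times> 'j"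
      let ?n = "count (state_at (H \<omega>) t) ?v" and ?c = "clock (H \<omega>) t ?v"
      have int: "integral {0..t} (\<lambda>s. real (?P s \<omega> i j)) = ?c"
        using integral_unique[OF rate_integral[of "H \<omega>", OF H0 Hm unb t, of ?v]]
        by (simp add: rate_simps)
      have cb: "H \<omega> ?v ?n \<le> ?c" "?c < H \<omega> ?v (Suc ?n)"
        by (rule clock_bounds[of "H \<omega>", OF H0 Hm unb t])+
      have "H \<omega> ?v 0 \<le> H \<omega> ?v ?n" using strict_mono_less_eq[OF Hm] by blast
      then have c0: "0 \<le> ?c" using cb(1) H0[of ?v] by linarith
      have "?n \<le> S i j ?c \<omega>" "\<not> Suc ?n \<le> S i j ?c \<omega>"
        using J(3)[OF c0, of _ i j] cb unfolding H_simps by auto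
      then show ?thesis unfolding int by linarith
    qed
    have rt: "routing (?A i) (F i j) (?R i) ?X ?Y ?Z ?P t \<omega> + \<Psi>0 i j =
        ?P t \<omega> i j + count (state_at (H \<omega>) t) (Inr (i, j))" if "0 \<le> t" for i j t
      using state_at_routing[of "H \<omega>", OF H0 Hm Hu that, of i j]
      unfolding routing_def Let_def jt by simp
    have P0: "?P 0 \<omega> = \<Psi>0" using state_at_0[of "H \<omega>", OF H0 Hm unb] by (simp add: start_simps)
    have st: "(\<Sum>i\<in>UNIV. ?P t \<omega> i j) \<le> N j" for t j
      by (rule state_at_inv[of "H \<omega>", OF H0 Hm Hu])
    have cl: "?X t \<omega> i + (\<Sum>j\<in>UNIV. count (state_at (H \<omega>) t) (Inr (i, j))) = X0 i + count (state_at (H \<omega>) t) (Inl i)" for t i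
      by (rule state_at_inv[of "H \<omega>", OF H0 Hm Hu])
    show ?thesis unfolding controlled_path_def
    proof (intro conjI allI impI)
      show "cadlag (\<lambda>t. ?X t \<omega> i)" "cadlag (\<lambda>t. ?Y t \<omega> i)" "cadlag (\<lambda>t. ?Z t \<omega> j)"
        "cadlag (\<lambda>t. ?P t \<omega> i j)" for i j
        using cad[of "\<lambda>d. present d i"] cad[of "\<lambda>d. queue d i"] cad[of "\<lambda>d. idle d j"]
          cad[of "\<lambda>d. busy d i j"] .
      fix t :: real and i :: 'i and j :: 'j assume t: "0 \<le> t"
      show "?X t \<omega> i + (\<Sum>j'\<in>UNIV. S i j' (integral {0..t} (\<lambda>s. real (?P s \<omega> i j'))) \<omega>)
             = X0 i + ?A i t \<omega>"
        unfolding SI[OF t] A[OF t] by (rule cl)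
      show "?Z t \<omega> j + (\<Sum>i'\<in>UNIV. ?P t \<omega> i' j) = N j"
        using st[of t j] by (simp add: idle_def)
      show "?P t \<omega> i j + S i j (integral {0..t} (\<lambda>s. real (?P s \<omega> i j))) \<omega>
             = ?P 0 \<omega> i j + routing (?A i) (F i j) (?R i) ?X ?Y ?Z ?P t \<omega>"
        unfolding SI[OF t] P0 using rt[OF t, of i j] by simp
    qed (simp_all add: P0 present_def)
  qed
  have AE_path: "AE \<omega> in M. controlled_path UNIV N X0 ?A S \<Psi>0 F ?R ?X ?Y ?Z ?P \<omega>"
    using good by eventually_elim (rule path; blast)
  show ?thesis
  proof (intro exI)
    show "N_SCP M UNIV N X0 ?A S \<Psi>0 F ?R ?X ?Y ?Z ?P"
      unfolding N_SCP_def
    proof (intro conjI allI impI)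
      show "indep_vars (\<lambda>_. borel) (?R i) {1..}" for i by (rule indep_vars_const) simp
      show "(\<lambda>\<omega>. ?X t \<omega> i) \<in> M \<rightarrow>\<^sub>M count_space UNIV" "(\<lambda>\<omega>. ?Y t \<omega> i) \<in> M \<rightarrow>\<^sub>M count_space UNIV"
        "(\<lambda>\<omega>. ?Z t \<omega> j) \<in> M \<rightarrow>\<^sub>M count_space UNIV" "(\<lambda>\<omega>. ?P t \<omega> i j) \<in> M \<rightarrow>\<^sub>M count_space UNIV" for t i j
        using dmeas[of "\<lambda>d. present d i" t] dmeas[of "\<lambda>d. queue d i" t] dmeas[of "\<lambda>d. idle d j" t]
          dmeas[of "\<lambda>d. busy d i j" t] .
    qed (rule initial_class initial_station F_measurable indep AE_path[unfolded controlled_path_def] | simp)+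
  qed
qed

section \<open>Routing by arrival number\<close>

text \<open>Target and actual content of an activity solve the same linear Volterra equation up to an error that
  consists of the rounding at time zero, the error of the input and the centered service process.\<close>

lemma activity_tracking:
  fixes P :: "real \<Rightarrow> nat" and s :: "real \<Rightarrow> nat" and q b B :: "real \<Rightarrow> real"
  assumes \<mu>: "0 < \<mu>" and T: "0 \<le> T"
    and rc: "\<And>t. 0 \<le> t \<Longrightarrow> continuous (at_right t) P"
    and Pn: "\<And>t. 0 \<le> t \<Longrightarrow> P t \<le> n"
    and s: "\<And>u. 0 \<le> u \<Longrightarrow> u \<le> real n * T \<Longrightarrow> \<bar>real (s u) - \<mu> * u\<bar> \<le> x"
    and eq: "\<And>t. 0 \<le> t \<Longrightarrow> t \<le> T \<Longrightarrow>
      real (P t) + real (s (integral {0..t} (\<lambda>u. real (P u)))) = p0 + B t"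
    and q: "continuous_on {0..T} q"
    and q_eq: "\<And>t. 0 \<le> t \<Longrightarrow> t \<le> T \<Longrightarrow> q t = q 0 + b t - \<mu> * integral {0..t} q"
    and p0: "\<bar>p0 - q 0\<bar> \<le> 1" and B: "\<And>t. 0 \<le> t \<Longrightarrow> t \<le> T \<Longrightarrow> \<bar>B t - b t\<bar> \<le> y"
  shows "\<bar>real (P T) - q T\<bar> \<le> 2 * (1 + y + x) * exp (2 * \<mu> * T)"
proof -
  have rc': "continuous (at_right t) (\<lambda>u. real (P u))" if "0 \<le> t" for t
    using rc[OF that] unfolding continuous_within tendsto_discrete
    by (intro tendsto_eventually) (auto elim: eventually_mono)
  have Pi: "(\<lambda>u. real (P u)) integrable_on {0..t}" for t
    by (rule bounded_right_continuous_integrable[of _ _ "real n"]) (use rc' Pn in auto)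
  have qi: "q integrable_on {0..t}" if "t \<le> T" for t
    using q that by (intro integrable_continuous_interval) (auto intro: continuous_on_subset)
  have "bounded (q ` {0..T})" using compact_imp_bounded[OF compact_continuous_image[OF q compact_Icc]] .
  then obtain C where "\<forall>v\<in>q ` {0..T}. norm v \<le> C" unfolding bounded_iff by blast
  then have C: "\<bar>q t\<bar> \<le> C" if "t \<in> {0..T}" for t using that by auto
  show ?thesis
  proof (rule volterra_bound[where \<Delta>="\<lambda>t. real (P t) - q t" and m=\<mu> and T=T and B="real n + C" and
        e="\<lambda>t. (p0 - q 0) + (B t - b t) - (real (s (integral {0..t} (\<lambda>u. real (P u)))) - \<mu> * integral {0..t} (\<lambda>u. real (P u)))"])
    show "(\<lambda>t. real (P t) - q t) integrable_on {0..T}"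
      using Pi qi by (intro integrable_diff) auto
    show "\<bar>real (P t) - q t\<bar> \<le> real n + C" if "0 \<le> t" "t \<le> T" for t
      using Pn[OF that(1)] C[of t] that by auto
    fix t assume t: "0 \<le> t" "t \<le> T"
    let ?I = "integral {0..t} (\<lambda>u. real (P u))"
    have I: "integral {0..t} (\<lambda>u. real (P u) - q u) = ?I - integral {0..t} q"
      using Pi qi t by (intro integral_diff) auto
    show "real (P t) - q t = (p0 - q 0) + (B t - b t) - (real (s ?I) - \<mu> * ?I) -
        \<mu> * integral {0..t} (\<lambda>u. real (P u) - q u)"
      unfolding I right_diff_distrib using eq[OF t] q_eq[OF t] by linarith
    have I0: "0 \<le> ?I" by (intro integral_nonneg Pi) auto
    have "?I \<le> integral {0..t} (\<lambda>u. real n)" using Pn by (intro integral_le Pi) auto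
    also have "\<dots> = real n * t" using t by simp
    also have "\<dots> \<le> real n * T" using t by (intro mult_left_mono) auto
    finally show "\<bar>(p0 - q 0) + (B t - b t) - (real (s ?I) - \<mu> * ?I)\<bar> \<le> 1 + y + x"
      using s[OF I0] p0 B[OF t] by linarith
  qed (use \<mu> T in auto)
qed

text \<open>Routing the arrivals whose numbers satisfy this predicate keeps the number of routed arrivals equal to
  the integer part of \<open>G\<close>, see \<open>sum_crosses_integer\<close>. Thus the error does not accumulate.\<close>

definition crosses_integer :: "(nat \<Rightarrow> real) \<Rightarrow> nat \<Rightarrow> bool" where
  "crosses_integer G k \<longleftrightarrow> \<lfloor>G (k - 1)\<rfloor> < \<lfloor>G k\<rfloor>"

lemma sum_crosses_integer:
  assumes "G 0 = 0" and "\<And>k. k < m \<Longrightarrow> 0 \<le> G (Suc k) - G k \<and> G (Suc k) - G k \<le> 1"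
  shows "int (\<Sum>k=1..m. of_bool (crosses_integer G k)) = \<lfloor>G m\<rfloor>"
  using assms(2)
proof (induction m)
  case (Suc m)
  have IH: "int (\<Sum>k=1..m. of_bool (crosses_integer G k)) = \<lfloor>G m\<rfloor>" using Suc by simp
  have "0 \<le> G (Suc m) - G m" "G (Suc m) - G m \<le> 1" using Suc.prems[of m] by auto
  then have "\<lfloor>G m\<rfloor> \<le> \<lfloor>G (Suc m)\<rfloor>" "\<lfloor>G (Suc m)\<rfloor> \<le> \<lfloor>G m\<rfloor> + 1"
    by (auto intro: floor_mono) linarith
  then have "int (of_bool (crosses_integer G (Suc m))) = \<lfloor>G (Suc m)\<rfloor> - \<lfloor>G m\<rfloor>"
    by (auto simp: crosses_integer_def)
  then show ?case using IH by simp
qed (simp add: assms(1))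

text \<open>An arrival goes to \<open>j0\<close> or \<open>j1\<close> according to the mark \<open>r\<close>; after time \<open>\<epsilon>\<close> it also takes the queue of its
  class to station \<open>j1\<close>. The policy acts only if each station could accommodate one new
  customer of every class and, after time \<open>\<epsilon>\<close>, all queues. This is what simultaneous arrivals may
  require.\<close>

definition static_policy ::
    "'j \<Rightarrow> 'j \<Rightarrow> real \<Rightarrow> 'i::finite \<Rightarrow> 'j \<Rightarrow> ('i, 'j) routing_map" where
  "static_policy j0 j1 \<epsilon> i j t x y z p r =
     (if \<forall>b. CARD('i) + (if \<epsilon> < t then \<Sum>a\<in>UNIV. y a else 0) \<le> z b
      then of_bool (j = (if 1 / 2 < r then j0 else j1)) + (if \<epsilon> < t \<and> j = j1 then y i else 0)
      else 0)"

lemma static_policy_class: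
  "(\<Sum>j\<in>UNIV. static_policy j0 j1 \<epsilon> i j t x y z p r) \<le> Suc (y i)" for j0 j1 :: "'j::finite"
proof -
  have "(\<Sum>j\<in>UNIV. static_policy j0 j1 \<epsilon> i j t x y z p r) \<le>
      (\<Sum>j\<in>UNIV. of_bool (j = (if 1 / 2 < r then j0 else j1)) + (if j = j1 then y i else 0))"
    by (intro sum_mono) (auto simp: static_policy_def)
  also have "\<dots> = Suc (y i)" by (simp add: sum.distrib of_bool_def)
  finally show ?thesis .
qed

lemma static_policy_station:
  "(\<Sum>i\<in>UNIV. static_policy j0 j1 \<epsilon> (i::'i::finite) j t x y z p (r i)) \<le> z j"
proof (cases "\<forall>b. CARD('i) + (if \<epsilon> < t then \<Sum>a\<in>UNIV. y a else 0) \<le> z b")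
  case True
  have "(\<Sum>i\<in>UNIV. static_policy j0 j1 \<epsilon> (i::'i) j t x y z p (r i)) \<le>
      (\<Sum>i\<in>(UNIV::'i set). 1 + (if \<epsilon> < t then y i else 0))"
    by (intro sum_mono) (auto simp: static_policy_def)
  also have "\<dots> = CARD('i) + (if \<epsilon> < t then \<Sum>a\<in>UNIV. y a else 0)"
    unfolding sum.distrib by (cases "\<epsilon> < t") simp_all
  also have "\<dots> \<le> z j" using True by blast
  finally show ?thesis .
next
  case False
  then have "static_policy j0 j1 \<epsilon> i j t x y z p (r i) = 0" for i :: 'i
    unfolding static_policy_def by (rule if_not_P)
  then show ?thesis by simp
qed

lemma static_policy_measurable:
  fixes i :: "'i::finite" and j :: "'j::finite"
  shows "(\<lambda>(t, x, y, z, p, r). static_policy j0 j1 \<epsilon> i j t x y z p r) \<in> measurable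
        (restrict_space borel {0..} \<Otimes>\<^sub>M count_space UNIV \<Otimes>\<^sub>M count_space UNIV \<Otimes>\<^sub>M
         count_space UNIV \<Otimes>\<^sub>M count_space UNIV \<Otimes>\<^sub>M borel) (count_space UNIV)" (is "_ \<in> measurable ?M _")
proof -
  define h :: "bool \<times> bool \<times> ('i \<Rightarrow> nat) \<times> ('j \<Rightarrow> nat) \<Rightarrow> nat" where
    "h = (\<lambda>(u, v, y, z). (if \<forall>b. CARD('i) + (if u then \<Sum>a\<in>UNIV. y a else 0) \<le> z b
      then of_bool (j = (if v then j0 else j1)) + (if u \<and> j = j1 then y i else 0) else 0))"
  let ?t = "\<lambda>w. fst w :: real" and ?y = "\<lambda>w. fst (snd (snd w)) :: 'i \<Rightarrow> nat"
    and ?z = "\<lambda>w. fst (snd (snd (snd w))) :: 'j \<Rightarrow> nat" and ?r = "\<lambda>w. snd (snd (snd (snd (snd w)))) :: real"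
  have t: "?t \<in> borel_measurable ?M"
    by (rule measurable_compose[OF measurable_fst]) (simp add: measurable_restrict_space1)
  have y: "?y \<in> ?M \<rightarrow>\<^sub>M count_space UNIV" and z: "?z \<in> ?M \<rightarrow>\<^sub>M count_space UNIV"
    and r: "?r \<in> borel_measurable ?M" by measurable
  have "(\<lambda>w. \<epsilon> < ?t w) \<in> ?M \<rightarrow>\<^sub>M count_space UNIV" "(\<lambda>w. 1 / 2 < ?r w) \<in> ?M \<rightarrow>\<^sub>M count_space UNIV"
    by (rule measurable_compose[OF t] measurable_compose[OF r], measurable)+
  then have "(\<lambda>w. (\<epsilon> < ?t w, 1 / 2 < ?r w, ?y w, ?z w)) \<in> ?M \<rightarrow>\<^sub>M count_space UNIV"
    using y z by (intro measurable_Pair_count_space)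
  then have "(\<lambda>w. h (\<epsilon> < ?t w, 1 / 2 < ?r w, ?y w, ?z w)) \<in> ?M \<rightarrow>\<^sub>M count_space UNIV"
    by (rule measurable_compose[where g=h]) simp
  also have "(\<lambda>w. h (\<epsilon> < ?t w, 1 / 2 < ?r w, ?y w, ?z w)) =
      (\<lambda>(t, x, y, z, p, r). static_policy j0 j1 \<epsilon> i j t x y z p r)"
    by (rule ext) (simp only: h_def static_policy_def case_prod_beta fst_conv snd_conv)
  finally show ?thesis .
qed

lemma cadlag_nat_left:
  fixes f :: "real \<Rightarrow> nat"
  assumes "cadlag f" "0 < t"
  shows "\<forall>\<^sub>F s in at_left t. f s = left_lim f t"
proof -
  obtain l where l: "(f \<longlongrightarrow> l) (at_left t)" using assms by (auto simp: cadlag_def)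
  then have "left_lim f t = l" unfolding left_lim_def by (intro tendsto_Lim) auto
  then show ?thesis using l by (simp add: tendsto_discrete)
qed

section \<open>Queues along a typical path\<close>

text \<open>A fixed path of a system under the static policy: \<open>\<tau> i k\<close> is the time of the \<open>k\<close>th arrival of class
  \<open>i\<close>, and \<open>G i\<close> is the curve that determines the marks.\<close>

locale routed_path =
  fixes j0 j1 :: "'j::finite" and N :: "'j \<Rightarrow> nat" and X0 :: "'i::finite \<Rightarrow> nat" and \<Psi>0 :: "'i \<Rightarrow> 'j \<Rightarrow> nat"
    and A :: "'i \<Rightarrow> real \<Rightarrow> nat" and \<tau> :: "'i \<Rightarrow> nat \<Rightarrow> real" and s :: "'i \<Rightarrow> 'j \<Rightarrow> real \<Rightarrow> nat"
    and G :: "'i \<Rightarrow> nat \<Rightarrow> real" and \<epsilon> :: real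
    and X :: "real \<Rightarrow> 'i \<Rightarrow> nat" and Y :: "real \<Rightarrow> 'i \<Rightarrow> nat" and Z :: "real \<Rightarrow> 'j \<Rightarrow> nat"
    and P :: "real \<Rightarrow> 'i \<Rightarrow> 'j \<Rightarrow> nat"
  assumes stations: "j0 \<noteq> j1" "UNIV = {j0, j1}"
    and \<tau>_0: "\<And>i. \<tau> i 0 = 0" and \<tau>_mono: "\<And>i. strict_mono (\<tau> i)"
    and A_iff: "\<And>i k t. 0 \<le> t \<Longrightarrow> k \<le> A i t \<longleftrightarrow> \<tau> i k \<le> t"
    and cadlag_Y: "\<And>i. cadlag (\<lambda>t. Y t i)" and cadlag_Z: "\<And>j. cadlag (\<lambda>t. Z t j)"
    and cadlag_P: "\<And>i j. cadlag (\<lambda>t. P t i j)"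
    and class_eq: "\<And>t i. 0 \<le> t \<Longrightarrow> Y t i + (\<Sum>j\<in>UNIV. P t i j) +
      (\<Sum>j\<in>UNIV. s i j (integral {0..t} (\<lambda>u. real (P u i j)))) = X0 i + A i t"
    and station_eq: "\<And>t j. 0 \<le> t \<Longrightarrow> Z t j + (\<Sum>i\<in>UNIV. P t i j) = N j"
    and routing_eq: "\<And>t i j. 0 \<le> t \<Longrightarrow> P t i j + s i j (integral {0..t} (\<lambda>u. real (P u i j))) =
      \<Psi>0 i j + (\<Sum>k | 1 \<le> k \<and> \<tau> i k \<le> t. static_policy j0 j1 \<epsilon> i j (\<tau> i k)
        (\<lambda>a. left_lim (\<lambda>s. X s a) (\<tau> i k)) (\<lambda>a. left_lim (\<lambda>s. Y s a) (\<tau> i k))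
        (\<lambda>b. left_lim (\<lambda>s. Z s b) (\<tau> i k)) (\<lambda>a b. left_lim (\<lambda>s. P s a b) (\<tau> i k)) (of_bool (crosses_integer (G i) k)))"
    and initial_class: "\<And>i. (\<Sum>j\<in>UNIV. \<Psi>0 i j) \<le> X0 i"
begin

definition Yl :: "'i \<Rightarrow> nat \<Rightarrow> 'i \<Rightarrow> nat" where "Yl i k a = left_lim (\<lambda>s. Y s a) (\<tau> i k)"
definition Zl :: "'i \<Rightarrow> nat \<Rightarrow> 'j \<Rightarrow> nat" where "Zl i k b = left_lim (\<lambda>s. Z s b) (\<tau> i k)"

definition admitted :: "'i \<Rightarrow> nat \<Rightarrow> bool" where
  "admitted i k \<longleftrightarrow> (\<forall>b. CARD('i) + (if \<epsilon> < \<tau> i k then \<Sum>a\<in>UNIV. Yl i k a else 0) \<le> Zl i k b)"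

definition to :: "'i \<Rightarrow> 'j \<Rightarrow> nat \<Rightarrow> nat" where
  "to i j k = static_policy j0 j1 \<epsilon> i j (\<tau> i k)
        (\<lambda>a. left_lim (\<lambda>s. X s a) (\<tau> i k)) (Yl i k) (Zl i k)
        (\<lambda>a b. left_lim (\<lambda>s. P s a b) (\<tau> i k)) (of_bool (crosses_integer (G i) k))"

text \<open>The number of class \<open>i\<close> customers taken from the queue by the first \<open>m\<close> arrivals, provided that these
  are admitted.\<close>

definition bulk :: "'i \<Rightarrow> nat \<Rightarrow> nat" where
  "bulk i m = (\<Sum>k=1..m. if \<epsilon> < \<tau> i k then Yl i k i else 0)"

definition Y0 :: "'i \<Rightarrow> nat" where "Y0 i = X0 i - (\<Sum>j\<in>UNIV. \<Psi>0 i j)"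

lemma sum_stations: "(\<Sum>j\<in>UNIV. f j) = f j0 + f j1" for f :: "'j \<Rightarrow> 'x::comm_monoid_add"
  using stations(1) by (simp add: stations(2))

lemma station_cases: "j = j0 \<or> j = j1"
  using stations(2) by auto

lemma arrivals_set: "0 \<le> t \<Longrightarrow> {k. 1 \<le> k \<and> \<tau> i k \<le> t} = {1..A i t}"
  using A_iff[of t _ i] by (intro set_eqI) auto

lemma routing: "0 \<le> t \<Longrightarrow> P t i j + s i j (integral {0..t} (\<lambda>u. real (P u i j))) =
    \<Psi>0 i j + (\<Sum>k=1..A i t. to i j k)"
  using routing_eq[of t i j] arrivals_set[of t i] by (simp add: to_def Yl_def[abs_def] Zl_def[abs_def])

lemma to_admitted:
  assumes "admitted i k"
  shows "to i j k = of_bool (j = (if crosses_integer (G i) k then j0 else j1)) + (if \<epsilon> < \<tau> i k \<and> j = j1 then Yl i k i else 0)"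
proof -
  have "(1 / 2 < (of_bool b :: real)) = b" for b by simp
  then show ?thesis using assms unfolding to_def static_policy_def admitted_def by simp
qed

lemma to_sums:
  assumes "\<And>k. 1 \<le> k \<Longrightarrow> k \<le> m \<Longrightarrow> admitted i k"
  shows "(\<Sum>k=1..m. to i j0 k) = (\<Sum>k=1..m. of_bool (crosses_integer (G i) k))"
    and "(\<Sum>k=1..m. to i j1 k) + (\<Sum>k=1..m. of_bool (crosses_integer (G i) k)) = m + bulk i m"
proof -
  have 0: "to i j0 k = of_bool (crosses_integer (G i) k)" if "k \<in> {1..m}" for k
    using to_admitted[of i k j0] assms that stations(1) by simp
  then show "(\<Sum>k=1..m. to i j0 k) = (\<Sum>k=1..m. of_bool (crosses_integer (G i) k))" by (rule sum.cong[OF refl])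
  have 1: "to i j1 k + of_bool (crosses_integer (G i) k) = 1 + (if \<epsilon> < \<tau> i k then Yl i k i else 0)" if "k \<in> {1..m}" for k
    using to_admitted[of i k j1] assms that stations(1) by simp
  have "(\<Sum>k=1..m. to i j1 k) + (\<Sum>k=1..m. of_bool (crosses_integer (G i) k)) =
      (\<Sum>k=1..m. to i j1 k + of_bool (crosses_integer (G i) k))" by (simp only: sum.distrib)
  also have "\<dots> = (\<Sum>k=1..m. 1 + (if \<epsilon> < \<tau> i k then Yl i k i else 0))" by (intro sum.cong refl 1)
  also have "\<dots> = m + bulk i m" unfolding sum.distrib bulk_def by simp
  finally show "(\<Sum>k=1..m. to i j1 k) + (\<Sum>k=1..m. of_bool (crosses_integer (G i) k)) = m + bulk i m" .
qed

text \<open>An admitted arrival is routed at once, hence the queue consists of initial customers only.\<close>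

lemma queue_eq:
  assumes t: "0 \<le> t" and adm: "\<And>k. 1 \<le> k \<Longrightarrow> \<tau> i k \<le> t \<Longrightarrow> admitted i k"
  shows "Y t i + bulk i (A i t) = Y0 i"
proof -
  have adm': "admitted i k" if "1 \<le> k" "k \<le> A i t" for k using that adm A_iff[OF t] by blast
  have "P t i j0 + s i j0 (integral {0..t} (\<lambda>u. real (P u i j0))) = \<Psi>0 i j0 + (\<Sum>k=1..A i t. to i j0 k)"
    "P t i j1 + s i j1 (integral {0..t} (\<lambda>u. real (P u i j1))) = \<Psi>0 i j1 + (\<Sum>k=1..A i t. to i j1 k)"
    by (rule routing[OF t])+
  moreover note to_sums[OF adm', of "A i t"] class_eq[OF t, of i, unfolded sum_stations]
    initial_class[of i, unfolded sum_stations]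
  ultimately show ?thesis unfolding Y0_def sum_stations by linarith
qed

lemma A_mono: "0 \<le> u \<Longrightarrow> u \<le> t \<Longrightarrow> A i u \<le> A i t"
  using A_iff[of t "A i u" i] A_iff[of u "A i u" i] by linarith

lemma bulk_mono: "m \<le> m' \<Longrightarrow> bulk i m \<le> bulk i m'"
  unfolding bulk_def by (intro sum_mono2) auto

lemma left_values:
  assumes "1 \<le> k" "e < \<tau> i k"
  obtains u where "0 \<le> u" "e < u" "u < \<tau> i k" "\<And>a. Y u a = Yl i k a" "\<And>b. Z u b = Zl i k b"
proof -
  have pos: "0 < \<tau> i k" using strict_monoD[OF \<tau>_mono, of 0 k i] assms(1) \<tau>_0 by simp
  have "\<forall>\<^sub>F u in at_left (\<tau> i k). (\<forall>a\<in>UNIV. Y u a = Yl i k a) \<and> (\<forall>b\<in>UNIV. Z u b = Zl i k b)"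
    unfolding Yl_def Zl_def
    by (intro eventually_conj eventually_ball_finite) (auto intro!: cadlag_nat_left cadlag_Y cadlag_Z pos)
  moreover have "\<forall>\<^sub>F u in at_left (\<tau> i k). u \<in> {max 0 e<..<\<tau> i k}"
    using pos assms(2) by (intro eventually_at_left_real) simp
  ultimately have "\<forall>\<^sub>F u in at_left (\<tau> i k). ((\<forall>a\<in>UNIV. Y u a = Yl i k a) \<and> (\<forall>b\<in>UNIV. Z u b = Zl i k b)) \<and>
      u \<in> {max 0 e<..<\<tau> i k}" by (rule eventually_conj)
  from eventually_happens[OF this] obtain u where
    "(\<forall>a\<in>UNIV. Y u a = Yl i k a) \<and> (\<forall>b\<in>UNIV. Z u b = Zl i k b)" "u \<in> {max 0 e<..<\<tau> i k}"
    by (auto simp: trivial_limit_at_left_real)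
  then show thesis using that[of u] by simp
qed

end

text \<open>Here \<open>q i j\<close> is the target of an activity, \<open>inflow i j\<close> its cumulative input, and \<open>x\<close> bounds the
  fluctuations of the path. The assumptions \<open>room\<close> and \<open>late_room\<close> say that the targets leave enough idle
  servers for the tracking error and for admission, the latter also for the initial queues, which are
  then taken into service.\<close>

locale tracked_path = routed_path +
  fixes T T' x mu_bound :: real and \<Lambda> :: "'b \<Rightarrow> real" and \<mu> :: "'b \<Rightarrow> 'a \<Rightarrow> real"
    and q inflow :: "'b \<Rightarrow> 'a \<Rightarrow> real \<Rightarrow> real"
  assumes T: "0 < T" and eps: "0 \<le> \<epsilon>" and x0: "0 \<le> x"
    and \<Lambda>: "\<And>i. 0 < \<Lambda> i" and T': "\<And>i. T + x / \<Lambda> i \<le> T'"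
    and \<mu>: "\<And>i j. 0 < \<mu> i j" "\<And>i j. \<mu> i j \<le> mu_bound"
    and A_err: "\<And>i t. 0 \<le> t \<Longrightarrow> t \<le> T \<Longrightarrow> \<bar>real (A i t) - \<Lambda> i * t\<bar> \<le> x"
    and s_err: "\<And>i j u. 0 \<le> u \<Longrightarrow> u \<le> real (N j) * T \<Longrightarrow> \<bar>real (s i j u) - \<mu> i j * u\<bar> \<le> x"
    and G_infl: "\<And>i k. G i k = inflow i j0 (real k / \<Lambda> i)" and inflow_0: "\<And>i. inflow i j0 0 = 0"
    and slope: "\<And>i u v. 0 \<le> u \<Longrightarrow> u \<le> v \<Longrightarrow> v \<le> T' \<Longrightarrow>
      0 \<le> inflow i j0 v - inflow i j0 u \<and> inflow i j0 v - inflow i j0 u \<le> \<Lambda> i * (v - u)"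
    and inflow_sum: "\<And>i t. inflow i j0 t + inflow i j1 t = \<Lambda> i * t"
    and q_cont: "\<And>i j. continuous_on {0..T} (q i j)"
    and q_eq: "\<And>i j t. 0 \<le> t \<Longrightarrow> t \<le> T \<Longrightarrow> q i j t = q i j 0 + inflow i j t - \<mu> i j * integral {0..t} (q i j)"
    and q_0: "\<And>i j. \<bar>real (\<Psi>0 i j) - q i j 0\<bar> \<le> 1"
    and room: "\<And>j t. 0 \<le> t \<Longrightarrow> t \<le> T \<Longrightarrow>
      (\<Sum>i\<in>UNIV. q i j t) + real CARD('b) * (2 * (2 + 3 * x) * exp (2 * mu_bound * T) + 1) \<le> real (N j)"
    and late_room: "\<And>j t. \<epsilon> < t \<Longrightarrow> t \<le> T \<Longrightarrow>
      (\<Sum>i\<in>UNIV. q i j t) + real CARD('b) * (2 * (2 + 3 * x) * exp (2 * mu_bound * T) + 1) +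
        (2 * exp (2 * mu_bound * T) + 1) * (\<Sum>i\<in>UNIV. real (Y0 i)) \<le> real (N j)"
begin

lemma crosses_integer_count:
  assumes t: "0 \<le> t" "t \<le> T"
  shows "\<bar>real (\<Sum>k=1..A i t. of_bool (crosses_integer (G i) k)) - inflow i j0 t\<bar> \<le> 1 + x"
proof -
  have AT: "real (A i t) / \<Lambda> i \<le> T'"
  proof -
    have "real (A i t) \<le> \<Lambda> i * t + x" using A_err[OF t, of i] by linarith
    also have "\<dots> \<le> \<Lambda> i * T + x" using t \<Lambda>[of i] by simp
    also have "\<dots> = (T + x / \<Lambda> i) * \<Lambda> i" using \<Lambda>[of i] by (simp add: field_simps)
    also have "\<dots> \<le> T' * \<Lambda> i" using T'[of i] \<Lambda>[of i] by (intro mult_right_mono) auto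
    finally show ?thesis using \<Lambda>[of i] by (simp add: pos_divide_le_eq)
  qed
  have inc: "0 \<le> G i (Suc k) - G i k \<and> G i (Suc k) - G i k \<le> 1" if "k < A i t" for k
  proof -
    have "real (Suc k) / \<Lambda> i \<le> real (A i t) / \<Lambda> i" using that \<Lambda>[of i] by (intro divide_right_mono) auto
    then have "real (Suc k) / \<Lambda> i \<le> T'" using AT by linarith
    moreover have "real k / \<Lambda> i \<le> real (Suc k) / \<Lambda> i" "0 \<le> real k / \<Lambda> i"
      using \<Lambda>[of i] by (auto intro!: divide_right_mono)
    moreover have "\<Lambda> i * (real (Suc k) / \<Lambda> i - real k / \<Lambda> i) = 1"
      using \<Lambda>[of i] by (simp add: field_simps)
    ultimately show ?thesis unfolding G_infl using slope[of "real k / \<Lambda> i" "real (Suc k) / \<Lambda> i" i] by simp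
  qed
  have "int (\<Sum>k=1..A i t. of_bool (crosses_integer (G i) k)) = \<lfloor>G i (A i t)\<rfloor>"
    by (rule sum_crosses_integer) (use inc in \<open>auto simp: G_infl inflow_0\<close>)
  then have fl: "real (\<Sum>k=1..A i t. of_bool (crosses_integer (G i) k)) = of_int \<lfloor>G i (A i t)\<rfloor>"
    by (metis of_int_of_nat_eq)
  have f1: "\<bar>of_int \<lfloor>G i (A i t)\<rfloor> - G i (A i t)\<bar> \<le> 1"
    using floor_correct[of "G i (A i t)"] by linarith
  have tT: "t \<le> T'" using t T'[of i] x0 \<Lambda>[of i] by (smt (verit) divide_nonneg_pos)
  have eq: "\<Lambda> i * (real (A i t) / \<Lambda> i - t) = real (A i t) - \<Lambda> i * t"
    using \<Lambda>[of i] by (simp add: field_simps)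
  have A0: "0 \<le> real (A i t) / \<Lambda> i" using \<Lambda>[of i] by simp
  have "\<bar>G i (A i t) - inflow i j0 t\<bar> \<le> x"
  proof (cases "t \<le> real (A i t) / \<Lambda> i")
    case True
    from slope[OF t(1) True AT, of i] show ?thesis
      unfolding G_infl using eq A_err[OF t, of i] by linarith
  next
    case False
    then have "real (A i t) / \<Lambda> i \<le> t" by simp
    from slope[OF A0 this tT, of i] have "0 \<le> inflow i j0 t - G i (A i t)"
      "inflow i j0 t - G i (A i t) \<le> - (\<Lambda> i * (real (A i t) / \<Lambda> i - t))"
      unfolding G_infl by (auto simp: algebra_simps)
    then show ?thesis using eq A_err[OF t, of i] by linarith
  qed
  then show ?thesis using f1 fl by linarith
qed

lemma tracking:
  assumes t: "0 \<le> t" "t \<le> T" and adm: "\<And>i k. 1 \<le> k \<Longrightarrow> \<tau> i k \<le> t \<Longrightarrow> admitted i k"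
  shows "\<bar>real (P t i j) - q i j t\<bar> \<le> 2 * (2 + 3 * x + (if \<epsilon> < t then real (Y0 i) else 0)) * exp (2 * mu_bound * T)"
proof -
  define y where "y = 1 + 2 * x + (if \<epsilon> < t then real (Y0 i) else 0)"
  have y0: "0 \<le> y" using x0 by (simp add: y_def)
  have inflow_error: "\<bar>real (\<Sum>k=1..A i u. to i j k) - inflow i j u\<bar> \<le> y" if u: "0 \<le> u" "u \<le> t" for u
  proof -
    have uT: "u \<le> T" using u t by simp
    have ad: "admitted i k" if "1 \<le> k" "k \<le> A i u" for k
      using adm[of k i] A_iff[OF u(1), of k i] that u by simp
    note ts = to_sums[OF ad, of "A i u"] and dc = crosses_integer_count[OF u(1) uT, of i]
    have bl: "real (bulk i (A i u)) \<le> (if \<epsilon> < t then real (Y0 i) else 0)"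
    proof (cases "\<epsilon> < t")
      case True
      have "Y u i + bulk i (A i u) = Y0 i" using queue_eq[OF u(1)] adm u by (meson order.trans)
      then show ?thesis using True by simp
    next
      case False
      have "\<not> \<epsilon> < \<tau> i k" if "k \<in> {1..A i u}" for k
        using A_iff[OF u(1), of k i] that u False by simp
      then have "bulk i (A i u) = 0" unfolding bulk_def by (intro sum.neutral) simp
      then show ?thesis by simp
    qed
    consider "j = j0" | "j = j1" using station_cases by blast
    then show ?thesis
    proof cases
      case 1
      have "\<bar>real (\<Sum>k=1..A i u. to i j k) - inflow i j u\<bar> \<le> 1 + x" 
        using dc by (simp only: 1 ts(1))
      also have "\<dots> \<le> y" using x0 by (simp add: y_def)
      finally show ?thesis .
    next
      case 2
      have "real (\<Sum>k=1..A i u. to i j1 k) + real (\<Sum>k=1..A i u. of_bool (crosses_integer (G i) k)) =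
          real (A i u) + real (bulk i (A i u))"
        using ts(2) by (metis of_nat_add)
      then show ?thesis unfolding 2 using dc A_err[OF u(1) uT, of i] inflow_sum[of i u] bl
        unfolding y_def by linarith
    qed
  qed
  have "\<bar>real (P t i j) - q i j t\<bar> \<le> 2 * (1 + y + x) * exp (2 * \<mu> i j * t)"
  proof (rule activity_tracking[where n="N j" and s="s i j" and ?p0.0="real (\<Psi>0 i j)" and b="inflow i j"
        and B="\<lambda>u. real (\<Sum>k=1..A i u. to i j k)"])
    show "continuous (at_right u) (\<lambda>t. P t i j)" if "0 \<le> u" for u
      using cadlag_P[of i j] that by (simp add: cadlag_def)
    show "P u i j \<le> N j" if "0 \<le> u" for u
    proof -
      have "P u i j \<le> (\<Sum>i\<in>UNIV. P u i j)" by (rule member_le_sum) auto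
      then show ?thesis using station_eq[OF that, of j] by linarith
    qed
    show "\<bar>real (s i j u) - \<mu> i j * u\<bar> \<le> x" if "0 \<le> u" "u \<le> real (N j) * t" for u
    proof -
      have "real (N j) * t \<le> real (N j) * T" using t by (intro mult_left_mono) auto
      then show ?thesis using s_err[of u j i] that by simp
    qed
    show "real (P u i j) + real (s i j (integral {0..u} (\<lambda>u. real (P u i j)))) =
        real (\<Psi>0 i j) + real (\<Sum>k=1..A i u. to i j k)" if "0 \<le> u" for u
      using routing[OF that, of i j] by (metis of_nat_add)
    show "continuous_on {0..t} (q i j)" by (rule continuous_on_subset[OF q_cont]) (use t in auto)
    show "q i j u = q i j 0 + inflow i j u - \<mu> i j * integral {0..u} (q i j)" if "0 \<le> u" "u \<le> t" for u
      by (rule q_eq) (use that t in auto)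
    show "\<bar>real (\<Sum>k=1..A i u. to i j k) - inflow i j u\<bar> \<le> y" if "0 \<le> u" "u \<le> t" for u
      using that by (rule inflow_error)
  qed (rule \<mu> t q_0)+
  also have "\<dots> \<le> 2 * (1 + y + x) * exp (2 * mu_bound * T)"
  proof (intro mult_left_mono)
    have "\<mu> i j * t \<le> mu_bound * T" using \<mu>[of i j] t by (intro mult_mono) auto
    then show "exp (2 * \<mu> i j * t) \<le> exp (2 * mu_bound * T)" by simp
  qed (use y0 x0 in auto)
  finally show ?thesis unfolding y_def by (simp add: algebra_simps)
qed

lemma station_room:
  assumes t: "0 \<le> t" "t \<le> T" and adm: "\<And>i k. 1 \<le> k \<Longrightarrow> \<tau> i k \<le> t \<Longrightarrow> admitted i k"
  shows "CARD('b) + (if \<epsilon> < t then \<Sum>i\<in>UNIV. Y0 i else 0) \<le> Z t j"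
proof -
  let ?e = "exp (2 * mu_bound * T)"
  let ?y = "\<lambda>i. if \<epsilon> < t then real (Y0 i) else 0"
  have "(\<Sum>i\<in>UNIV. real (P t i j)) \<le> (\<Sum>i\<in>UNIV. q i j t + 2 * (2 + 3 * x + ?y i) * ?e)"
  proof (rule sum_mono)
    fix i
    show "real (P t i j) \<le> q i j t + 2 * (2 + 3 * x + ?y i) * ?e"
      using tracking[OF t adm, of i j] by linarith
  qed
  also have "\<dots> = (\<Sum>i\<in>UNIV. q i j t) + real CARD('b) * (2 * (2 + 3 * x) * ?e) + 2 * ?e * (\<Sum>i\<in>UNIV. ?y i)"
    by (simp add: sum.distrib sum_distrib_left algebra_simps)
  finally have Ps: "real (\<Sum>i\<in>UNIV. P t i j) \<le> \<dots>" by simp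
  have ys: "(\<Sum>i\<in>UNIV. ?y i) = (if \<epsilon> < t then \<Sum>i\<in>UNIV. real (Y0 i) else 0)" by simp
  have Zr: "real (Z t j) = real (N j) - real (\<Sum>i\<in>UNIV. P t i j)"
    using station_eq[OF t(1), of j] by (metis add_diff_cancel_right' of_nat_add)
  have "real CARD('b) + (if \<epsilon> < t then \<Sum>i\<in>UNIV. real (Y0 i) else 0) \<le> real (Z t j)"
  proof (cases "\<epsilon> < t")
    case True
    then show ?thesis using Ps Zr late_room[OF True t(2), of j] unfolding ys by (simp add: algebra_simps)
  next
    case False
    then show ?thesis using Ps Zr room[OF t, of j] unfolding ys by (simp add: algebra_simps)
  qed
  then have "real (CARD('b) + (if \<epsilon> < t then \<Sum>i\<in>UNIV. Y0 i else 0)) \<le> real (Z t j)"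
    by (cases "\<epsilon> < t") simp_all
  then show ?thesis by (rule of_nat_le_iff[THEN iffD1])
qed

text \<open>The first arrival that is not admitted would see a state in which it is admitted. Immediately before
  it all arrivals have been admitted, hence \<open>station_room\<close> applies, and the left limits are attained
  because the processes are integer valued.\<close>

lemma all_admitted:
  assumes "1 \<le> k" "\<tau> i k \<le> T"
  shows "admitted i k"
proof (rule ccontr)
  assume na: "\<not> admitted i k"
  define V where "V = {\<tau> a m | a m. 1 \<le> m \<and> \<tau> a m \<le> T \<and> \<not> admitted a m}"
  have "V \<subseteq> (\<Union>a\<in>UNIV. \<tau> a ` {1..A a T})" 
  proof
    fix v assume "v \<in> V"
    then obtain a m where am: "v = \<tau> a m" "1 \<le> m" "\<tau> a m \<le> T" unfolding V_def by blast
    then have "m \<in> {1..A a T}" using A_iff[of T m a] T by simp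
    then show "v \<in> (\<Union>a\<in>UNIV. \<tau> a ` {1..A a T})" using am(1) by blast
  qed
  then have fin: "finite V" by (rule finite_subset) auto
  have "V \<noteq> {}" unfolding V_def using na assms by blast
  then have "Min V \<in> V" using fin by (rule Min_in[rotated])
  then obtain a m where am: "Min V = \<tau> a m" "1 \<le> m" "\<tau> a m \<le> T" "\<not> admitted a m"
    unfolding V_def by blast
  \<comment> \<open>An earlier time with the same state has to lie after \<open>\<epsilon>\<close> if the arrival does; \<open>-1\<close> imposes nothing.\<close>
  define e where "e = (if \<epsilon> < \<tau> a m then \<epsilon> else -1)"
  have pos: "0 < \<tau> a m" using strict_monoD[OF \<tau>_mono, of 0 m a] am(2) \<tau>_0 by simp
  then have "e < \<tau> a m" by (simp add: e_def)
  then obtain u where u: "0 \<le> u" "e < u" "u < \<tau> a m" "\<And>a'. Y u a' = Yl a m a'" "\<And>b. Z u b = Zl a m b"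
    using left_values[OF am(2)] by metis
  have uT: "u \<le> T" using u(3) am(3) by simp
  have adm: "admitted c l" if "1 \<le> l" "\<tau> c l \<le> u" for c l
  proof (rule ccontr)
    assume "\<not> admitted c l"
    then have "\<tau> c l \<in> V" unfolding V_def using that uT by fastforce
    then have "Min V \<le> \<tau> c l" by (rule Min_le[OF fin])
    then show False using am(1) that(2) u(3) by simp
  qed
  have "Y u c \<le> Y0 c" for c using queue_eq[OF u(1), of c] adm by simp
  then have "(\<Sum>c\<in>UNIV. Yl a m c) \<le> (\<Sum>c\<in>UNIV. Y0 c)" unfolding u(4)[symmetric] by (intro sum_mono)
  moreover have "\<epsilon> < u" if "\<epsilon> < \<tau> a m" using u(2) that by (simp add: e_def)
  ultimately have "CARD('b) + (if \<epsilon> < \<tau> a m then \<Sum>c\<in>UNIV. Yl a m c else 0) \<le> Zl a m b" for b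
    using station_room[OF u(1) uT adm, of b] unfolding u(5)[of b] by (auto split: if_splits)
  then have "admitted a m" by (simp add: admitted_def)
  then show False using am(4) by simp
qed

text \<open>By \<open>many\<close> there is an arrival of class \<open>i\<close> in \<open>(\<epsilon>, \<epsilon>']\<close>. It finds the whole remaining queue and takes
  it into service.\<close>

theorem queue_empties:
  assumes e: "\<epsilon> < \<epsilon>'" "\<epsilon>' \<le> t" "t \<le> T" and many: "2 * x < \<Lambda> i * (\<epsilon>' - \<epsilon>)"
  shows "Y t i = 0"
proof -
  have pos: "0 \<le> \<epsilon>'" "0 \<le> t" "\<epsilon>' \<le> T" using e eps by auto
  \<comment> \<open>the last arrival of class \<open>i\<close> up to time \<open>\<epsilon>'\<close>, which comes after \<open>\<epsilon>\<close>\<close>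
  let ?k = "A i \<epsilon>'"
  have "real (A i \<epsilon>) < real ?k"
    using A_err[of \<epsilon> i] A_err[of \<epsilon>' i] many e eps by (simp add: algebra_simps)
  then have k: "A i \<epsilon> < ?k" by simp
  have k1: "1 \<le> ?k" using k by simp
  have \<tau>k: "\<tau> i ?k \<le> \<epsilon>'" using A_iff[OF pos(1), of ?k i] by simp
  have \<epsilon>k: "\<epsilon> < \<tau> i ?k" using A_iff[OF eps, of ?k i] k by simp
  have "\<tau> i (?k - 1) < \<tau> i ?k" using k1 by (intro strict_monoD[OF \<tau>_mono]) simp
  then obtain u where u: "0 \<le> u" "\<tau> i (?k - 1) < u" "u < \<tau> i ?k" "\<And>a. Y u a = Yl i ?k a"
    using left_values[OF k1, of "\<tau> i (?k - 1)" i] by metis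
  have Au: "A i u = ?k - 1"
    using A_iff[OF u(1), of "?k - 1" i] A_iff[OF u(1), of ?k i] u(2,3) by linarith
  have adm: "admitted i l" if "1 \<le> l" "\<tau> i l \<le> t'" "t' \<le> T" for l t'
    using all_admitted[OF that(1)] that(2,3) by simp
  have "Yl i ?k i + bulk i (?k - 1) = Y0 i"
    using queue_eq[OF u(1), of i] adm[of _ u] u(3,4) \<tau>k pos unfolding Au by simp
  moreover have "bulk i ?k = bulk i (?k - 1) + Yl i ?k i"
    using k1 \<epsilon>k unfolding bulk_def by (cases ?k) simp_all
  moreover have "bulk i ?k \<le> bulk i (A i t)" by (intro bulk_mono A_mono pos e)
  moreover have "Y t i + bulk i (A i t) = Y0 i" using queue_eq[OF pos(2), of i] adm[of _ t] e by simp
  ultimately show ?thesis by linarith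
qed

end

section \<open>Events of probability tending to one\<close>

context prob_space
begin

text \<open>With high probability: the property holds on measurable events whose probabilities tend to one, while
  the set where it holds may fail to be measurable.\<close>

definition whp :: "(nat \<Rightarrow> 'a \<Rightarrow> bool) \<Rightarrow> bool" where
  "whp Q \<longleftrightarrow> (\<exists>G. (\<forall>n. G n \<in> events) \<and> (\<lambda>n. prob (G n)) \<longlonglongrightarrow> 1 \<and>
     (\<forall>\<^sub>F n in sequentially. \<forall>\<omega>\<in>G n. Q n \<omega>))"

lemma whp_mono:
  assumes "whp Q" "\<forall>\<^sub>F n in sequentially. \<forall>\<omega>\<in>space M. Q n \<omega> \<longrightarrow> Q' n \<omega>"
  shows "whp Q'"
proof -
  obtain G where G: "\<forall>n. G n \<in> events" "(\<lambda>n. prob (G n)) \<longlonglongrightarrow> 1"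
    "\<forall>\<^sub>F n in sequentially. \<forall>\<omega>\<in>G n. Q n \<omega>" using assms(1) unfolding whp_def by blast
  have "\<forall>\<^sub>F n in sequentially. \<forall>\<omega>\<in>G n. Q' n \<omega>"
    using G(3) assms(2) by eventually_elim (use G(1) sets.sets_into_space in blast)
  then show ?thesis using G unfolding whp_def by blast
qed

lemma whp_conj:
  assumes "whp Q" "whp Q'"
  shows "whp (\<lambda>n \<omega>. Q n \<omega> \<and> Q' n \<omega>)"
proof -
  obtain G where G: "\<forall>n. G n \<in> events" "(\<lambda>n. prob (G n)) \<longlonglongrightarrow> 1"
    "\<forall>\<^sub>F n in sequentially. \<forall>\<omega>\<in>G n. Q n \<omega>" using assms(1) unfolding whp_def by blast
  obtain G' where G': "\<forall>n. G' n \<in> events" "(\<lambda>n. prob (G' n)) \<longlonglongrightarrow> 1"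
    "\<forall>\<^sub>F n in sequentially. \<forall>\<omega>\<in>G' n. Q' n \<omega>" using assms(2) unfolding whp_def by blast
  have "(\<lambda>n. prob (G n \<inter> G' n)) \<longlonglongrightarrow> 1"
  proof (rule tendsto_sandwich[where f="\<lambda>n. prob (G n) + prob (G' n) - 1" and h="\<lambda>_. 1"])
    have "prob (G n) + prob (G' n) - 1 \<le> prob (G n \<inter> G' n)" for n
    proof -
      have "prob (G n \<union> G' n) = prob (G n) + prob (G' n - G n)"
        using G(1) G'(1) by (intro finite_measure_Union') auto
      also have "prob (G' n - G n) = prob (G' n) - prob (G n \<inter> G' n)"
        using G(1) G'(1) by (subst finite_measure_Diff') (auto simp: Int_commute)
      finally show ?thesis using prob_le_1[of "G n \<union> G' n"] by linarith
    qed
    then show "\<forall>\<^sub>F n in sequentially. prob (G n) + prob (G' n) - 1 \<le> prob (G n \<inter> G' n)" by simp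
    show "(\<lambda>n. prob (G n) + prob (G' n) - 1) \<longlonglongrightarrow> 1"
      using tendsto_diff[OF tendsto_add[OF G(2) G'(2)] tendsto_const[of 1]] by simp
  qed auto
  moreover have "\<forall>\<^sub>F n in sequentially. \<forall>\<omega>\<in>G n \<inter> G' n. Q n \<omega> \<and> Q' n \<omega>"
    using G(3) G'(3) by eventually_elim blast
  ultimately show ?thesis using G(1) G'(1) unfolding whp_def by (intro exI[of _ "\<lambda>n. G n \<inter> G' n"]) auto
qed

lemma whp_AE:
  assumes "\<And>n. 1 \<le> n \<Longrightarrow> AE \<omega> in M. Q n \<omega>"
  shows "whp Q"
proof -
  have "\<exists>G. G \<in> events \<and> prob G = 1 \<and> (1 \<le> n \<longrightarrow> (\<forall>\<omega>\<in>G. Q n \<omega>))" for n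
  proof (cases "1 \<le> n")
    case True
    from AE_E[OF assms[OF True]] obtain N where N: "{\<omega>\<in>space M. \<not> Q n \<omega>} \<subseteq> N" "emeasure M N = 0" "N \<in> events"
      by blast
    then have "prob (space M - N) = 1" using prob_compl[OF N(3)] by (simp add: measure_def)
    then show ?thesis using N by (intro exI[of _ "space M - N"]) auto
  next
    case False
    then show ?thesis by (intro exI[of _ "space M"]) (simp add: prob_space)
  qed
  then obtain G where G: "\<And>n. G n \<in> events \<and> prob (G n) = 1 \<and> (1 \<le> n \<longrightarrow> (\<forall>\<omega>\<in>G n. Q n \<omega>))" by metis
  have "\<forall>\<^sub>F n in sequentially. \<forall>\<omega>\<in>G n. Q n \<omega>"
    using eventually_ge_at_top[of 1] by eventually_elim (use G in blast)
  then show ?thesis unfolding whp_def using G by (intro exI[of _ G]) simp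
qed

lemma whp_all:
  assumes "\<And>a::'x::finite. whp (Q a)"
  shows "whp (\<lambda>n \<omega>. \<forall>a. Q a n \<omega>)"
proof -
  have "whp (\<lambda>n \<omega>. \<forall>a\<in>A. Q a n \<omega>)" if "finite A" for A
    using that
  proof induction
    case empty
    show ?case by (rule whp_AE) simp
  next
    case (insert a A)
    show ?case by (rule whp_mono[OF whp_conj[OF assms[of a] insert.IH]]) simp
  qed
  from this[of UNIV] show ?thesis by simp
qed

lemma whpI:
  assumes G: "\<forall>\<^sub>F n in sequentially. \<exists>G\<in>events. 1 - b n \<le> prob G \<and> (\<forall>\<omega>\<in>G. Q n \<omega>)"
    and b: "b \<longlonglongrightarrow> 0"
  shows "whp Q"
proof -
  let ?E = "\<lambda>n G. G \<in> events \<and> 1 - b n \<le> prob G \<and> (\<forall>\<omega>\<in>G. Q n \<omega>)"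
  define G where "G n = (if \<exists>G. ?E n G then SOME G. ?E n G else space M)" for n
  have ev: "\<forall>\<^sub>F n in sequentially. ?E n (G n)"
    using assms(1)
  proof eventually_elim
    case (elim n)
    then have ex: "\<exists>G. ?E n G" by blast
    show ?case unfolding G_def if_P[OF ex] by (rule someI_ex[OF ex])
  qed
  have "G n \<in> events" for n
  proof (cases "\<exists>G. ?E n G")
    case True
    show ?thesis unfolding G_def if_P[OF True] using someI_ex[OF True] by blast
  next
    case False
    show ?thesis unfolding G_def if_not_P[OF False] by simp
  qed
  moreover have "(\<lambda>n. prob (G n)) \<longlonglongrightarrow> 1"
  proof (rule tendsto_sandwich[where f="\<lambda>n. 1 - b n" and h="\<lambda>_. 1"])
    show "\<forall>\<^sub>F n in sequentially. 1 - b n \<le> prob (G n)" using ev by eventually_elim blast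
    show "(\<lambda>n. 1 - b n) \<longlonglongrightarrow> 1" using tendsto_diff[OF tendsto_const[of 1] b] by simp
  qed auto
  moreover have "\<forall>\<^sub>F n in sequentially. \<forall>\<omega>\<in>G n. Q n \<omega>" using ev by eventually_elim blast
  ultimately show ?thesis unfolding whp_def by blast
qed

end

text \<open>The counting process is the inverse of the random walk, so a uniform bound for the walk carries over.
  The condition on \<open>K\<close> says that the walk has passed \<open>l * T\<close> before step \<open>K\<close>; in particular the supremum in
  \<open>arrivals\<close> is over a finite set.\<close>

lemma arrivals_error:
  fixes u :: "nat \<Rightarrow> 'w \<Rightarrow> real"
  assumes u: "\<And>k. 1 \<le> k \<Longrightarrow> 0 < u k \<omega>" and l: "0 < l" and t: "0 \<le> t" "t \<le> T"
    and W: "\<And>m. m \<le> K \<Longrightarrow> \<bar>(\<Sum>k=1..m. u k \<omega>) - real m\<bar> \<le> w" and K: "l * T + w < real K"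
  shows "\<bar>real (arrivals l u t \<omega>) - l * t\<bar> \<le> w + 1"
proof -
  let ?A = "arrivals l u t \<omega>"
  have div: "(\<Sum>k=1..m. u k \<omega> / l) \<le> t \<longleftrightarrow> (\<Sum>k=1..m. u k \<omega>) \<le> l * t" for m
    using l by (simp add: sum_divide_distrib[symmetric] pos_divide_le_eq mult.commute)
  have lt: "l * t \<le> l * T" using l t by simp
  have WK: "l * t < (\<Sum>k=1..K. u k \<omega>)" using W[of K] K lt by linarith
  then have "t < (\<Sum>k=1..K. u k \<omega> / l)" using div[of K] by linarith
  note iff = arrivals_iff[where u=u and \<omega>=\<omega>, OF u l t(1) this, unfolded div]
  have AK: "?A < K" using iff[of K] WK by linarith
  have "(\<Sum>k=1..?A. u k \<omega>) \<le> l * t" "l * t < (\<Sum>k=1..Suc ?A. u k \<omega>)"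
    using iff[of ?A] iff[of "Suc ?A"] by linarith+
  then show ?thesis using W[of ?A] W[of "Suc ?A"] AK by linarith
qed

context queueing_model
begin

lemma U_measurable: "1 \<le> k \<Longrightarrow> U i k \<in> borel_measurable M"
  using U_integrable[of k i] by (rule borel_measurable_integrable)

definition U2 :: "'i \<Rightarrow> real" where "U2 i = expectation (\<lambda>\<omega>. (U i 1 \<omega>)\<^sup>2)"

lemma U_second_moment: "1 \<le> k \<Longrightarrow> expectation (\<lambda>\<omega>. (U i k \<omega>)\<^sup>2) = U2 i"
  unfolding U2_def
  using integral_distr[OF U_measurable[of k i], of "\<lambda>z. z\<^sup>2"] integral_distr[OF U_measurable[of 1 i], of "\<lambda>z. z\<^sup>2"]
    U_ident[of k i] by simp

lemma walk_tail:
  assumes y: "0 < y"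
  shows "prob {\<omega>\<in>space M. y \<le> \<bar>(\<Sum>k=1..m. U i k \<omega>) - real m\<bar>} \<le> real m * U2 i / y\<^sup>2"
proof -
  let ?K = "Pair i ` {1..m}"
  have s: "(\<Sum>p\<in>?K. (case p of (i, k) \<Rightarrow> U i k) \<omega>) = (\<Sum>k=1..m. U i k \<omega>)" for \<omega>
    by (subst sum.reindex) (auto simp: inj_on_def)
  have c: "card ?K = m" by (subst card_image) (auto simp: inj_on_def)
  have "prob {\<omega>\<in>space M. y \<le> \<bar>(\<Sum>p\<in>?K. (case p of (i, k) \<Rightarrow> U i k) \<omega>) - real (card ?K)\<bar>} \<le>
      real (card ?K) * U2 i / y\<^sup>2"
  proof (rule indep_sum_tail)
    show "indep_vars (\<lambda>_. borel) (\<lambda>(i, k). U i k) ?K"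
      by (rule indep_vars_subset[OF U_indep]) auto
  qed (use y U_integrable U_finite_variance U_mean U_second_moment in auto)
  then show ?thesis unfolding s c .
qed

lemma walk_unbounded: "AE \<omega> in M. \<forall>L. \<exists>m. L < (\<Sum>k=1..m. U i k \<omega>)"
proof -
  have nat: "AE \<omega> in M. \<forall>L::nat. \<exists>m\<ge>0. \<not> (\<Sum>k=1..m. U i k \<omega>) \<le> real L"
  proof (rule AE_all_countable[THEN iffD2], rule)
    fix L :: nat
    show "AE \<omega> in M. \<exists>m\<ge>0. \<not> (\<Sum>k=1..m. U i k \<omega>) \<le> real L"
    proof (rule AE_not_all)
      have m: "(\<lambda>\<omega>. \<Sum>k=1..m. U i k \<omega>) \<in> borel_measurable M" for m
        by (intro borel_measurable_sum U_measurable) auto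
      then show "Measurable.pred M (\<lambda>\<omega>. (\<Sum>k=1..m. U i k \<omega>) \<le> real L)" for m by measurable
      show "\<forall>\<^sub>F m in sequentially. prob {\<omega>\<in>space M. (\<Sum>k=1..m. U i k \<omega>) \<le> real L} \<le>
          real m * U2 i / (real m - real L)\<^sup>2"
        using eventually_gt_at_top[of L]
      proof eventually_elim
        case (elim n)
        have "prob {\<omega>\<in>space M. (\<Sum>k=1..n. U i k \<omega>) \<le> real L} \<le>
            prob {\<omega>\<in>space M. real n - real L \<le> \<bar>(\<Sum>k=1..n. U i k \<omega>) - real n\<bar>}"
        proof (rule finite_measure_mono)
          show "{\<omega>\<in>space M. real n - real L \<le> \<bar>(\<Sum>k=1..n. U i k \<omega>) - real n\<bar>} \<in> events"
            using m[of n] by measurable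
        qed auto
        also have "\<dots> \<le> real n * U2 i / (real n - real L)\<^sup>2" using elim by (intro walk_tail) auto
        finally show ?case .
      qed
      have "(\<lambda>m. real m / (real m - real L)\<^sup>2) \<longlonglongrightarrow> 0" by real_asymp
      from tendsto_mult_right[OF this, of "U2 i"]
      show "(\<lambda>m. real m * U2 i / (real m - real L)\<^sup>2) \<longlonglongrightarrow> 0" by (simp add: mult_ac)
    qed
  qed
  then show ?thesis
  proof eventually_elim
    case (elim \<omega>)
    show ?case
    proof
      fix L :: real
      obtain l :: nat where "L < real l" using reals_Archimedean2 by blast
      then show "\<exists>m. L < (\<Sum>k=1..m. U i k \<omega>)" using elim by (meson less_le_trans not_le less_imp_le)
    qed
  qed
qed

lemma walk_uniform:
  assumes y: "0 < y" and h: "0 < h"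
  obtains G where "G \<in> events" "1 - (real L + 1) * (real (L * h) * U2 i / y\<^sup>2) \<le> prob G"
    "\<And>\<omega> m. \<omega> \<in> G \<Longrightarrow> m \<le> L * h \<Longrightarrow> \<bar>(\<Sum>k=1..m. U i k \<omega>) - real m\<bar> \<le> y + real h"
proof -
  let ?g = "\<lambda>s \<omega>. \<Sum>k=1..nat \<lfloor>s\<rfloor>. U i k \<omega>"
  have fl: "nat \<lfloor>real l * real h\<rfloor> = l * h" for l
    by (metis floor_of_nat nat_int of_nat_mult)
  have U2: "0 \<le> U2 i" unfolding U2_def by (intro integral_nonneg_AE) auto
  obtain G where G: "G \<in> events" "1 - (real L + 1) * (real (L * h) * U2 i / y\<^sup>2) \<le> prob G"
    "\<And>\<omega> s. \<omega> \<in> G \<Longrightarrow> 0 \<le> s \<Longrightarrow> s \<le> real L * real h \<Longrightarrow> \<bar>?g s \<omega> - 1 * s\<bar> \<le> y + 1 * real h"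
  proof (rule grid_uniform[of ?g "real h" L y 1 "real (L * h) * U2 i / y\<^sup>2"])
    show "?g (real l * real h) \<in> borel_measurable M" for l
      by (intro borel_measurable_sum U_measurable) auto
    show "?g s \<omega> \<le> ?g t \<omega>" if "\<omega> \<in> space M" "0 \<le> s" "s \<le> t" for \<omega> s t
      using that U_pos by (intro sum_mono2) (auto intro!: less_imp_le nat_mono floor_mono)
    show "prob {\<omega>\<in>space M. y \<le> \<bar>?g (real l * real h) \<omega> - 1 * (real l * real h)\<bar>} \<le> real (L * h) * U2 i / y\<^sup>2"
      if "l \<le> L" for l
    proof -
      have "prob {\<omega>\<in>space M. y \<le> \<bar>(\<Sum>k=1..l * h. U i k \<omega>) - real (l * h)\<bar>} \<le> real (l * h) * U2 i / y\<^sup>2"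
        by (rule walk_tail[OF y])
      also have "\<dots> \<le> real (L * h) * U2 i / y\<^sup>2"
        using that U2 by (intro divide_right_mono mult_right_mono of_nat_mono mult_le_mono1) auto
      finally show ?thesis unfolding fl by simp
    qed
  qed (use h in auto)
  show thesis
  proof (rule that[OF G(1,2)])
    fix \<omega> m assume "\<omega> \<in> G" "m \<le> L * h"
    then have "real m \<le> real L * real h" by (metis of_nat_le_iff of_nat_mult)
    from G(3)[OF \<open>\<omega> \<in> G\<close> _ this] show "\<bar>(\<Sum>k=1..m. U i k \<omega>) - real m\<bar> \<le> y + real h" by simp
  qed
qed


lemma powr_quarters:
  assumes "1 \<le> n"
  shows "real n powr (1/4) * real n powr (3/4) = real n" "1 \<le> real n powr (3/4)"
    "sqrt (real n) \<le> real n powr (3/4)" "real n powr (3/4) \<le> real n"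
proof -
  have n: "1 \<le> real n" using assms by simp
  show "real n powr (1/4) * real n powr (3/4) = real n" using n by (simp add: powr_add[symmetric])
  show "1 \<le> real n powr (3/4)" using n by (simp add: ge_one_powr_ge_zero)
  have "real n powr (1/2) \<le> real n powr (3/4)" using n by (intro powr_mono) auto
  then show "sqrt (real n) \<le> real n powr (3/4)" using n by (simp add: powr_half_sqrt)
  have "real n powr (3/4) \<le> real n powr 1" using n by (intro powr_mono) auto
  then show "real n powr (3/4) \<le> real n" using n by simp
qed

lemma scaled_error_le:
  fixes f :: "nat \<Rightarrow> real"
  assumes "(\<lambda>n. sqrt (real n) * f n) \<longlonglongrightarrow> a"
  shows "\<forall>\<^sub>F n in sequentially. sqrt (real n) * \<bar>f n\<bar> \<le> \<bar>a\<bar> + 1"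
proof -
  have "(\<lambda>n. \<bar>sqrt (real n) * f n\<bar>) \<longlonglongrightarrow> \<bar>a\<bar>" using assms by (rule tendsto_rabs)
  then have "\<forall>\<^sub>F n in sequentially. \<bar>sqrt (real n) * f n\<bar> < \<bar>a\<bar> + 1" by (rule order_tendstoD) simp
  then show ?thesis by eventually_elim (simp add: abs_mult)
qed

lemma stations_le: "\<forall>\<^sub>F n in sequentially. real (N n j) \<le> (\<nu> j + 1) * real n"
proof -
  have "\<forall>\<^sub>F n in sequentially. real (N n j) / real n < \<nu> j + 1" using N_lim[of j] by (rule order_tendstoD) simp
  then show ?thesis using eventually_gt_at_top[of 0]
    by eventually_elim (simp add: pos_divide_less_eq)
qed

text \<open>The grid has mesh \<open>n powr (3/4)\<close> and \<open>O(n powr (1/4))\<close> points. At each of them the deviation exceeds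
  \<open>n powr (3/4)\<close> with probability \<open>O(n powr (- 1/2))\<close>. Replacing the rate by its limit costs \<open>O(sqrt n)\<close>.\<close>

lemma service_noise:
  assumes pos: "(i, j) \<in> E" and T: "0 < T"
  shows "\<exists>c. whp (\<lambda>n \<omega>. \<forall>u. 0 \<le> u \<and> u \<le> real (N n j) * T \<longrightarrow>
    \<bar>real (S n i j u \<omega>) - \<mu> i j * u\<bar> \<le> c * real n powr (3/4))"
proof (rule exI, rule whpI)
  define C where "C = (\<nu> j + 1) * T"
  have C: "0 < C" using nu_pos[of j] T by (simp add: C_def)
  have \<mu>: "0 < \<mu> i j" using mu_pos[OF pos] .
  let ?p = "\<lambda>n. real n powr (3/4)" and ?b = "\<lambda>n. (C * real n powr (1/4) + 2) * ((\<mu> i j + 1) *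
    ((C * real n powr (1/4) + 1) * real n powr (3/4)) / (real n powr (3/4))\<^sup>2)"
  show "?b \<longlonglongrightarrow> 0" using C \<mu> by real_asymp
  have "\<forall>\<^sub>F n in sequentially. mun n i j < \<mu> i j + 1" using mu_lim[of i j] by (rule order_tendstoD) simp
  then show "\<forall>\<^sub>F n in sequentially. \<exists>G\<in>events. 1 - ?b n \<le> prob G \<and>
      (\<forall>\<omega>\<in>G. \<forall>u. 0 \<le> u \<and> u \<le> real (N n j) * T \<longrightarrow>
        \<bar>real (S n i j u \<omega>) - \<mu> i j * u\<bar> \<le> (\<mu> i j + 2 + (\<bar>muhat i j\<bar> + 1) * C) * ?p n)"
    using scaled_error_le[OF muhat_lim[of i j]] stations_le[of j] eventually_ge_at_top[of 1]
  proof eventually_elim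
    case (elim n)
    define L where "L = nat \<lceil>C * real n powr (1/4)\<rceil>"
    have L: "C * real n powr (1/4) \<le> real L" "real L \<le> C * real n powr (1/4) + 1"
      unfolding L_def using C by (auto simp: of_nat_nat)
    note pq = powr_quarters[OF elim(4)]
    have r: "0 < mun n i j" using activities[OF elim(4)] pos by auto
    have p0: "0 < ?p n" using pq(2) by linarith
    obtain G where G: "G \<in> events" "1 - (real L + 1) * (mun n i j * (real L * ?p n) / (?p n)\<^sup>2) \<le> prob G"
      "\<And>\<omega> s. \<omega> \<in> G \<Longrightarrow> 0 \<le> s \<Longrightarrow> s \<le> real L * ?p n \<Longrightarrow> \<bar>real (S n i j s \<omega>) - mun n i j * s\<bar> \<le> ?p n + mun n i j * ?p n"
      using poisson_uniform[OF S_poisson[OF elim(4) r] less_imp_le[OF r] p0 p0] by metis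
    have "(real L + 1) * (mun n i j * (real L * ?p n) / (?p n)\<^sup>2) \<le> ?b n"
      using L C r p0 elim(1) \<mu> by (intro mult_mono divide_right_mono) auto
    then have 1: "1 - ?b n \<le> prob G" using G(2) by linarith
    have 2: "\<bar>real (S n i j u \<omega>) - \<mu> i j * u\<bar> \<le> (\<mu> i j + 2 + (\<bar>muhat i j\<bar> + 1) * C) * ?p n"
      if w: "\<omega> \<in> G" and u: "0 \<le> u" "u \<le> real (N n j) * T" for \<omega> u
    proof -
      have "real (N n j) * T \<le> ((\<nu> j + 1) * real n) * T" using elim(3) T by (intro mult_right_mono) auto
      also have "\<dots> = C * real n" by (simp add: C_def)
      finally have uC: "u \<le> C * real n" using u(2) by linarith
      also have Cn: "C * real n = (C * real n powr (1/4)) * ?p n" using pq(1) by (simp add: mult.assoc)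
      also have "\<dots> \<le> real L * ?p n" using L p0 by (intro mult_right_mono) auto
      finally have a: "\<bar>real (S n i j u \<omega>) - mun n i j * u\<bar> \<le> ?p n + mun n i j * ?p n" using G(3)[OF w u(1)] by simp
      have b: "mun n i j * ?p n \<le> (\<mu> i j + 1) * ?p n" using elim(1) p0 by (intro mult_right_mono) auto
      have "\<bar>mun n i j - \<mu> i j\<bar> * u \<le> \<bar>mun n i j - \<mu> i j\<bar> * (C * real n)" using uC by (intro mult_left_mono) auto
      also have "\<dots> = (sqrt (real n) * \<bar>mun n i j - \<mu> i j\<bar>) * C * sqrt (real n)" by simp
      also have "\<dots> \<le> (\<bar>muhat i j\<bar> + 1) * C * ?p n"
        using elim(2) C pq(3) by (intro mult_mono) auto
      finally have "\<bar>(mun n i j - \<mu> i j) * u\<bar> \<le> (\<bar>muhat i j\<bar> + 1) * C * ?p n"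
        using u(1) by (simp add: abs_mult)
      then show ?thesis using a b by (simp add: algebra_simps abs_le_iff)
    qed
    show ?case using G(1) 1 2 by blast
  qed
qed

lemma arrival_noise:
  assumes T: "0 < T"
  shows "\<exists>c. whp (\<lambda>n \<omega>. \<forall>t. 0 \<le> t \<and> t \<le> T \<longrightarrow>
    \<bar>real (arrivals (lamn n i) (U i) t \<omega>) - real n * lam i * t\<bar> \<le> c * real n powr (3/4))"
proof (rule exI, rule whpI)
  define C where "C = (lam i + 1) * T + 4"
  have C: "0 < C" using lam_pos[of i] T by (simp add: C_def add_pos_pos)
  let ?p = "\<lambda>n. real n powr (3/4)" and ?b = "\<lambda>n. U2 i * ((C * real n powr (1/4) + 2) *
    ((C * real n powr (1/4) + 1) * (real n powr (3/4) + 1) / (real n powr (3/4))\<^sup>2))"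
  have U2: "0 \<le> U2 i" unfolding U2_def by (intro integral_nonneg_AE) auto
  have "(\<lambda>n. (C * real n powr (1/4) + 2) *
    ((C * real n powr (1/4) + 1) * (real n powr (3/4) + 1) / (real n powr (3/4))\<^sup>2)) \<longlonglongrightarrow> 0"
    using C by real_asymp
  from tendsto_mult_left[OF this, of "U2 i"] show "?b \<longlonglongrightarrow> 0" by (simp only: mult_zero_right)
  have "\<forall>\<^sub>F n in sequentially. lamn n i / real n < lam i + 1" using lam_lim[of i] by (rule order_tendstoD) simp
  then show "\<forall>\<^sub>F n in sequentially. \<exists>G\<in>events. 1 - ?b n \<le> prob G \<and>
      (\<forall>\<omega>\<in>G. \<forall>t. 0 \<le> t \<and> t \<le> T \<longrightarrow>
        \<bar>real (arrivals (lamn n i) (U i) t \<omega>) - real n * lam i * t\<bar> \<le> (4 + (\<bar>lamhat i\<bar> + 1) * T) * ?p n)"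
    using scaled_error_le[OF lamhat_lim[of i]] eventually_ge_at_top[of 1]
  proof eventually_elim
    case (elim n)
    define L where "L = nat \<lceil>C * real n powr (1/4)\<rceil>"
    define h where "h = nat \<lceil>?p n\<rceil>"
    have L: "C * real n powr (1/4) \<le> real L" "real L \<le> C * real n powr (1/4) + 1"
      unfolding L_def using C by (auto simp: of_nat_nat)
    note pq = powr_quarters[OF elim(3)]
    have p0: "0 < ?p n" using pq(2) by linarith
    have h: "?p n \<le> real h" "real h \<le> ?p n + 1"
      unfolding h_def using p0 by (auto simp: of_nat_nat)
    have h0: "0 < h" using h(1) p0 by linarith
    have n0: "0 < real n" using elim(3) by simp
    obtain G where G: "G \<in> events" "1 - (real L + 1) * (real (L * h) * U2 i / (?p n)\<^sup>2) \<le> prob G"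
      "\<And>\<omega> m. \<omega> \<in> G \<Longrightarrow> m \<le> L * h \<Longrightarrow> \<bar>(\<Sum>k=1..m. U i k \<omega>) - real m\<bar> \<le> ?p n + real h"
      using walk_uniform[OF p0 h0] by metis
    have "(real L + 1) * (real L * real h / (?p n)\<^sup>2) \<le> (C * real n powr (1/4) + 2) *
        ((C * real n powr (1/4) + 1) * (real n powr (3/4) + 1) / (real n powr (3/4))\<^sup>2)"
      using L C h by (intro mult_mono divide_right_mono) auto
    then have "U2 i * ((real L + 1) * (real L * real h / (?p n)\<^sup>2)) \<le> ?b n"
      using U2 by (rule mult_left_mono)
    then have 1: "1 - ?b n \<le> prob G" using G(2) by (simp add: mult_ac)
    have lT: "lamn n i * T \<le> (lam i + 1) * real n * T"
      using elim(1) n0 T by (intro mult_right_mono) (auto simp: pos_divide_less_eq)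
    have K: "lamn n i * T + (?p n + real h) < real (L * h)"
    proof -
      have "C * real n = (C * real n powr (1/4)) * ?p n" using pq(1) by (simp add: mult.assoc)
      also have "\<dots> \<le> real L * real h" using L h C by (intro mult_mono) auto
      finally have "C * real n \<le> real (L * h)" by simp
      moreover have "C * real n = (lam i + 1) * real n * T + 4 * real n" by (simp add: C_def algebra_simps)
      ultimately show ?thesis using lT h(2) pq(4) elim(3) n0 by linarith
    qed
    have 2: "\<bar>real (arrivals (lamn n i) (U i) t \<omega>) - real n * lam i * t\<bar> \<le> (4 + (\<bar>lamhat i\<bar> + 1) * T) * ?p n"
      if w: "\<omega> \<in> G" and t: "0 \<le> t" "t \<le> T" for \<omega> t
    proof -
      have sp: "\<omega> \<in> space M" using w G(1) sets.sets_into_space by blast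
      have a: "\<bar>real (arrivals (lamn n i) (U i) t \<omega>) - lamn n i * t\<bar> \<le> (?p n + real h) + 1"
        by (rule arrivals_error[where u="U i", OF U_pos[OF _ sp] lamn_pos[OF elim(3)] t G(3)[OF w] K])
      have "lamn n i - real n * lam i = real n * (lamn n i / real n - lam i)" using n0 by (simp add: field_simps)
      then have "\<bar>lamn n i - real n * lam i\<bar> * t = real n * \<bar>lamn n i / real n - lam i\<bar> * t"
        using n0 by (simp add: abs_mult)
      also have "\<dots> = (sqrt (real n) * \<bar>lamn n i / real n - lam i\<bar>) * t * sqrt (real n)" by simp
      also have "\<dots> \<le> (\<bar>lamhat i\<bar> + 1) * T * ?p n"
        using elim(2) t pq(3) by (intro mult_mono) auto
      finally have "\<bar>(lamn n i - real n * lam i) * t\<bar> \<le> (\<bar>lamhat i\<bar> + 1) * T * ?p n"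
        using t(1) by (simp add: abs_mult)
      then show ?thesis using a h(2) pq(2) by (simp add: algebra_simps abs_le_iff)
    qed
    show ?case using G(1) 1 2 by blast
  qed
qed

end

section \<open>Targets, scaling and the conclusion\<close>

text \<open>The target, an equilibrium \<open>A\<close> plus a multiple of the shift profile minus a decaying cushion, is the
  content of a fluid activity: its derivative is the input rate minus \<open>m\<close> times itself.\<close>

lemma target_integral:
  fixes A C K b \<eta> m t :: real
  assumes b: "0 < b" and m: "0 < m" and t: "0 \<le> t"
  defines "q \<equiv> \<lambda>t. A + C * shift_profile b \<eta> m t - K * exp (- (m * t))"
  shows "q t = q 0 + (m * A * t + C * (1 + \<eta> / b) * (exp (b * t) - 1)) - m * integral {0..t} q"
proof -
  let ?F = "\<lambda>t. (m * A * t + C * (1 + \<eta> / b) * (exp (b * t) - 1) - q t) / m"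
  have "(?F has_real_derivative q s) (at s)" for s
  proof -
    have "((\<lambda>t. m * A * t + C * (1 + \<eta> / b) * (exp (b * t) - 1) - q t) has_real_derivative
      m * A + C * (1 + \<eta> / b) * (b * exp (b * s)) -
        (C * ((b + \<eta>) * exp (b * s) - m * shift_profile b \<eta> m s) - K * (- m * exp (- (m * s))))) (at s)"
      unfolding q_def using b m by (auto intro!: derivative_eq_intros shift_profile_deriv[OF b m] simp: algebra_simps)
    then have "(?F has_real_derivative
      (m * A + C * (1 + \<eta> / b) * (b * exp (b * s)) -
        (C * ((b + \<eta>) * exp (b * s) - m * shift_profile b \<eta> m s) - K * (- m * exp (- (m * s))))) / m) (at s)"
      by (rule DERIV_cdivide)
    also have "(m * A + C * (1 + \<eta> / b) * (b * exp (b * s)) -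
        (C * ((b + \<eta>) * exp (b * s) - m * shift_profile b \<eta> m s) - K * (- m * exp (- (m * s))))) / m = q s"
      using b m by (simp add: q_def field_simps)
    finally show ?thesis .
  qed
  then have "(q has_integral ?F t - ?F 0) {0..t}"
    using t by (intro fundamental_theorem_of_calculus)
      (auto simp: has_real_derivative_iff_has_vector_derivative[symmetric] intro: has_field_derivative_at_within)
  then have "integral {0..t} q = ?F t - ?F 0" by (rule integral_unique)
  then show ?thesis using m by (simp add: field_simps)
qed

text \<open>The situation found by \<open>simple_cycle_2x2\<close>; the negative sum over the cycle is \<open>profit\<close>.\<close>

locale profitable_cycle =
  queueing_model lamn mun N E lam lamhat \<mu> muhat \<nu> \<xi> \<rho> M U S X0 x
  for lamn :: "nat \<Rightarrow> 'i::finite \<Rightarrow> real"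
    and mun :: "nat \<Rightarrow> 'i \<Rightarrow> 'j::finite \<Rightarrow> real"
    and N E lam lamhat \<mu> muhat \<nu> \<xi> \<rho>
    and M :: "'w measure" and U S X0 x +
  fixes i0 i1 :: 'i and j0 j1 :: 'j
  assumes classes: "i0 \<noteq> i1" "UNIV = {i0, i1}" and stations: "j0 \<noteq> j1" "UNIV = {j0, j1}"
    and all_activities: "E = UNIV"
    and nonbasic: "\<xi> i0 j0 = 0" and basic: "0 < \<xi> i0 j1" "0 < \<xi> i1 j0" "0 < \<xi> i1 j1"
    and profit: "\<mu> i0 j1 + \<mu> i1 j0 < \<mu> i0 j0 + \<mu> i1 j1"
begin

text \<open>
  \<open>\<kappa>\<close> is the gain in total service rate per unit of shifted mass, \<open>boost i\<close> the surplus in the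
  rerouting of class \<open>i\<close> that divides the gain between the stations, and \<open>growth\<close> is large enough for \<open>station_gain\<close>. The cushion
  \<open>slack n\<close> decays with the service rate, as customers missing from an activity do. In finitely many
  systems the rounded targets may violate the constraints; there the initial assignment is zero.
\<close>

definition "\<kappa> = \<mu> i0 j0 + \<mu> i1 j1 - \<mu> i0 j1 - \<mu> i1 j0"
definition "\<eta> = (\<mu> i1 j0 - \<mu> i0 j0 + \<mu> i1 j1 - \<mu> i0 j1) / 2"
definition "mu_bound = \<mu> i0 j0 + \<mu> i0 j1 + \<mu> i1 j0 + \<mu> i1 j1"
definition "growth = 1 + mu_bound + \<bar>\<eta>\<bar> + (8 * (\<mu> i0 j0)\<^sup>2 + 8 * \<mu> i0 j1 * \<mu> i1 j1) / \<kappa>"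
definition "fluid i j = \<xi> i j * \<nu> j"
definition "boost i = (if i = i0 then 0 else \<eta>)"
definition "cycle_sign i j = (if (i = i0) = (j = j0) then 1 else - 1 :: real)"
definition "amplitude n = real n powr (- 1 / 16)"
definition "slack n = real n powr (13 / 16)"
definition "target n i j t = real n * fluid i j +
  real n * amplitude n * cycle_sign i j * shift_profile growth (boost i) (\<mu> i j) t - slack n * exp (- (\<mu> i j * t))"
definition "inflow n i j t = \<mu> i j * (real n * fluid i j) * t +
  real n * amplitude n * cycle_sign i j * (1 + boost i / growth) * (exp (growth * t) - 1)"
definition "routing_curve n i k = inflow n i j0 (real k / (real n * lam i))"
definition "rounded_target n i j = nat \<lfloor>target n i j 0\<rfloor>"
definition "feasible n \<longleftrightarrow> (\<forall>i. (\<Sum>j\<in>UNIV. rounded_target n i j) \<le> X0 n i) \<and>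
  (\<forall>j. (\<Sum>i\<in>UNIV. rounded_target n i j) \<le> N n j)"
definition "assignment0 n = (if feasible n then rounded_target n else (\<lambda>_ _. 0))"

lemma mu_gt0: "0 < \<mu> i j" using mu_pos all_activities by simp

lemma sum_classes: "(\<Sum>i\<in>UNIV. f i) = f i0 + f i1" for f :: "'i \<Rightarrow> 'x::comm_monoid_add"
  using classes(1) by (simp add: classes(2))

lemma sum_stations: "(\<Sum>j\<in>UNIV. f j) = f j0 + f j1" for f :: "'j \<Rightarrow> 'x::comm_monoid_add"
  using stations(1) by (simp add: stations(2))

lemma class_cases: "i = i0 \<or> i = i1" using classes(2) by auto

lemma station_cases: "j = j0 \<or> j = j1" using stations(2) by auto

lemma kappa: "0 < \<kappa>" using profit by (simp add: \<kappa>_def)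

lemma mu_le_bound: "\<mu> i j \<le> mu_bound"
  using class_cases[of i] station_cases[of j] mu_gt0[of i0 j0] mu_gt0[of i0 j1] mu_gt0[of i1 j0] mu_gt0[of i1 j1]
  by (auto simp: mu_bound_def)

lemma mu_bound: "0 < mu_bound" using mu_gt0[of i0 j0] mu_le_bound[of i0 j0] by linarith

lemma growth_props:
  shows "1 + mu_bound + \<bar>\<eta>\<bar> \<le> growth" "8 * (\<mu> i0 j0)\<^sup>2 \<le> \<kappa> * growth" "8 * \<mu> i0 j1 * \<mu> i1 j1 \<le> \<kappa> * growth"
proof -
  let ?p = "8 * (\<mu> i0 j0)\<^sup>2" and ?r = "8 * \<mu> i0 j1 * \<mu> i1 j1"
  have pos: "0 \<le> ?p" "0 \<le> ?r" using mu_gt0[of i0 j1] mu_gt0[of i1 j1] by auto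
  show "1 + mu_bound + \<bar>\<eta>\<bar> \<le> growth" unfolding growth_def using kappa pos by simp
  have "\<kappa> * growth = \<kappa> * (1 + mu_bound + \<bar>\<eta>\<bar>) + (?p + ?r)"
    unfolding growth_def using kappa by (simp add: field_simps)
  moreover have "0 \<le> \<kappa> * (1 + mu_bound + \<bar>\<eta>\<bar>)" using kappa mu_bound by simp
  ultimately show "?p \<le> \<kappa> * growth" "?r \<le> \<kappa> * growth" using pos by linarith+
qed

lemma growth_pos: "0 < growth" and eta_le_b: "\<bar>boost i\<bar> \<le> growth"
  using growth_props(1) mu_bound by (auto simp: boost_def)

lemma lp: "lp_feasible lam \<mu> \<nu> \<xi> \<rho>"
  using optimal by (simp add: lp_optimal_def)

lemma fluid_class: "(\<Sum>j\<in>UNIV. \<mu> i j * fluid i j) = lam i"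
  using lp by (simp add: lp_feasible_def fluid_def mult_ac)

lemma fluid_station: "(\<Sum>i\<in>UNIV. fluid i j) = \<nu> j"
  using heavy_traffic[of j] by (simp add: fluid_def sum_distrib_right[symmetric])

lemma fluid_pos: "fluid i0 j0 = 0" "0 < fluid i0 j1" "0 < fluid i1 j0" "0 < fluid i1 j1"
  using nonbasic basic nu_pos by (simp_all add: fluid_def)

lemma cycle_sign_simps: "cycle_sign i0 j0 = 1" "cycle_sign i0 j1 = - 1" "cycle_sign i1 j0 = - 1" "cycle_sign i1 j1 = 1"
  using classes(1) stations(1) by (auto simp: cycle_sign_def)

lemma boost_simps: "boost i0 = 0" "boost i1 = \<eta>" using classes(1) by (auto simp: boost_def)

lemma target_0: "target n i j 0 = real n * fluid i j + real n * amplitude n * cycle_sign i j - slack n"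
  by (simp add: target_def)

lemma target_eq: "0 \<le> t \<Longrightarrow> target n i j t = target n i j 0 + inflow n i j t - \<mu> i j * integral {0..t} (target n i j)"
  using target_integral[OF growth_pos mu_gt0[of i j], where t=t and A="real n * fluid i j" and
      C="real n * amplitude n * cycle_sign i j" and \<eta>="boost i" and K="slack n"]
  unfolding target_def[abs_def] inflow_def by simp

lemma target_cont: "continuous_on A (target n i j)"
  unfolding target_def[abs_def] shift_profile_def[abs_def] exp_lag_def by (intro continuous_intros) (use growth_pos mu_gt0[of i j] in auto)

lemma inflow_sum: "inflow n i j0 t + inflow n i j1 t = real n * lam i * t"
proof -
  have "cycle_sign i j0 = - cycle_sign i j1" using class_cases[of i] by (auto simp: cycle_sign_simps)
  then show ?thesis
    using fluid_class[of i] unfolding inflow_def sum_stations by (simp add: algebra_simps flip: distrib_left)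
qed

lemma station_sum:
  assumes t: "0 \<le> t" "t \<le> T"
  shows "(\<Sum>i\<in>UNIV. target n i j t) \<le> real n * \<nu> j - real n * amplitude n * (\<kappa> / 8 * t) - 2 * slack n * exp (- (mu_bound * T))"
proof -
  have gain: "(\<Sum>i\<in>UNIV. cycle_sign i j * shift_profile growth (boost i) (\<mu> i j) t) \<le> - (\<kappa> / 8) * t"
    using station_gain[of "\<mu> i0 j0" "\<mu> i0 j1" "\<mu> i1 j0" "\<mu> i1 j1" t growth, folded \<kappa>_def \<eta>_def]
      mu_gt0 kappa t growth_pos growth_props mu_le_bound station_cases[of j]
    by (auto simp: sum_classes cycle_sign_simps boost_simps) (smt (verit))+
  have nd: "0 \<le> real n * amplitude n" by (simp add: amplitude_def)
  have e: "exp (- (mu_bound * T)) \<le> exp (- (\<mu> i j * t))" for i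
  proof -
    have "\<mu> i j * t \<le> mu_bound * T" using mu_le_bound[of i j] mu_gt0[of i j] t by (intro mult_mono) auto
    then show ?thesis by simp
  qed
  have s0: "0 \<le> slack n" by (simp add: slack_def)
  have "(\<Sum>i\<in>UNIV. target n i j t) = real n * (\<Sum>i\<in>UNIV. fluid i j) +
      real n * amplitude n * (\<Sum>i\<in>UNIV. cycle_sign i j * shift_profile growth (boost i) (\<mu> i j) t) - slack n * (\<Sum>i\<in>UNIV. exp (- (\<mu> i j * t)))"
    unfolding sum_classes target_def by (simp add: algebra_simps)
  also have "\<dots> \<le> real n * \<nu> j + real n * amplitude n * (- (\<kappa> / 8) * t) - slack n * (2 * exp (- (mu_bound * T)))"
  proof -
    have "real n * amplitude n * (\<Sum>i\<in>UNIV. cycle_sign i j * shift_profile growth (boost i) (\<mu> i j) t) \<le> real n * amplitude n * (- (\<kappa> / 8) * t)"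
      using gain nd by (rule mult_left_mono)
    moreover have "slack n * (2 * exp (- (mu_bound * T))) \<le> slack n * (\<Sum>i\<in>UNIV. exp (- (\<mu> i j * t)))"
      using e[of i0] e[of i1] s0 unfolding sum_classes by (intro mult_left_mono) linarith+
    ultimately show ?thesis unfolding fluid_station by linarith
  qed
  finally show ?thesis by (simp add: algebra_simps)
qed

text \<open>Routing by arrival number can realize a curve only if its slope lies between zero and the arrival
  rate. The shift adds to the flow into \<open>j0\<close> for class \<open>i0\<close> and subtracts from it for class \<open>i1\<close>, and the
  small amplitude leaves room for this, since in equilibrium class \<open>i0\<close> does not use \<open>j0\<close> and class \<open>i1\<close>
  uses it at a positive rate.\<close>

lemma inflow_slope:
  assumes uv: "0 \<le> u" "u \<le> v" "v \<le> T'"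
    and d0: "amplitude n * (growth * exp (growth * T')) \<le> lam i0"
    and d1: "amplitude n * ((growth + \<eta>) * exp (growth * T')) \<le> \<mu> i1 j0 * fluid i1 j0"
  shows "0 \<le> inflow n i j0 v - inflow n i j0 u \<and> inflow n i j0 v - inflow n i j0 u \<le> real n * lam i * (v - u)"
proof -
  define D where "D = (exp (growth * v) - exp (growth * u)) / growth"
  have D0: "0 \<le> D" unfolding D_def using uv growth_pos by (intro divide_nonneg_pos) auto
  have D1: "D \<le> exp (growth * T') * (v - u)"
  proof -
    have "1 - growth * (v - u) \<le> exp (- (growth * (v - u)))" using exp_ge_add_one_self[of "- (growth * (v - u))"] by simp
    then have "exp (growth * v) * (1 - growth * (v - u)) \<le> exp (growth * v) * exp (- (growth * (v - u)))" by (intro mult_left_mono) auto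
    also have "\<dots> = exp (growth * u)" by (simp add: exp_add[symmetric] algebra_simps)
    finally have "exp (growth * v) - exp (growth * u) \<le> exp (growth * v) * (growth * (v - u))" by (simp add: algebra_simps)
    also have "\<dots> \<le> exp (growth * T') * (growth * (v - u))" using uv growth_pos by (intro mult_right_mono) auto
    finally show ?thesis unfolding D_def using growth_pos by (simp add: pos_divide_le_eq mult_ac)
  qed
  have be: "0 \<le> growth + boost i" using eta_le_b[of i] by linarith
  have dn: "0 \<le> amplitude n" by (simp add: amplitude_def)
  have eq: "inflow n i j0 v - inflow n i j0 u =
      real n * (\<mu> i j0 * fluid i j0 * (v - u) + amplitude n * cycle_sign i j0 * (growth + boost i) * D)"
    unfolding inflow_def D_def using growth_pos by (simp add: field_simps)
  have X: "0 \<le> amplitude n * (growth + boost i) * D" "amplitude n * (growth + boost i) * D \<le> amplitude n * ((growth + boost i) * exp (growth * T')) * (v - u)"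
  proof -
    show "0 \<le> amplitude n * (growth + boost i) * D" using dn be D0 by simp
    have "amplitude n * (growth + boost i) * D \<le> amplitude n * (growth + boost i) * (exp (growth * T') * (v - u))"
      using D1 dn be by (intro mult_left_mono) auto
    then show "amplitude n * (growth + boost i) * D \<le> amplitude n * ((growth + boost i) * exp (growth * T')) * (v - u)" by (simp add: mult_ac)
  qed
  have main: "0 \<le> \<mu> i j0 * fluid i j0 * (v - u) + amplitude n * cycle_sign i j0 * (growth + boost i) * D \<and>
      \<mu> i j0 * fluid i j0 * (v - u) + amplitude n * cycle_sign i j0 * (growth + boost i) * D \<le> lam i * (v - u)"
  proof -
    consider "i = i0" | "i = i1" using class_cases by blast
    then show ?thesis
    proof cases
      case 1
      have "amplitude n * (growth * exp (growth * T')) * (v - u) \<le> lam i0 * (v - u)" using d0 uv by (intro mult_right_mono) auto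
      then show ?thesis using X unfolding 1 cycle_sign_simps boost_simps fluid_pos by simp
    next
      case 2
      have "amplitude n * ((growth + \<eta>) * exp (growth * T')) * (v - u) \<le> \<mu> i1 j0 * fluid i1 j0 * (v - u)"
        using d1 uv by (intro mult_right_mono) auto
      moreover have "\<mu> i1 j0 * fluid i1 j0 * (v - u) \<le> lam i1 * (v - u)"
        using fluid_class[of i1] mult_pos_pos[OF mu_gt0[of i1 j1] fluid_pos(4)] uv unfolding sum_stations
        by (intro mult_right_mono) linarith+
      ultimately show ?thesis using X unfolding 2 cycle_sign_simps boost_simps by simp
    qed
  qed
  have "real n * (\<mu> i j0 * fluid i j0 * (v - u) + amplitude n * cycle_sign i j0 * (growth + boost i) * D) \<le> real n * (lam i * (v - u))"
    using main by (intro mult_left_mono) auto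
  then show ?thesis unfolding eq using main by (simp add: mult_ac)
qed

end

context prob_space
begin

lemma whp_prob:
  assumes "whp Q" "\<And>n. 1 \<le> n \<Longrightarrow> {\<omega>\<in>space M. Q n \<omega>} \<in> events"
  shows "(\<lambda>n. prob {\<omega>\<in>space M. Q n \<omega>}) \<longlonglongrightarrow> 1"
proof -
  obtain G where G: "\<forall>n. G n \<in> events" "(\<lambda>n. prob (G n)) \<longlonglongrightarrow> 1"
    "\<forall>\<^sub>F n in sequentially. \<forall>\<omega>\<in>G n. Q n \<omega>" using assms(1) unfolding whp_def by blast
  show ?thesis
  proof (rule tendsto_sandwich[OF _ _ G(2) tendsto_const])
    show "\<forall>\<^sub>F n in sequentially. prob (G n) \<le> prob {\<omega>\<in>space M. Q n \<omega>}"
      using G(3) eventually_ge_at_top[of 1]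
    proof eventually_elim
      case (elim n)
      have "G n \<subseteq> space M" using G(1) sets.sets_into_space by blast
      then show ?case using elim assms(2)[OF elim(2)] by (intro finite_measure_mono) auto
    qed
  qed auto
qed

text \<open>By right continuity it suffices to look at countably many times, up to a null set, on which
  completeness of the measure helps.\<close>

lemma vanishing_event_measurable:
  fixes Y :: "real \<Rightarrow> 'a \<Rightarrow> 'x::finite \<Rightarrow> nat"
  assumes "complete_measure M" and e: "0 \<le> e" "e \<le> T"
    and meas: "\<And>t i. 0 \<le> t \<Longrightarrow> (\<lambda>\<omega>. Y t \<omega> i) \<in> M \<rightarrow>\<^sub>M count_space UNIV"
    and cad: "AE \<omega> in M. \<forall>i. cadlag (\<lambda>t. Y t \<omega> i)"
  shows "{\<omega>\<in>space M. \<forall>t\<in>{e..T}. \<forall>i. Y t \<omega> i = 0} \<in> events" (is "?A \<in> _")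
proof -
  let ?D = "insert T (\<rat> \<inter> {e..T})"
  let ?B = "{\<omega>\<in>space M. \<forall>t\<in>?D. \<forall>i\<in>UNIV. Y t \<omega> i = 0}"
  have D: "countable ?D" "?D \<subseteq> {e..T}" using countable_rat e by (auto intro: countable_subset)
  have "{\<omega>\<in>space M. \<forall>i\<in>UNIV. Y t \<omega> i = 0} \<in> events" if "t \<in> ?D" for t
  proof (rule sets.sets_Collect_finite_All)
    fix i
    have "0 \<le> t" using that D(2) e(1) by force
    from measurable_sets[OF meas[OF this, of i], of "{0}"]
    have "(\<lambda>\<omega>. Y t \<omega> i) -` {0} \<inter> space M \<in> events" by simp
    also have "(\<lambda>\<omega>. Y t \<omega> i) -` {0} \<inter> space M = {\<omega>\<in>space M. Y t \<omega> i = 0}" by auto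
    finally show "{\<omega>\<in>space M. Y t \<omega> i = 0} \<in> events" .
  qed simp
  then have B: "?B \<in> events" by (rule sets.sets_Collect_countable_All'[OF _ D(1)])
  from AE_E[OF cad] obtain N where N: "{\<omega>\<in>space M. \<not> (\<forall>i. cadlag (\<lambda>t. Y t \<omega> i))} \<subseteq> N"
    "emeasure M N = 0" "N \<in> events" by blast
  have AB: "\<omega> \<in> ?A \<longleftrightarrow> \<omega> \<in> ?B" if w: "\<omega> \<in> space M" "\<omega> \<notin> N" for \<omega>
  proof
    assume A: "\<omega> \<in> ?A"
    show "\<omega> \<in> ?B"
    proof (intro CollectI conjI ballI)
      fix t i assume "t \<in> ?D"
      then have "t \<in> {e..T}" using D(2) by (rule rev_subsetD)
      then show "Y t \<omega> i = 0" using A by simp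
    qed (rule w)
  next
    assume B: "\<omega> \<in> ?B"
    have "Y t \<omega> i = 0" if t: "t \<in> {e..T}" for t i
    proof (cases "t = T")
      case False
      have "\<omega> \<notin> {\<omega>\<in>space M. \<not> (\<forall>i. cadlag (\<lambda>t. Y t \<omega> i))}" using w(2) N(1) by (rule contra_subsetD[rotated])
      then have "cadlag (\<lambda>t. Y t \<omega> i)" using w(1) by simp
      then have "continuous (at_right t) (\<lambda>t. Y t \<omega> i)" using t e by (simp add: cadlag_def)
      then have "\<forall>\<^sub>F u in at_right t. Y u \<omega> i = Y t \<omega> i"
        unfolding continuous_within by (simp add: tendsto_discrete)
      then obtain c where c: "t < c" "\<And>u. t < u \<Longrightarrow> u < c \<Longrightarrow> Y u \<omega> i = Y t \<omega> i"
        unfolding eventually_at_right_field by blast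
      obtain r where r: "r \<in> \<rat>" "t < r" "r < min c T"
        using Rats_dense_in_real[of t "min c T"] c(1) t False by auto
      then have "Y r \<omega> i = 0" using B t by auto
      then show ?thesis using c(2)[of r] r by simp
    qed (use B in simp)
    then show "\<omega> \<in> ?A" using w by simp
  qed
  have AN: "?A \<inter> N \<in> events"
  proof (rule complete_measure.complete[OF assms(1)])
    show "?A \<inter> N \<subseteq> N" by simp
    show "N \<in> null_sets M" using N by auto
  qed
  have "?A = (?B - N) \<union> (?A \<inter> N)"
  proof (rule set_eqI)
    fix \<omega>
    show "\<omega> \<in> ?A \<longleftrightarrow> \<omega> \<in> (?B - N) \<union> (?A \<inter> N)"
      using AB[of \<omega>] by (cases "\<omega> \<in> N"; cases "\<omega> \<in> space M") simp_all
  qed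
  also have "\<dots> \<in> events" using B N(3) AN by blast
  finally show ?thesis .
qed

end

context profitable_cycle
begin

lemma amplitude_pos: "1 \<le> n \<Longrightarrow> 0 < amplitude n" by (simp add: amplitude_def)

lemma initial_targets_nonneg: "\<forall>\<^sub>F n in sequentially. \<forall>i j. 0 \<le> target n i j 0"
proof -
  have "\<forall>\<^sub>F n in sequentially. 0 \<le> target n i j 0" for i j
  proof -
    have 1: "\<forall>\<^sub>F n in sequentially. 0 \<le> real n * a + real n * real n powr (- 1 / 16) * s - real n powr (13 / 16)"
      if "0 < a" for a s :: real using that by real_asymp
    have 2: "\<forall>\<^sub>F n in sequentially. 0 \<le> real n * real n powr (- 1 / 16) - real n powr (13 / 16)" by real_asymp
    show ?thesis unfolding target_0 amplitude_def slack_def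
      using class_cases[of i] station_cases[of j] 1[OF fluid_pos(2), of "- 1"] 1[OF fluid_pos(3), of "- 1"]
        1[OF fluid_pos(4), of 1] 2
      by (auto simp: cycle_sign_simps fluid_pos(1))
  qed
  then have "\<forall>\<^sub>F n in sequentially. \<forall>i\<in>UNIV. \<forall>j\<in>UNIV. 0 \<le> target n i j 0"
    by (intro eventually_ball_finite ballI) auto
  then show ?thesis by simp
qed

lemma sum_q_0: "(\<Sum>j\<in>UNIV. target n i j 0) = real n * (\<Sum>j\<in>UNIV. fluid i j) - 2 * slack n"
  "(\<Sum>i\<in>UNIV. target n i j 0) = real n * \<nu> j - 2 * slack n"
proof -
  have "cycle_sign i j0 = - cycle_sign i j1" "cycle_sign i0 j = - cycle_sign i1 j"
    using class_cases[of i] station_cases[of j] by (auto simp: cycle_sign_simps)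
  then show "(\<Sum>j\<in>UNIV. target n i j 0) = real n * (\<Sum>j\<in>UNIV. fluid i j) - 2 * slack n"
    "(\<Sum>i\<in>UNIV. target n i j 0) = real n * \<nu> j - 2 * slack n"
    unfolding target_0 sum_stations sum_classes fluid_station[of j, unfolded sum_classes, symmetric]
    by (simp_all add: algebra_simps)
qed

lemma X0_error: "\<forall>\<^sub>F n in sequentially. \<bar>real (X0 n i) - real n * (\<Sum>j\<in>UNIV. fluid i j)\<bar> \<le> (\<bar>x i\<bar> + 1) * sqrt (real n)"
proof -
  have "(\<lambda>n. \<bar>(real (X0 n i) - real n * (\<Sum>j\<in>UNIV. fluid i j)) / sqrt (real n)\<bar>) \<longlonglongrightarrow> \<bar>x i\<bar>"
    using X0_lim[of i] unfolding fluid_def by (rule tendsto_rabs)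
  then have "\<forall>\<^sub>F n in sequentially. \<bar>(real (X0 n i) - real n * (\<Sum>j\<in>UNIV. fluid i j)) / sqrt (real n)\<bar> < \<bar>x i\<bar> + 1"
    by (rule order_tendstoD) simp
  then show ?thesis using eventually_gt_at_top[of 0]
    by eventually_elim (simp add: abs_divide pos_divide_less_eq)
qed

lemma N_error: "\<forall>\<^sub>F n in sequentially. \<bar>real (N n j) - real n * \<nu> j\<bar> \<le> sqrt (real n)"
  using scaled_error_le[OF N_second_order[of j]] eventually_gt_at_top[of 0]
proof eventually_elim
  case (elim n)
  have n: "0 < real n" using elim by simp
  have "\<bar>real (N n j) - real n * \<nu> j\<bar> = real n * \<bar>real (N n j) / real n - \<nu> j\<bar>"
    using n by (simp add: abs_mult[of "real n" _, symmetric, simplified] field_simps)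
  also have "\<dots> = sqrt (real n) * (sqrt (real n) * \<bar>real (N n j) / real n - \<nu> j\<bar>)" by simp
  also have "\<dots> \<le> sqrt (real n) * 1" using elim by (intro mult_left_mono) auto
  finally show ?case by simp
qed

text \<open>The class totals of the targets are \<open>2 * slack n\<close> below their fluid values and the station totals likewise.
  Since \<open>slack n\<close> is of larger order than \<open>sqrt n\<close>, the rounded targets are eventually a feasible
  initial assignment, and the queues that they leave are of order \<open>slack n\<close>.\<close>

lemma initial_state:
  "\<forall>\<^sub>F n in sequentially. (\<forall>i j. \<bar>real (assignment0 n i j) - target n i j 0\<bar> \<le> 1) \<and>
     (\<forall>i. real (X0 n i - (\<Sum>j\<in>UNIV. assignment0 n i j)) \<le> (\<bar>x i\<bar> + 1) * sqrt (real n) + 2 * slack n + 2)"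
proof -
  have Xe: "\<forall>\<^sub>F n in sequentially. \<forall>i\<in>UNIV. \<bar>real (X0 n i) - real n * (\<Sum>j\<in>UNIV. fluid i j)\<bar> \<le> (\<bar>x i\<bar> + 1) * sqrt (real n)"
    by (intro eventually_ball_finite ballI X0_error) auto
  have Ne: "\<forall>\<^sub>F n in sequentially. \<forall>j\<in>UNIV. \<bar>real (N n j) - real n * \<nu> j\<bar> \<le> sqrt (real n)"
    by (intro eventually_ball_finite ballI N_error) auto
  have "\<forall>\<^sub>F n in sequentially. (\<bar>x i\<bar> + 1) * sqrt (real n) \<le> 2 * slack n" for i
    unfolding slack_def by real_asymp
  then have s1: "\<forall>\<^sub>F n in sequentially. \<forall>i\<in>UNIV. (\<bar>x i\<bar> + 1) * sqrt (real n) \<le> 2 * slack n"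
    by (intro eventually_ball_finite ballI) auto
  have s2: "\<forall>\<^sub>F n in sequentially. sqrt (real n) \<le> 2 * slack n"
    unfolding slack_def by real_asymp
  show ?thesis using initial_targets_nonneg Xe Ne s1 s2
  proof eventually_elim
    case (elim n)
    have c: "real (rounded_target n i j) \<le> target n i j 0" "target n i j 0 - 1 \<le> real (rounded_target n i j)" for i j
    proof -
      have "0 \<le> \<lfloor>target n i j 0\<rfloor>" using elim(1) by simp
      then have "real (rounded_target n i j) = of_int \<lfloor>target n i j 0\<rfloor>" by (simp add: rounded_target_def)
      then show "real (rounded_target n i j) \<le> target n i j 0" "target n i j 0 - 1 \<le> real (rounded_target n i j)" by linarith+
    qed
    have "(\<Sum>j\<in>UNIV. rounded_target n i j) \<le> X0 n i" for i
    proof -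
      have "real (\<Sum>j\<in>UNIV. rounded_target n i j) \<le> (\<Sum>j\<in>UNIV. target n i j 0)" unfolding of_nat_sum by (intro sum_mono c)
      also have "\<dots> \<le> real (X0 n i)"
      proof -
        have "\<bar>real (X0 n i) - real n * (\<Sum>j\<in>UNIV. fluid i j)\<bar> \<le> (\<bar>x i\<bar> + 1) * sqrt (real n)"
          "(\<bar>x i\<bar> + 1) * sqrt (real n) \<le> 2 * slack n" using elim(2,4) by blast+
        then show ?thesis unfolding sum_q_0 by linarith
      qed
      finally show ?thesis by (simp only: of_nat_le_iff)
    qed
    moreover have "(\<Sum>i\<in>UNIV. rounded_target n i j) \<le> N n j" for j
    proof -
      have "real (\<Sum>i\<in>UNIV. rounded_target n i j) \<le> (\<Sum>i\<in>UNIV. target n i j 0)" unfolding of_nat_sum by (intro sum_mono c)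
      also have "\<dots> \<le> real (N n j)"
      proof -
        have "\<bar>real (N n j) - real n * \<nu> j\<bar> \<le> sqrt (real n)" using elim(3) by blast
        then show ?thesis unfolding sum_q_0 using elim(5) by linarith
      qed
      finally show ?thesis by (simp only: of_nat_le_iff)
    qed
    ultimately have f: "feasible n" by (simp add: feasible_def)
    then have P: "assignment0 n = rounded_target n" by (simp add: assignment0_def)
    have "real (X0 n i - (\<Sum>j\<in>UNIV. assignment0 n i j)) \<le> (\<bar>x i\<bar> + 1) * sqrt (real n) + 2 * slack n + 2" for i
    proof -
      have "(\<Sum>j\<in>UNIV. assignment0 n i j) \<le> X0 n i" using f unfolding P feasible_def by blast
      then have "real (X0 n i - (\<Sum>j\<in>UNIV. assignment0 n i j)) = real (X0 n i) - (\<Sum>j\<in>UNIV. real (rounded_target n i j))"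
        unfolding P by (simp add: of_nat_diff)
      also have "\<dots> \<le> real (X0 n i) - (\<Sum>j\<in>UNIV. target n i j 0) + 2"
        using c(2)[of i j0] c(2)[of i j1] unfolding sum_stations by linarith
      also have "\<dots> \<le> (\<bar>x i\<bar> + 1) * sqrt (real n) + 2 * slack n + 2"
      proof -
        have "\<bar>real (X0 n i) - real n * (\<Sum>j\<in>UNIV. fluid i j)\<bar> \<le> (\<bar>x i\<bar> + 1) * sqrt (real n)"
          using elim(2) by blast
        then show ?thesis unfolding sum_q_0 by linarith
      qed
      finally show ?thesis .
    qed
    moreover have "\<bar>real (assignment0 n i j) - target n i j 0\<bar> \<le> 1" for i j
      unfolding P using c[of i j] by linarith
    ultimately show ?case by blast
  qed
qed

lemma assignment0_feasible: "(\<Sum>j\<in>UNIV. assignment0 n i j) \<le> X0 n i" "(\<Sum>i\<in>UNIV. assignment0 n i j) \<le> N n j"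
  by (auto simp: assignment0_def feasible_def)

lemma noise:
  assumes T: "0 < T"
  shows "\<exists>c>0. whp (\<lambda>n \<omega>.
    (\<forall>i t. 0 \<le> t \<and> t \<le> T \<longrightarrow> \<bar>real (arrivals (lamn n i) (U i) t \<omega>) - real n * lam i * t\<bar> \<le> c * real n powr (3/4)) \<and>
    (\<forall>i j u. 0 \<le> u \<and> u \<le> real (N n j) * T \<longrightarrow> \<bar>real (S n i j u \<omega>) - \<mu> i j * u\<bar> \<le> c * real n powr (3/4)))"
proof -
  define ca where "ca i = (SOME c. whp (\<lambda>n \<omega>. \<forall>t. 0 \<le> t \<and> t \<le> T \<longrightarrow>
      \<bar>real (arrivals (lamn n i) (U i) t \<omega>) - real n * lam i * t\<bar> \<le> c * real n powr (3/4)))" for i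
  have ca: "whp (\<lambda>n \<omega>. \<forall>t. 0 \<le> t \<and> t \<le> T \<longrightarrow>
      \<bar>real (arrivals (lamn n i) (U i) t \<omega>) - real n * lam i * t\<bar> \<le> ca i * real n powr (3/4))" for i
    unfolding ca_def by (rule someI_ex[OF arrival_noise[OF T]])
  define cs where "cs i j = (SOME c. whp (\<lambda>n \<omega>. \<forall>u. 0 \<le> u \<and> u \<le> real (N n j) * T \<longrightarrow>
      \<bar>real (S n i j u \<omega>) - \<mu> i j * u\<bar> \<le> c * real n powr (3/4)))" for i j
  have E: "(i, j) \<in> E" for i j by (simp add: all_activities)
  have cs: "whp (\<lambda>n \<omega>. \<forall>u. 0 \<le> u \<and> u \<le> real (N n j) * T \<longrightarrow>
      \<bar>real (S n i j u \<omega>) - \<mu> i j * u\<bar> \<le> cs i j * real n powr (3/4))" for i j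
    unfolding cs_def by (rule someI_ex[OF service_noise[OF E T]])
  define c where "c = 1 + (\<Sum>i\<in>UNIV. \<bar>ca i\<bar>) + (\<Sum>i\<in>UNIV. \<Sum>j\<in>UNIV. \<bar>cs i j\<bar>)"
  have c0: "0 < c" unfolding c_def by (intro add_pos_nonneg sum_nonneg) auto
  have ci: "ca i \<le> c" for i
  proof -
    have "\<bar>ca i\<bar> \<le> (\<Sum>i\<in>UNIV. \<bar>ca i\<bar>)" by (rule member_le_sum) auto
    moreover have "0 \<le> (\<Sum>i\<in>UNIV. \<Sum>j\<in>UNIV. \<bar>cs i j\<bar>)" by (intro sum_nonneg) auto
    ultimately show ?thesis unfolding c_def by linarith
  qed
  have cij: "cs i j \<le> c" for i j
  proof -
    have "\<bar>cs i j\<bar> \<le> (\<Sum>j\<in>UNIV. \<bar>cs i j\<bar>)" by (rule member_le_sum) auto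
    also have "\<dots> \<le> (\<Sum>i\<in>UNIV. \<Sum>j\<in>UNIV. \<bar>cs i j\<bar>)"
      by (rule member_le_sum[of i _ "\<lambda>i. \<Sum>j\<in>UNIV. \<bar>cs i j\<bar>"]) (auto intro: sum_nonneg)
    moreover have "0 \<le> (\<Sum>i\<in>UNIV. \<bar>ca i\<bar>)" by (intro sum_nonneg) auto
    ultimately show ?thesis unfolding c_def by linarith
  qed
  have m: "a * real n powr (3/4) \<le> c * real n powr (3/4)" if "a \<le> c" for a n
    using that by (intro mult_right_mono) auto
  have "whp (\<lambda>n \<omega>. (\<forall>i t. 0 \<le> t \<and> t \<le> T \<longrightarrow>
        \<bar>real (arrivals (lamn n i) (U i) t \<omega>) - real n * lam i * t\<bar> \<le> c * real n powr (3/4)) \<and>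
      (\<forall>i j u. 0 \<le> u \<and> u \<le> real (N n j) * T \<longrightarrow>
        \<bar>real (S n i j u \<omega>) - \<mu> i j * u\<bar> \<le> c * real n powr (3/4)))"
  proof (rule whp_mono[OF whp_conj[OF whp_all[OF ca] whp_all[OF whp_all[OF cs]]]], intro always_eventually allI ballI impI conjI)
    fix n \<omega> i t
    assume h: "(\<forall>i t. 0 \<le> t \<and> t \<le> T \<longrightarrow>
        \<bar>real (arrivals (lamn n i) (U i) t \<omega>) - real n * lam i * t\<bar> \<le> ca i * real n powr (3/4)) \<and>
      (\<forall>i j u. 0 \<le> u \<and> u \<le> real (N n j) * T \<longrightarrow>
        \<bar>real (S n i j u \<omega>) - \<mu> i j * u\<bar> \<le> cs i j * real n powr (3/4))"
    { assume "0 \<le> t \<and> t \<le> T"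
      then have "\<bar>real (arrivals (lamn n i) (U i) t \<omega>) - real n * lam i * t\<bar> \<le> ca i * real n powr (3/4)" using h by blast
      then show "\<bar>real (arrivals (lamn n i) (U i) t \<omega>) - real n * lam i * t\<bar> \<le> c * real n powr (3/4)"
        using m[OF ci[of i], of n] by linarith }
    fix j
    assume "0 \<le> t \<and> t \<le> real (N n j) * T"
    then have "\<bar>real (S n i j t \<omega>) - \<mu> i j * t\<bar> \<le> cs i j * real n powr (3/4)" using h by blast
    then show "\<bar>real (S n i j t \<omega>) - \<mu> i j * t\<bar> \<le> c * real n powr (3/4)"
      using m[OF cij[of i j], of n] by linarith
  qed
  then show ?thesis using c0 by blast
qed

end

context profitable_cycle
begin

text \<open>The orders of magnitude are \<open>3/4 < 13/16 < 14/16 < 15/16\<close>, the exponents of the fluctuations, the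
  cushion, the idle capacity at time \<open>amplitude n\<close>, and the shift.\<close>

lemma scale_facts:
  assumes T: "0 < T" and c: "0 < c" and e: "0 < e"
  shows "\<forall>\<^sub>F n in sequentially.
    (\<forall>i. c * real n powr (3/4) \<le> real n * lam i) \<and>
    amplitude n * (growth * exp (growth * (T + 1))) \<le> lam i0 \<and>
    amplitude n * ((growth + \<eta>) * exp (growth * (T + 1))) \<le> \<mu> i1 j0 * fluid i1 j0 \<and>
    sqrt (real n) + 2 * (2 * (2 + 3 * (c * real n powr (3/4))) * exp (2 * mu_bound * T) + 1) \<le> 2 * slack n * exp (- (mu_bound * T)) \<and>
    (2 * exp (2 * mu_bound * T) + 1) * (\<Sum>i\<in>UNIV. (\<bar>x i\<bar> + 1) * sqrt (real n) + 2 * slack n + 2)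
      \<le> real n * amplitude n * (\<kappa> / 8 * amplitude n) \<and>
    (\<forall>i. 2 * (c * real n powr (3/4)) < real n * lam i * (e - amplitude n)) \<and> amplitude n < e"
proof (intro eventually_conj)
  have fin: "\<forall>\<^sub>F n in sequentially. \<forall>i. P n i" if "\<And>i. \<forall>\<^sub>F n in sequentially. P n i" for P :: "nat \<Rightarrow> 'i \<Rightarrow> bool"
  proof -
    have "\<forall>\<^sub>F n in sequentially. \<forall>i\<in>UNIV. P n i" by (intro eventually_ball_finite ballI that) simp
    then show ?thesis by simp
  qed
  have 1: "\<forall>\<^sub>F n in sequentially. c * real n powr (3/4) \<le> real n * a" if "0 < a" for a
    using that c by real_asymp
  show "\<forall>\<^sub>F n in sequentially. \<forall>i. c * real n powr (3/4) \<le> real n * lam i"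
    by (intro fin 1 lam_pos)
  have 2: "\<forall>\<^sub>F n in sequentially. real n powr (- 1 / 16) * A \<le> a" if "0 < A" "0 < a" for A a :: real
    using that by real_asymp
  have "0 < growth + \<eta>" using growth_props(1) mu_bound by linarith
  then show "\<forall>\<^sub>F n in sequentially. amplitude n * (growth * exp (growth * (T + 1))) \<le> lam i0"
    "\<forall>\<^sub>F n in sequentially. amplitude n * ((growth + \<eta>) * exp (growth * (T + 1))) \<le> \<mu> i1 j0 * fluid i1 j0"
    unfolding amplitude_def by (intro 2 mult_pos_pos lam_pos growth_pos mu_gt0 fluid_pos; simp)+
  have 3: "\<forall>\<^sub>F n in sequentially. sqrt (real n) + 2 * (2 * (2 + 3 * (c * real n powr (3/4))) * A + 1)
      \<le> 2 * real n powr (13 / 16) * B" if "0 < A" "0 < B" for A B :: real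
    using that c by real_asymp
  show "\<forall>\<^sub>F n in sequentially. sqrt (real n) + 2 * (2 * (2 + 3 * (c * real n powr (3/4))) * exp (2 * mu_bound * T) + 1)
      \<le> 2 * slack n * exp (- (mu_bound * T))"
    unfolding slack_def by (intro 3) auto
  have 4: "\<forall>\<^sub>F n in sequentially. A * (((a + 1) * sqrt (real n) + 2 * real n powr (13 / 16) + 2) +
      ((a' + 1) * sqrt (real n) + 2 * real n powr (13 / 16) + 2))
      \<le> real n * real n powr (- 1 / 16) * (k / 8 * real n powr (- 1 / 16))"
    if "0 < A" "0 \<le> a" "0 \<le> a'" "0 < k" for A a a' k :: real
    using that by real_asymp
  show "\<forall>\<^sub>F n in sequentially. (2 * exp (2 * mu_bound * T) + 1) * (\<Sum>i\<in>UNIV. (\<bar>x i\<bar> + 1) * sqrt (real n) + 2 * slack n + 2)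
      \<le> real n * amplitude n * (\<kappa> / 8 * amplitude n)"
    unfolding slack_def amplitude_def sum_classes by (intro 4 kappa) (auto intro: add_pos_pos)
  have 5: "\<forall>\<^sub>F n in sequentially. 2 * (c * real n powr (3/4)) < real n * a * (e - real n powr (- 1 / 16))"
    if "0 < a" for a
    using that c e by real_asymp
  show "\<forall>\<^sub>F n in sequentially. \<forall>i. 2 * (c * real n powr (3/4)) < real n * lam i * (e - amplitude n)"
    unfolding amplitude_def by (intro fin 5 lam_pos)
  show "\<forall>\<^sub>F n in sequentially. amplitude n < e"
    unfolding amplitude_def using e by real_asymp
qed

lemma arrivals_measurable:
  assumes n: "1 \<le> n" and t: "0 \<le> t"
  shows "arrivals (lamn n i) (U i) t \<in> M \<rightarrow>\<^sub>M count_space UNIV"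
proof (rule measurableI)
  fix B :: "nat set"
  let ?F = "\<lambda>v. case v of
            None \<Rightarrow> sigma_sets (space M)
              (\<Union>i. process_sets M {0..} (count_space UNIV) (arrivals (lamn n i) (U i)))
          | Some (i, j) \<Rightarrow> process_sets M {0..} (count_space UNIV) (S n i j)"
  have "?F None \<subseteq> events" using S_indep[OF n] unfolding indep_sets_def by blast
  moreover have "arrivals (lamn n i) (U i) t -` B \<inter> space M \<in> process_sets M {0..} (count_space UNIV) (arrivals (lamn n i) (U i))"
    unfolding process_sets_def using t by (intro sigma_sets.Basic UN_I[of t]) auto
  ultimately show "arrivals (lamn n i) (U i) t -` B \<inter> space M \<in> events"
    by (auto intro!: sigma_sets.Basic)
qed simp

abbreviation "policy n \<equiv> static_policy j0 j1 (amplitude n)"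
abbreviation "marks n \<equiv> \<lambda>i k \<omega>. of_bool (crosses_integer (routing_curve n i) k) :: real"
abbreviation "arr n \<equiv> \<lambda>i. arrivals (lamn n i) (U i)"

lemma process_exists:
  assumes n: "1 \<le> n"
  shows "\<exists>X Y Z \<Psi>. N_SCP M E (N n) (X0 n) (arr n) (S n) (assignment0 n) (policy n) (marks n) X Y Z \<Psi>"
proof -
  have m: "0 < mun n i j" for i j using activities[OF n] all_activities by auto
  have "capacity_policy (N n) (X0 n) (assignment0 n) (policy n)"
    by unfold_locales
      (rule static_policy_class static_policy_station assignment0_feasible static_policy_measurable)+
  then show ?thesis unfolding all_activities
    by (rule controlled_process_exists[where r="mun n"])
      (rule U_measurable U_pos walk_unbounded lamn_pos[OF n] S_poisson[OF n] m arrivals_measurable[OF n]; assumption?)+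
qed

lemma queue_empty_whp:
  assumes scp: "\<And>n. 1 \<le> n \<Longrightarrow> N_SCP M E (N n) (X0 n) (arr n) (S n) (assignment0 n) (policy n) (marks n)
      (X n) (Y n) (Z n) (\<Psi> n)"
    and e: "0 < e" "e < T"
  shows "whp (\<lambda>n \<omega>. \<forall>t\<in>{e..T}. \<forall>i. Y n t \<omega> i = 0)"
proof -
  have T: "0 < T" using e by linarith
  define path where "path n \<omega> \<longleftrightarrow> controlled_path E (N n) (X0 n) (arr n) (S n) (assignment0 n) (policy n) (marks n)
      (X n) (Y n) (Z n) (\<Psi> n) \<omega>" for n \<omega>
  have path: "AE \<omega> in M. path n \<omega>" if "1 \<le> n" for n
    using scp[OF that] unfolding N_SCP_def path_def controlled_path_def by (elim conjE)
  have unb: "AE \<omega> in M. \<forall>i L. \<exists>m. L < (\<Sum>k=1..m. U i k \<omega>)"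
    by (rule AE_all_countable[THEN iffD2]) (use walk_unbounded in blast)
  have regular: "whp (\<lambda>n \<omega>. path n \<omega> \<and> (\<forall>i L. \<exists>m. L < (\<Sum>k=1..m. U i k \<omega>)))"
    by (rule whp_AE) (rule AE_conjI[OF path unb])
  obtain c where c: "0 < c" and ns: "whp (\<lambda>n \<omega>.
    (\<forall>i t. 0 \<le> t \<and> t \<le> T \<longrightarrow> \<bar>real (arr n i t \<omega>) - real n * lam i * t\<bar> \<le> c * real n powr (3/4)) \<and>
    (\<forall>i j u. 0 \<le> u \<and> u \<le> real (N n j) * T \<longrightarrow> \<bar>real (S n i j u \<omega>) - \<mu> i j * u\<bar> \<le> c * real n powr (3/4)))"
    using noise[OF T] by blast
  have Ne: "\<forall>\<^sub>F n in sequentially. \<forall>j\<in>UNIV. \<bar>real (N n j) - real n * \<nu> j\<bar> \<le> sqrt (real n)"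
    by (intro eventually_ball_finite ballI N_error) auto
  show ?thesis
  proof (rule whp_mono[OF whp_conj[OF regular ns]])
    show "\<forall>\<^sub>F n in sequentially. \<forall>\<omega>\<in>space M.
      (path n \<omega> \<and> (\<forall>i L. \<exists>m. L < (\<Sum>k=1..m. U i k \<omega>))) \<and>
      (\<forall>i t. 0 \<le> t \<and> t \<le> T \<longrightarrow> \<bar>real (arr n i t \<omega>) - real n * lam i * t\<bar> \<le> c * real n powr (3/4)) \<and>
      (\<forall>i j u. 0 \<le> u \<and> u \<le> real (N n j) * T \<longrightarrow> \<bar>real (S n i j u \<omega>) - \<mu> i j * u\<bar> \<le> c * real n powr (3/4)) \<longrightarrow>
      (\<forall>t\<in>{e..T}. \<forall>i. Y n t \<omega> i = 0)"
      using scale_facts[OF T c e(1)] initial_state Ne eventually_ge_at_top[of 1]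
    proof eventually_elim
      case (elim n)
      have n: "1 \<le> n" by (rule elim(4))
      have rn: "0 < real n" using n by simp
      let ?x = "c * real n powr (3/4)" and ?E = "exp (2 * mu_bound * T)"
      from elim(1) have s: "\<And>i. ?x \<le> real n * lam i" "amplitude n * (growth * exp (growth * (T + 1))) \<le> lam i0"
        "amplitude n * ((growth + \<eta>) * exp (growth * (T + 1))) \<le> \<mu> i1 j0 * fluid i1 j0"
        "sqrt (real n) + 2 * (2 * (2 + 3 * ?x) * ?E + 1) \<le> 2 * slack n * exp (- (mu_bound * T))"
        "(2 * ?E + 1) * (\<Sum>i\<in>UNIV. (\<bar>x i\<bar> + 1) * sqrt (real n) + 2 * slack n + 2) \<le> real n * amplitude n * (\<kappa> / 8 * amplitude n)"
        "\<And>i. 2 * ?x < real n * lam i * (e - amplitude n)" "amplitude n < e" by blast+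
      have P0: "\<And>i j. \<bar>real (assignment0 n i j) - target n i j 0\<bar> \<le> 1"
        and Y0: "\<And>i. real (X0 n i - (\<Sum>j\<in>UNIV. assignment0 n i j)) \<le> (\<bar>x i\<bar> + 1) * sqrt (real n) + 2 * slack n + 2"
        using elim(2) by blast+
      have Nn: "\<And>j. \<bar>real (N n j) - real n * \<nu> j\<bar> \<le> sqrt (real n)" using elim(3) by blast
      have "card {i0, i1} = 2" using classes(1) by simp
      then have C2: "CARD('i) = 2" using classes(2) by simp
      show ?case
      proof (intro ballI impI)
        fix \<omega> t
        assume w: "\<omega> \<in> space M" and t: "t \<in> {e..T}" and h: "(path n \<omega> \<and> (\<forall>i L. \<exists>m. L < (\<Sum>k=1..m. U i k \<omega>))) \<and>
          (\<forall>i t. 0 \<le> t \<and> t \<le> T \<longrightarrow> \<bar>real (arr n i t \<omega>) - real n * lam i * t\<bar> \<le> ?x) \<and>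
          (\<forall>i j u. 0 \<le> u \<and> u \<le> real (N n j) * T \<longrightarrow> \<bar>real (S n i j u \<omega>) - \<mu> i j * u\<bar> \<le> ?x)"
        have p: "path n \<omega>" using h by blast
        have unbU: "\<exists>m. L < (\<Sum>k=1..m. U i k \<omega> / lamn n i)" for i L
        proof -
          obtain m where "L * lamn n i < (\<Sum>k=1..m. U i k \<omega>)" using h by blast
          then show ?thesis using lamn_pos[OF n, of i]
            by (auto simp: sum_divide_distrib[symmetric] pos_less_divide_eq)
        qed
        have jt: "jump_time (arr n i) k \<omega> = (\<Sum>k=1..k. U i k \<omega> / lamn n i)" for i k
          by (intro jump_time_arrivals[where u="U i" and \<omega>=\<omega>] U_pos w lamn_pos n unbU)
        interpret routed_path j0 j1 "N n" "X0 n" "assignment0 n" "\<lambda>i t. arr n i t \<omega>" "\<lambda>i k. jump_time (arr n i) k \<omega>"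
          "\<lambda>i j u. S n i j u \<omega>" "routing_curve n" "amplitude n" "\<lambda>t. X n t \<omega>" "\<lambda>t. Y n t \<omega>" "\<lambda>t. Z n t \<omega>" "\<lambda>t. \<Psi> n t \<omega>"
        proof
          show "j0 \<noteq> j1" "UNIV = {j0, j1}" by (rule stations)+
          show "jump_time (arr n i) 0 \<omega> = 0" for i by (simp add: jt)
          show "strict_mono (\<lambda>k. jump_time (arr n i) k \<omega>)" for i
            unfolding jt using U_pos w lamn_pos[OF n] by (intro strict_mono_partial_sums) auto
          show "k \<le> arr n i t \<omega> \<longleftrightarrow> jump_time (arr n i) k \<omega> \<le> t" if t: "0 \<le> t" for i k t
          proof -
            obtain K where K: "t < (\<Sum>k=1..K. U i k \<omega> / lamn n i)" using unbU by blast
            show ?thesis unfolding jt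
              by (rule arrivals_iff[where u="U i" and \<omega>=\<omega>, OF U_pos[OF _ w] lamn_pos[OF n] t K])
          qed
          show "cadlag (\<lambda>t. Y n t \<omega> i)" "cadlag (\<lambda>t. Z n t \<omega> j)" "cadlag (\<lambda>t. \<Psi> n t \<omega> i j)" for i j
            using p unfolding path_def controlled_path_def by blast+
          show "Y n t \<omega> i + (\<Sum>j\<in>UNIV. \<Psi> n t \<omega> i j) +
            (\<Sum>j\<in>UNIV. S n i j (integral {0..t} (\<lambda>u. real (\<Psi> n u \<omega> i j))) \<omega>) = X0 n i + arr n i t \<omega>"
            if "0 \<le> t" for t i
          proof -
            have "X n t \<omega> i + (\<Sum>j'\<in>UNIV. S n i j' (integral {0..t} (\<lambda>s. real (\<Psi> n s \<omega> i j'))) \<omega>)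
              = X0 n i + arr n i t \<omega>" "Y n t \<omega> i + (\<Sum>j'\<in>UNIV. \<Psi> n t \<omega> i j') = X n t \<omega> i"
              using p that unfolding path_def controlled_path_def by blast+
            then show ?thesis by linarith
          qed
          show "Z n t \<omega> j + (\<Sum>i\<in>UNIV. \<Psi> n t \<omega> i j) = N n j" if "0 \<le> t" for t j
            using p that unfolding path_def controlled_path_def by blast
          show "\<Psi> n t \<omega> i j + S n i j (integral {0..t} (\<lambda>u. real (\<Psi> n u \<omega> i j))) \<omega> =
            assignment0 n i j + (\<Sum>k | 1 \<le> k \<and> jump_time (arr n i) k \<omega> \<le> t. policy n i j (jump_time (arr n i) k \<omega>)
              (\<lambda>a. left_lim (\<lambda>s. X n s \<omega> a) (jump_time (arr n i) k \<omega>))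
              (\<lambda>a. left_lim (\<lambda>s. Y n s \<omega> a) (jump_time (arr n i) k \<omega>))
              (\<lambda>b. left_lim (\<lambda>s. Z n s \<omega> b) (jump_time (arr n i) k \<omega>))
              (\<lambda>a b. left_lim (\<lambda>s. \<Psi> n s \<omega> a b) (jump_time (arr n i) k \<omega>)) (of_bool (crosses_integer (routing_curve n i) k)))"
            if "0 \<le> t" for t i j
          proof -
            have "\<Psi> n t \<omega> i j + S n i j (integral {0..t} (\<lambda>s. real (\<Psi> n s \<omega> i j))) \<omega>
             = \<Psi> n 0 \<omega> i j + routing (arr n i) (policy n i j) (marks n i) (X n) (Y n) (Z n) (\<Psi> n) t \<omega>"
             "\<Psi> n 0 \<omega> i j = assignment0 n i j"
              using p that unfolding path_def controlled_path_def by blast+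
            then show ?thesis unfolding routing_def Let_def by simp
          qed
          show "(\<Sum>j\<in>UNIV. assignment0 n i j) \<le> X0 n i" for i by (rule assignment0_feasible)
        qed
        interpret tracked_path j0 j1 "N n" "X0 n" "assignment0 n" "\<lambda>i t. arr n i t \<omega>" "\<lambda>i k. jump_time (arr n i) k \<omega>"
          "\<lambda>i j u. S n i j u \<omega>" "routing_curve n" "amplitude n" "\<lambda>t. X n t \<omega>" "\<lambda>t. Y n t \<omega>" "\<lambda>t. Z n t \<omega>" "\<lambda>t. \<Psi> n t \<omega>"
          T "T + 1" ?x mu_bound "\<lambda>i. real n * lam i" \<mu> "target n" "inflow n"
        proof
          have room_aux: "(\<Sum>i\<in>UNIV. target n i j t) + real CARD('i) * (2 * (2 + 3 * ?x) * ?E + 1) \<le>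
              real (N n j) - real n * amplitude n * (\<kappa> / 8 * t)" if t: "0 \<le> t" "t \<le> T" for j t
            using station_sum[OF t, of n j] Nn[of j] s(4) unfolding C2 by simp
          have gain0: "0 \<le> real n * amplitude n * (\<kappa> / 8 * t)" if "0 \<le> t" for t
            using rn amplitude_pos[OF n] kappa that by simp
          show "0 < T" by (rule T)
          show "0 \<le> amplitude n" using amplitude_pos[OF n] by simp
          show "0 \<le> ?x" using c by simp
          show "0 < real n * lam i" for i using rn lam_pos by simp
          show "T + ?x / (real n * lam i) \<le> T + 1" for i
            using s(1)[of i] rn lam_pos[of i] by (simp add: divide_le_eq_1)
          show "0 < \<mu> i j" "\<mu> i j \<le> mu_bound" for i j by (rule mu_gt0 mu_le_bound)+
          show "\<bar>real (arr n i t \<omega>) - real n * lam i * t\<bar> \<le> ?x" if "0 \<le> t" "t \<le> T" for i t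
            using h that by blast
          show "\<bar>real (S n i j u \<omega>) - \<mu> i j * u\<bar> \<le> ?x" if "0 \<le> u" "u \<le> real (N n j) * T" for i j u
            using h that by blast
          show "routing_curve n i k = inflow n i j0 (real k / (real n * lam i))" for i k by (rule routing_curve_def)
          show "inflow n i j0 0 = 0" for i by (simp add: inflow_def)
          show "0 \<le> inflow n i j0 v - inflow n i j0 u \<and> inflow n i j0 v - inflow n i j0 u \<le> real n * lam i * (v - u)"
            if "0 \<le> u" "u \<le> v" "v \<le> T + 1" for i u v
            by (rule inflow_slope[OF that s(2,3)])
          show "inflow n i j0 t + inflow n i j1 t = real n * lam i * t" for i t by (rule inflow_sum)
          show "continuous_on {0..T} (target n i j)" for i j by (rule target_cont)
          show "target n i j t = target n i j 0 + inflow n i j t - \<mu> i j * integral {0..t} (target n i j)" if "0 \<le> t" for i j t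
            by (rule target_eq[OF that])
          show "\<bar>real (assignment0 n i j) - target n i j 0\<bar> \<le> 1" for i j by (rule P0)
          show "(\<Sum>i\<in>UNIV. target n i j t) + real CARD('i) * (2 * (2 + 3 * ?x) * ?E + 1) \<le> real (N n j)"
            if "0 \<le> t" "t \<le> T" for j t
            using room_aux[OF that, of j] gain0[OF that(1)] by linarith
          show "(\<Sum>i\<in>UNIV. target n i j t) + real CARD('i) * (2 * (2 + 3 * ?x) * ?E + 1) +
            (2 * ?E + 1) * (\<Sum>i\<in>UNIV. real (routed_path.Y0 (X0 n) (assignment0 n) i)) \<le> real (N n j)"
            if "amplitude n < t" "t \<le> T" for j t
          proof -
            have t0: "0 \<le> t" using that(1) amplitude_pos[OF n] by linarith
            have "(2 * ?E + 1) * (\<Sum>i\<in>UNIV. real (Y0 i)) \<le>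
                (2 * ?E + 1) * (\<Sum>i\<in>UNIV. (\<bar>x i\<bar> + 1) * sqrt (real n) + 2 * slack n + 2)"
              unfolding Y0_def by (intro mult_left_mono sum_mono Y0) (simp add: add_nonneg_nonneg)
            also have "\<dots> \<le> real n * amplitude n * (\<kappa> / 8 * amplitude n)" by (rule s(5))
            also have "\<dots> \<le> real n * amplitude n * (\<kappa> / 8 * t)"
              using that(1) rn amplitude_pos[OF n] kappa by (intro mult_left_mono) auto
            finally show ?thesis using room_aux[OF t0 that(2), of j] by linarith
          qed
        qed
        show "\<forall>i. Y n t \<omega> i = 0"
          using queue_empties[OF s(7)] t s(6) by simp
      qed
    qed
  qed
qed

end

theorem theorem2p4:
  fixes lamn :: "nat \<Rightarrow> 'i::finite \<Rightarrow> real"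
    and mun :: "nat \<Rightarrow> 'i \<Rightarrow> 'j::finite \<Rightarrow> real"
    and N :: "nat \<Rightarrow> 'j \<Rightarrow> nat"
    and E :: "('i \<times> 'j) set"
    and lam lamhat :: "'i \<Rightarrow> real"
    and \<mu> muhat :: "'i \<Rightarrow> 'j \<Rightarrow> real"
    and \<nu> :: "'j \<Rightarrow> real"
    and \<xi> :: "'i \<Rightarrow> 'j \<Rightarrow> real"
    and \<rho> :: real
    and M :: "'w measure"
    and U :: "'i \<Rightarrow> nat \<Rightarrow> 'w \<Rightarrow> real"
    and S :: "nat \<Rightarrow> 'i \<Rightarrow> 'j \<Rightarrow> real \<Rightarrow> 'w \<Rightarrow> nat"
    and X0 :: "nat \<Rightarrow> 'i \<Rightarrow> nat"
    and x :: "'i \<Rightarrow> real"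
  assumes "queueing_model lamn mun N E lam lamhat \<mu> muhat \<nu> \<xi> \<rho> M U S X0 x"
    and "CARD('i) = 2" and "CARD('j) = 2"
    and "\<exists>c \<in> simple_cycles E (basic_activities E \<xi>).
           (\<chi> i. 1) \<bullet> cyc_vec E (basic_activities E \<xi>) \<mu> c < 0"
  shows "\<exists>(\<Psi>0 :: nat \<Rightarrow> 'i \<Rightarrow> 'j \<Rightarrow> nat) (F :: nat \<Rightarrow> 'i \<Rightarrow> 'j \<Rightarrow> ('i, 'j) routing_map)
            (R :: nat \<Rightarrow> 'i \<Rightarrow> nat \<Rightarrow> 'w \<Rightarrow> real).
    (\<forall>n\<ge>1. \<exists>X Y Z \<Psi>.
       N_SCP M E (N n) (X0 n) (\<lambda>i. arrivals (lamn n i) (U i)) (S n) (\<Psi>0 n) (F n) (R n) X Y Z \<Psi>) \<and>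
    (\<forall>X Y Z \<Psi>.
       (\<forall>n\<ge>1. N_SCP M E (N n) (X0 n) (\<lambda>i. arrivals (lamn n i) (U i)) (S n) (\<Psi>0 n) (F n) (R n)
                 (X n) (Y n) (Z n) (\<Psi> n)) \<longrightarrow>
       (\<forall>\<epsilon> T. 0 < \<epsilon> \<and> \<epsilon> < T \<longrightarrow>
          (\<lambda>n. measure M {\<omega> \<in> space M. \<forall>t\<in>{\<epsilon>..T}. \<forall>i. Y n t \<omega> i = 0}) \<longlonglongrightarrow> 1))"
proof -
  interpret queueing_model lamn mun N E lam lamhat \<mu> muhat \<nu> \<xi> \<rho> M U S X0 x by fact
  let ?Eb = "basic_activities E \<xi>"
  obtain c where c: "c \<in> simple_cycles E ?Eb" and neg: "(\<chi> i. 1) \<bullet> cyc_vec E ?Eb \<mu> c < 0"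
    using assms(4) by blast
  obtain i0 i1 j0 j1 where ij: "i0 \<noteq> i1" "j0 \<noteq> j1" "UNIV = {i0, i1}" "UNIV = {j0, j1}" "E = UNIV"
    "(i0, j0) \<notin> ?Eb" "(i0, j1) \<in> ?Eb" "(i1, j0) \<in> ?Eb" "(i1, j1) \<in> ?Eb"
    "(\<chi> i. 1) \<bullet> cyc_vec E ?Eb \<mu> c = \<mu> i0 j1 + \<mu> i1 j0 - \<mu> i0 j0 - \<mu> i1 j1"
    by (rule simple_cycle_2x2[OF assms(2,3) c, of \<mu>]) blast
  have "0 \<le> \<xi> i0 j0" using optimal by (simp add: lp_optimal_def lp_feasible_def)
  then have "\<xi> i0 j0 = 0" using ij(5,6) by (simp add: basic_activities_def)
  moreover have "0 < \<xi> i0 j1" "0 < \<xi> i1 j0" "0 < \<xi> i1 j1" using ij(7-9) by (simp_all add: basic_activities_def)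
  moreover have "\<mu> i0 j1 + \<mu> i1 j0 < \<mu> i0 j0 + \<mu> i1 j1" using neg ij(10) by linarith
  ultimately interpret profitable_cycle lamn mun N E lam lamhat \<mu> muhat \<nu> \<xi> \<rho> M U S X0 x i0 i1 j0 j1
    using ij(1-5) by unfold_locales
  have lim: "(\<lambda>n. prob {\<omega> \<in> space M. \<forall>t\<in>{\<epsilon>..T}. \<forall>i. Y n t \<omega> i = 0}) \<longlonglongrightarrow> 1"
    if scp: "\<forall>n\<ge>1. N_SCP M E (N n) (X0 n) (arr n) (S n) (assignment0 n) (policy n) (marks n) (X n) (Y n) (Z n) (\<Psi> n)"
      and e: "0 < \<epsilon>" "\<epsilon> < T" for X Y Z \<Psi> \<epsilon> T
  proof (rule whp_prob)
    show "whp (\<lambda>n \<omega>. \<forall>t\<in>{\<epsilon>..T}. \<forall>i. Y n t \<omega> i = 0)"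
      by (rule queue_empty_whp[where X=X and Z=Z and \<Psi>=\<Psi>]) (use scp e in simp_all)
    fix n :: nat assume "1 \<le> n"
    then have s: "N_SCP M E (N n) (X0 n) (arr n) (S n) (assignment0 n) (policy n) (marks n) (X n) (Y n) (Z n) (\<Psi> n)"
      using scp by blast
    have m: "(\<lambda>\<omega>. Y n t \<omega> i) \<in> M \<rightarrow>\<^sub>M count_space UNIV" if "0 \<le> t" for t i
      using s that unfolding N_SCP_def by blast
    have "AE \<omega> in M. \<forall>i. cadlag (\<lambda>t. Y n t \<omega> i)"
      using s unfolding N_SCP_def by (elim conjE) (erule eventually_mono, elim conjE)
    then show "{\<omega>\<in>space M. \<forall>t\<in>{\<epsilon>..T}. \<forall>i. Y n t \<omega> i = 0} \<in> events"
      using e m by (intro vanishing_event_measurable) (auto intro: complete_measure_axioms)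
  qed
  show ?thesis
  proof (intro exI conjI)
    show "\<forall>n\<ge>1. \<exists>X Y Z \<Psi>. N_SCP M E (N n) (X0 n) (arr n) (S n) (assignment0 n) (policy n) (marks n) X Y Z \<Psi>"
      using process_exists by blast
    show "\<forall>X Y Z \<Psi>.
       (\<forall>n\<ge>1. N_SCP M E (N n) (X0 n) (arr n) (S n) (assignment0 n) (policy n) (marks n) (X n) (Y n) (Z n) (\<Psi> n)) \<longrightarrow>
       (\<forall>\<epsilon> T. 0 < \<epsilon> \<and> \<epsilon> < T \<longrightarrow>
          (\<lambda>n. measure M {\<omega> \<in> space M. \<forall>t\<in>{\<epsilon>..T}. \<forall>i. Y n t \<omega> i = 0}) \<longlonglongrightarrow> 1)"
      using lim by blast
  qed
qed

end
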